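(* Let $d\ge1$, $p_d:=\frac{2d+1}{4d}$, $p\in(p_d,1)$ and $a:=\frac{2dp-1}{2d-1}\in(1/2,1)$. Let $W_d$ and $Y_d$ be the random vectors defined in the context, let $w:=\sum_{i=1}^dW_d(i)$, and let $\varphi=f+\mathrm{i}g$ ($f,g$ real-valued) be the characteristic function of $w$. Then $$\limsup_{|x|\to\infty}|x|^{1/a}|f(x)|<\infty,\qquad\limsup_{|x|\to\infty}|x|^{1/a}|g(x)|<\infty .$$ In particular, $\sup_{x\in\mathbb{R}}|x|^{1/a}|\varphi(x)|<\infty$ and $|\varphi|\in L^1(\mathbb{R})$. Thus $w$ admits a density $p_w$, given by $$p_w(x)=\frac1{2\pi}\int_{\mathbb{R}}e^{-\mathrm{i}xz}\varphi(z)\,dz,\qquad x\in\mathbb{R},$$ whence $\mathbb{P}(W_d=0)=\mathbb{P}(Y_d=0)=0$. Moreover, the distribution of $W_d$ is infinitely divisible.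
   Context: Continuous-time urn (branching) process: consider an urn whose balls carry one of the $2d$ directions $e_1,-e_1,\dots,e_d,-e_d$ ($e_1,\dots,e_d$ the standard basis of $\mathbb{R}^d$). At time $0$ the urn contains exactly one ball, of direction $e_1$. Each ball present is equipped with an $\mathrm{Exp}(1)$-distributed random clock, all clocks being independent. When the clock of a ball of some direction rings, one adds to the urn a new ball, which has the same direction with probability $p$ and each of the $2d-1$ other directions with probability $\frac{1-p}{2d-1}$; the clock that rang is replaced by a new independent $\mathrm{Exp}(1)$ clock, and the added ball receives its own independent $\mathrm{Exp}(1)$ clock. For $t\ge0$ let $U_t(i)$ and $U_t(-i)$ be the numbers of balls of direction $e_i$ and $-e_i$, respectively, at time $t$. It is known that for $p>p_d$ the limit $$W_d:=\lim_{t\to\infty}\frac{(U_t(i)-U_t(-i))_{1\le i\le d}}{e^{at}}\in\mathbb{R}^d$$ exists almost surely, and that $\mathbb{E}W_d=e_1$. If $0=\tau_0<\tau_1<\tau_2<\cdots$ are the successive jump times of the process $U$, then $S_0:=0$, $S_{n+1}:=\sum_{i=1}^d(U_{\tau_n}(i)-U_{\tau_n}(-i))e_i$, $n\ge0$, is a multi-dimensional elephant random walk on $\mathbb{Z}^d$ with parameter $p$, i.e. $S_1=\sigma_1=e_1$ and, for each $n\ge1$, the step $\sigma_{n+1}=S_{n+1}-S_n$ equals a uniformly chosen previous step $\sigma_{n'}$, $n'\in\{1,\dots,n\}$, with probability $p$ and each of the other elements of $\{\pm e_1,\dots,\pm e_d\}$ with probability $\frac{1-p}{2d-1}$. It is known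 that for $p>p_d$ the limit $Y_d:=\lim_{n\to\infty}S_n/n^a$ exists almost surely, that $\xi:=\lim_{n\to\infty} n e^{-\tau_n}$ exists almost surely and is $\mathrm{Exp}(1)$-distributed and independent of $Y_d$, and that $W_d=Y_d\,\xi^a$ almost surely. *)

theory Defs
  imports "HOL-Probability.Probability"
begin

text \<open>The \<open>2d\<close> directions: \<open>Pos i\<close> stands for \<open>e\<^sub>i\<close> and \<open>Neg i\<close> for \<open>-e\<^sub>i\<close>,
  the index type \<open>'d\<close> having \<open>d = CARD('d)\<close> elements.\<close>

datatype 'd direction = Pos 'd | Neg 'd

text \<open>Balls are named by their genealogy. The initial ball is \<open>[]\<close>, and \<open>k # b\<close> is the ball that
  is added when a clock of ball \<open>b\<close> rings for the \<open>k\<close>-th time (counting from \<open>0\<close>).\<close>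

type_synonym ball = "nat list"

text \<open>The randomness that drives the urn: \<open>T b k\<close> is the duration of the \<open>k\<close>-th clock of ball \<open>b\<close>,
  and \<open>D b v\<close> is the direction that ball \<open>b\<close> receives in case its parent has direction \<open>v\<close>. Only
  the mark \<open>D b v\<close> for the actual direction \<open>v\<close> of the parent is ever used.\<close>

locale urn = prob_space M for M :: "'a measure" +
  fixes p :: real
    and T :: "ball \<Rightarrow> nat \<Rightarrow> 'a \<Rightarrow> real"
    and D :: "ball \<Rightarrow> 'd::finite direction \<Rightarrow> 'a \<Rightarrow> 'd direction"
  assumes clock_exponential: "distributed M lborel (T b k) (exponential_density 1)"
    and clocks_indep: "indep_vars (\<lambda>_. borel) (\<lambda>(b, k). T b k) UNIV"
    and mark_law: "prob {\<omega> \<in> space M. D b v \<omega> = u} =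
      (if u = v then p else (1 - p) / (2 * real CARD('d) - 1))"
    and marks_indep: "indep_vars (\<lambda>_. count_space UNIV) (\<lambda>(b, v). D b v) UNIV"
    and clocks_marks_indep: "indep_set
      (sets (vimage_algebra (space M) (\<lambda>\<omega> (b, k). T b k \<omega>) (\<Pi>\<^sub>M _\<in>UNIV. borel)))
      (sets (vimage_algebra (space M) (\<lambda>\<omega> (b, v). D b v \<omega>) (\<Pi>\<^sub>M _\<in>UNIV. count_space UNIV)))"

primrec birth_time :: "(ball \<Rightarrow> nat \<Rightarrow> 'a \<Rightarrow> real) \<Rightarrow> ball \<Rightarrow> 'a \<Rightarrow> real" where
  "birth_time T [] \<omega> = 0"
| "birth_time T (k # b) \<omega> = birth_time T b \<omega> + (\<Sum>j\<le>k. T b j \<omega>)"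

text \<open>The argument \<open>i1\<close> is the index of the distinguished basis vector \<open>e\<^sub>1\<close>.\<close>

primrec ball_direction ::
  "'d \<Rightarrow> (ball \<Rightarrow> 'd direction \<Rightarrow> 'a \<Rightarrow> 'd direction) \<Rightarrow> ball \<Rightarrow> 'a \<Rightarrow> 'd direction" where
  "ball_direction i1 D [] \<omega> = Pos i1"
| "ball_direction i1 D (k # b) \<omega> = D (k # b) (ball_direction i1 D b \<omega>) \<omega>"

text \<open>The set below is almost surely finite for all \<open>t\<close>; \<open>card\<close> gives \<open>0\<close> on the exceptional
  null event.\<close>

definition urn_count ::
  "'d \<Rightarrow> (ball \<Rightarrow> nat \<Rightarrow> 'a \<Rightarrow> real) \<Rightarrow> (ball \<Rightarrow> 'd direction \<Rightarrow> 'a \<Rightarrow> 'd direction) \<Rightarrow>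
    real \<Rightarrow> 'a \<Rightarrow> 'd direction \<Rightarrow> nat" where
  "urn_count i1 T D t \<omega> v =
    card {b. birth_time T b \<omega> \<le> t \<and> ball_direction i1 D b \<omega> = v}"

definition urn_difference ::
  "'d::finite \<Rightarrow> (ball \<Rightarrow> nat \<Rightarrow> 'a \<Rightarrow> real) \<Rightarrow> (ball \<Rightarrow> 'd direction \<Rightarrow> 'a \<Rightarrow> 'd direction) \<Rightarrow>
    real \<Rightarrow> 'a \<Rightarrow> real ^ 'd" where
  "urn_difference i1 T D t \<omega> =
    (\<chi> i. real (urn_count i1 T D t \<omega> (Pos i)) - real (urn_count i1 T D t \<omega> (Neg i)))"

primrec jump_time ::
  "'d \<Rightarrow> (ball \<Rightarrow> nat \<Rightarrow> 'a \<Rightarrow> real) \<Rightarrow> (ball \<Rightarrow> 'd direction \<Rightarrow> 'a \<Rightarrow> 'd direction) \<Rightarrow>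
    nat \<Rightarrow> 'a \<Rightarrow> real" where
  "jump_time i1 T D 0 \<omega> = 0"
| "jump_time i1 T D (Suc n) \<omega> =
    Inf {t. jump_time i1 T D n \<omega> < t \<and>
            urn_count i1 T D t \<omega> \<noteq> urn_count i1 T D (jump_time i1 T D n \<omega>) \<omega>}"

text \<open>The elephant random walk embedded in the urn at its jump times.\<close>

definition elephant_walk ::
  "'d::finite \<Rightarrow> (ball \<Rightarrow> nat \<Rightarrow> 'a \<Rightarrow> real) \<Rightarrow> (ball \<Rightarrow> 'd direction \<Rightarrow> 'a \<Rightarrow> 'd direction) \<Rightarrow>
    nat \<Rightarrow> 'a \<Rightarrow> real ^ 'd" where
  "elephant_walk i1 T D n \<omega> =
    (case n of 0 \<Rightarrow> 0 | Suc m \<Rightarrow> urn_difference i1 T D (jump_time i1 T D m \<omega>) \<omega>)"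

definition infinitely_divisible :: "'b::euclidean_space measure \<Rightarrow> bool" where
  "infinitely_divisible \<mu> \<longleftrightarrow>
    (\<forall>n::nat. 1 \<le> n \<longrightarrow>
      (\<exists>\<nu>. prob_space \<nu> \<and> sets \<nu> = sets borel \<and>
        \<mu> = distr (\<Pi>\<^sub>M i\<in>{..<n}. \<nu>) borel (\<lambda>x. \<Sum>i<n. x i)))"

end

theory Submission
  imports Defs
begin

text \<open>
  Let \<open>F\<^sub>v(t, \<zeta>)\<close> be the characteristic function of the urn at time \<open>t\<close> when it starts with one ball of
  direction \<open>v\<close>. When the first clock rings, the urn splits into two independent fresh urns, whence
  \<open>\<partial>\<^sub>t F\<^sub>v = F\<^sub>v (\<Sum>\<^sub>u q(v, u) F\<^sub>u - 1)\<close>. Uniqueness for this system gives the symmetries of the law, and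
  differential inequalities give \<open>1 - Re F = O(|\<zeta>|\<^sup>2 exp (2at))\<close> and a lower bound for \<open>|Im F|\<close>. These
  survive in the limit \<open>t \<rightarrow> \<infinity>\<close> with \<open>\<zeta>\<close> replaced by \<open>exp (-at) \<zeta>\<close>: \<open>W\<close> has a second moment and
  is not degenerate.

  Along a ray, \<open>h(s) = \<phi>(exp (as))\<close> satisfies \<open>h' = h ((1 - a) Re h + a h - 1)\<close>, so that
  \<open>(|h|\<^sup>2)' = - 2 (1 - Re h) |h|\<^sup>2\<close>. Since \<open>Re h \<le> |h|\<close>, the function \<open>|h| exp s / (1 - |h|)\<close> decreases,
  which is the bound \<open>|\<phi>(x)| = O(x powr (-1/a))\<close>. In general \<open>h' = h (\<psi> - 1)\<close> with \<open>\<psi>\<close> the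
  characteristic function of the first child's limit; a shot noise with marks of law \<open>\<psi>\<close> and rate \<open>1/n\<close>
  solves the equation with \<open>\<psi> - 1\<close> replaced by \<open>(\<psi> - 1)/n\<close>, so its \<open>n\<close>-th convolution power has
  characteristic function \<open>h\<close>.
\<close>

text \<open>The limit has no equation of its own: pointwise convergence of characteristic functions
  says nothing about derivatives. So the equation is carried over in integrated form, multiplied by
  exp s, where dominated convergence applies, and is differentiated again afterwards. In the limit a
  shift of time becomes a dilation of the argument; the equation then lives on rays and holds for
  all real s.

  The number a is the eigenvalue of q on functions odd under reversal of directions. Imaginary parts
  are odd and grow at most like exp (a s). Real parts obey a linear inequality with rate 2 d \<beta>
  + a = 1 and forcing of order exp (2 a s); the forcing dominates because 2 a > 1, and this is where
  the lower bound on p enters. The lower bound on Im F gives h \<noteq> 0 and Re h < 1, so that |h|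
  drops below 1 and the quotient for the decay makes sense. The second moment makes the shot noise
  converge.

  For Y: the mean population is at most exp s, so by Fatou the population is almost surely O(exp m)
  at infinitely many integer times m. Comparing the two scalings at such times, Y = 0 would force W
  = 0.\<close>

subsection \<open>Densities from integrable characteristic functions\<close>

text \<open>Levy's formula gives the mass of an interval only when its endpoints carry no atom, and
  only as a limit of truncated integrals. Integrability makes the limit an absolutely convergent
  integral, and Fubini turns that into the integral of the bounded continuous function
  \<open>p\<close>. Boundedness then excludes atoms, and continuity excludes negative
  values.\<close>

lemma integrable_char_density:
  fixes \<mu> :: "real measure"
  assumes "real_distribution \<mu>" and int_char: "integrable lborel (\<lambda>x. cmod (char \<mu> x))"
  obtains p_w :: "real \<Rightarrow> real" where "\<And>x. 0 \<le> p_w x" "p_w \<in> borel_measurable borel"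
    "\<mu> = density lborel (\<lambda>x. ennreal (p_w x))"
    "\<And>x. complex_of_real (p_w x) =
       1 / (2 * complex_of_real pi) * (CLBINT z. iexp (- (x * z)) * char \<mu> z)"
proof -
  interpret real_distribution \<mu> by fact
  let ?\<phi> = "char \<mu>"
  have \<phi>_meas [measurable]: "?\<phi> \<in> borel_measurable borel"
    by (rule char_measurable)
  have int: "integrable lborel (\<lambda>z. iexp (- (x * z)) * ?\<phi> z)" for x
    by (rule Bochner_Integration.integrable_bound[OF int_char]) (auto simp: norm_mult)
  define P where "P x = (CLBINT z. iexp (- (x * z)) * ?\<phi> z) / (2 * pi)" for x
  define C where "C = (LBINT z. cmod (?\<phi> z)) / (2 * pi)"
  have P_bound: "cmod (P x) \<le> C" for x
  proof -
    have "cmod (CLBINT z. iexp (- (x * z)) * ?\<phi> z) \<le> (LBINT z. cmod (iexp (- (x * z)) * ?\<phi> z))"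
      by (rule integral_norm_bound)
    also have "\<dots> = (LBINT z. cmod (?\<phi> z))"
      by (simp add: norm_mult)
    finally show ?thesis
      by (simp add: P_def C_def norm_divide divide_right_mono)
  qed
  have char_cnj: "?\<phi> (- z) = cnj (?\<phi> z)" for z
  proof -
    have "cnj (?\<phi> z) = (CLINT x | \<mu>. cnj (iexp (z * x)))"
      unfolding char_def by simp
    also have "\<dots> = ?\<phi> (- z)"
      unfolding char_def by (simp add: exp_cnj)
    finally show ?thesis ..
  qed
  have P_real: "cnj (P x) = P x" for x
  proof -
    have "cnj (CLBINT z. iexp (- (x * z)) * ?\<phi> z) = (CLBINT z. cnj (iexp (- (x * z)) * ?\<phi> z))"
      by (simp del: complex_cnj_mult)
    also have "\<dots> = (CLBINT z. iexp (x * z) * ?\<phi> (- z))"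
      by (intro Bochner_Integration.integral_cong) (simp_all add: exp_cnj char_cnj)
    also have "\<dots> = (CLBINT z. iexp (- (x * z)) * ?\<phi> z)"
      by (subst lborel_integral_real_affine[where c = "-1" and t = 0]) auto
    finally show ?thesis by (simp add: P_def)
  qed
  define p where "p x = Re (P x)" for x
  have P_p: "P x = complex_of_real (p x)" for x
    using P_real[of x] unfolding p_def by (metis Reals_cnj_iff of_real_Re)
  have P_cont: "isCont P x" for x
    unfolding continuous_at_sequentially
  proof (intro allI impI)
    fix X :: "nat \<Rightarrow> real" assume X: "X \<longlonglongrightarrow> x"
    have "(\<lambda>n. CLBINT z. iexp (- (X n * z)) * ?\<phi> z) \<longlonglongrightarrow> (CLBINT z. iexp (- (x * z)) * ?\<phi> z)"
      by (rule integral_dominated_convergence[where w = "\<lambda>z. cmod (?\<phi> z)"])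
        (auto simp: norm_mult int_char intro!: tendsto_intros X)
    then show "(P \<circ> X) \<longlonglongrightarrow> P x"
      unfolding comp_def P_def by (intro tendsto_intros) auto
  qed
  have p_cont: "isCont p x" for x
    unfolding p_def by (intro isCont_Re P_cont)
  have p_meas [measurable]: "p \<in> borel_measurable borel"
    by (intro borel_measurable_continuous_onI) (auto simp: continuous_on_eq_continuous_at p_cont)
  have p_bound: "\<bar>p x\<bar> \<le> C" for x
    using P_bound[of x] by (simp add: P_p)
  have p_int: "integrable lborel (\<lambda>x. indicator {a..b} x * p x)" for a b
    using integrableI_bounded_set_indicator[of "{a..b}" lborel p C] p_bound
    by (auto simp: emeasure_lborel_Icc_eq)
  have ind_int: "integrable lborel (\<lambda>x. indicator {a..b} x * c)" for a b c :: real
    by (intro integrable_mult_left integrable_real_indicator) (auto simp: emeasure_lborel_Icc_eq)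
  have inversion: "prob {a<..b} = (LBINT x. indicator {a..b} x * p x)"
    if "a < b" "prob {a} = 0" "prob {b} = 0" for a b
  proof -
    \<comment> \<open>Away from \<open>t = 0\<close>, Levy's kernel \<open>F t\<close> is the
      integral of \<open>E t\<close>; exchanging the two integrals therefore replaces the kernel by
      the density.\<close>
    define F where "F t = (iexp (-(t * a)) - iexp (-(t * b))) / (\<i> * t)" for t :: real
    define E where "E t x = indicator {a..b} x *\<^sub>R iexp (-(t * x))" for t x :: real
    have F_meas [measurable]: "F \<in> borel_measurable borel"
      unfolding F_def by measurable
    have E_meas [measurable]: "(\<lambda>(t, x). E t x) \<in> borel_measurable (borel \<Otimes>\<^sub>M borel)"
      unfolding E_def by measurable
    have norm_E: "cmod (E t x) = indicator {a..b} x" for t x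
      by (simp add: E_def)
    have FE: "F t = (CLBINT x. E t x)" if "t \<noteq> 0" for t
    proof -
      have "(CLBINT x. E t x) = exp (- (\<i> * t * of_real b)) / (- (\<i> * t)) - exp (- (\<i> * t * of_real a)) / (- (\<i> * t))"
        unfolding E_def
      proof (rule integral_FTC_atLeastAtMost)
        show "((\<lambda>x. exp (- (\<i> * t * of_real x)) / (- (\<i> * t))) has_vector_derivative iexp (-(t * x))) (at x within {a..b})" for x
          using that by (intro has_vector_derivative_real_field[where f = "\<lambda>z. exp (- (\<i> * t * z)) / (- (\<i> * t))"])
            (auto intro!: derivative_eq_intros simp: mult.assoc)
      qed (use \<open>a < b\<close> in \<open>auto intro!: continuous_intros\<close>)
      then show ?thesis using that by (simp add: F_def field_simps)
    qed
    have norm_F: "cmod (F t) \<le> b - a" if "t \<noteq> 0" for t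
      using Levy_Inversion_aux2[of "-b" "-a" t] \<open>a < b\<close> that by (simp add: F_def)
    have AE0: "AE t in lborel. t \<noteq> (0::real)"
      by (rule AE_lborel_singleton)
    have int_b: "integrable lborel (\<lambda>t. (b - a) * cmod (?\<phi> t))"
      using int_char by simp
    have lim1: "(\<lambda>T::nat. CLBINT t=-real T..real T. F t * ?\<phi> t) \<longlonglongrightarrow> (CLBINT t. F t * ?\<phi> t)"
    proof -
      have "(\<lambda>T::nat. CLBINT t. indicator {-real T<..<real T} t *\<^sub>R (F t * ?\<phi> t)) \<longlonglongrightarrow> (CLBINT t. F t * ?\<phi> t)"
      proof (rule integral_dominated_convergence[OF _ _ int_b])
        show "AE t in lborel. (\<lambda>T::nat. indicator {-real T<..<real T} t *\<^sub>R (F t * ?\<phi> t)) \<longlonglongrightarrow> F t * ?\<phi> t"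
        proof (rule AE_I2)
          fix t :: real
          have "eventually (\<lambda>T::nat. \<bar>t\<bar> < real T) sequentially"
            using filterlim_real_sequentially by (simp add: filterlim_at_top_dense)
          then have "eventually (\<lambda>T::nat. indicator {-real T<..<real T} t *\<^sub>R (F t * ?\<phi> t) = F t * ?\<phi> t) sequentially"
            by eventually_elim (auto simp: indicator_def)
          then show "(\<lambda>T::nat. indicator {-real T<..<real T} t *\<^sub>R (F t * ?\<phi> t)) \<longlonglongrightarrow> F t * ?\<phi> t"
            by (rule tendsto_eventually)
        qed
        show "AE t in lborel. cmod (indicator {-real T<..<real T} t *\<^sub>R (F t * ?\<phi> t)) \<le> (b - a) * cmod (?\<phi> t)" for T :: nat
          using AE0
        proof eventually_elim
          fix t :: real assume "t \<noteq> 0"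
          then have "cmod (F t) * cmod (?\<phi> t) \<le> (b - a) * cmod (?\<phi> t)"
            by (intro mult_right_mono norm_F) auto
          then show "cmod (indicator {-real T<..<real T} t *\<^sub>R (F t * ?\<phi> t)) \<le> (b - a) * cmod (?\<phi> t)"
            using \<open>a < b\<close> by (auto simp: indicator_def norm_mult)
        qed
      qed auto
      then show ?thesis
        by (simp add: interval_lebesgue_integral_def set_lebesgue_integral_def)
    qed
    have "(\<lambda>T::nat. 1 / (2 * pi) * (CLBINT t=-real T..real T. F t * ?\<phi> t)) \<longlonglongrightarrow> complex_of_real (prob {a<..b})"
      using Levy_Inversion[of a b] that by (simp add: F_def)
    moreover have "(\<lambda>T::nat. 1 / (2 * pi) * (CLBINT t=-real T..real T. F t * ?\<phi> t)) \<longlonglongrightarrow> 1 / (2 * pi) * (CLBINT t. F t * ?\<phi> t)"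
      by (intro tendsto_intros lim1)
    ultimately have "complex_of_real (prob {a<..b}) = 1 / (2 * pi) * (CLBINT t. F t * ?\<phi> t)"
      by (rule LIMSEQ_unique)
    also have "(CLBINT t. F t * ?\<phi> t) = (CLBINT t. CLBINT x. E t x * ?\<phi> t)"
      using AE0 by (intro integral_cong_AE) (auto elim!: eventually_mono simp: FE)
    also have "\<dots> = (CLBINT x. CLBINT t. E t x * ?\<phi> t)"
    proof (rule lborel_pair.Fubini_integral)
      show "integrable (lborel \<Otimes>\<^sub>M lborel) (case_prod (\<lambda>x t. E t x * ?\<phi> t))"
      proof (rule lborel_pair.Fubini_integrable)
        have *: "(LBINT t. cmod (E t x * ?\<phi> t)) = indicator {a..b} x * (LBINT t. cmod (?\<phi> t))" for x
          by (simp add: norm_mult norm_E)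
        show "integrable lborel (\<lambda>x. LBINT t. cmod (case (x, t) of (x, t) \<Rightarrow> E t x * ?\<phi> t))"
          by (simp only: prod.case * ind_int)
        show "AE x in lborel. integrable lborel (\<lambda>t. case (x, t) of (x, t) \<Rightarrow> E t x * ?\<phi> t)"
        proof (rule AE_I2)
          fix x
          show "integrable lborel (\<lambda>t. case (x, t) of (x, t) \<Rightarrow> E t x * ?\<phi> t)"
            using integrable_scaleR_right[OF int[of x], of "indicator {a..b} x"]
            by (simp add: E_def mult.commute)
        qed
      qed (simp add: case_prod_beta)
    qed
    also have "\<dots> = (CLBINT x. indicator {a..b} x *\<^sub>R (2 * pi * P x))"
      unfolding P_def E_def by (intro Bochner_Integration.integral_cong) (auto simp: indicator_def mult.commute)
    also have "\<dots> = (CLBINT x. of_real (2 * pi * (indicator {a..b} x * p x)))"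
      by (intro Bochner_Integration.integral_cong) (auto simp: indicator_def P_p)
    also have "\<dots> = of_real (2 * pi * (LBINT x. indicator {a..b} x * p x))"
      by (simp only: integral_complex_of_real integral_mult_right_zero)
    finally have "complex_of_real (prob {a<..b}) = of_real (LBINT x. indicator {a..b} x * p x)"
      by simp
    then show ?thesis by (simp only: of_real_eq_iff)
  qed
  have dense: "\<exists>x. l < x \<and> x < u \<and> prob {x} = 0" if "l < u" for l u
    using open_minus_countable[OF countable_support, of "{l<..<u}"] that by auto
  have no_atom: "prob {c} = 0" for c
  proof (rule ccontr)
    assume "prob {c} \<noteq> 0"
    then have pos: "prob {c} > 0" by (simp add: zero_less_measure_iff)
    have "C \<ge> 0" using p_bound[of 0] by linarith
    \<comment> \<open>Points without atoms within distance \<open>e\<close> of \<open>c\<close>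
      enclose mass at most \<open>2 * e * C\<close>, which is less than half of
      \<open>prob {c}\<close>; the \<open>+ 1\<close> covers \<open>C = 0\<close>.\<close>
    define e where "e = prob {c} / (4 * (C + 1))"
    have "e > 0" using pos \<open>C \<ge> 0\<close> by (simp add: e_def)
    obtain a where a: "c - e < a" "a < c" "prob {a} = 0" using dense[of "c - e" c] \<open>e > 0\<close> by auto
    obtain b where b: "c < b" "b < c + e" "prob {b} = 0" using dense[of c "c + e"] \<open>e > 0\<close> by auto
    have "prob {c} \<le> prob {a<..b}" using a b by (intro finite_measure_mono) auto
    also have "\<dots> = (LBINT x. indicator {a..b} x * p x)" using a b by (intro inversion) auto
    also have "\<dots> \<le> (LBINT x. indicator {a..b} x * C)"
      using p_bound by (intro integral_mono p_int ind_int mult_left_mono) (auto simp: abs_le_iff)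
    also have "\<dots> = (b - a) * C" using a b by simp
    also have "\<dots> \<le> 2 * e * C" using a b \<open>C \<ge> 0\<close> by (intro mult_right_mono) auto
    also have "\<dots> < prob {c}" proof -
      have "prob {c} = e * (4 * (C + 1))" using \<open>C \<ge> 0\<close> by (simp add: e_def)
      moreover have "0 \<le> e * C" using \<open>e > 0\<close> \<open>C \<ge> 0\<close> by simp
      ultimately show ?thesis using \<open>e > 0\<close> by (simp add: algebra_simps)
    qed
    finally show False by simp
  qed
  have p_nonneg: "0 \<le> p x" for x
  proof (rule ccontr)
    assume "\<not> 0 \<le> p x"
    then have "eventually (\<lambda>y. p y < p x / 2) (at x)"
      using p_cont[of x] by (intro order_tendstoD) (auto simp: isCont_def)
    then obtain e where e: "e > 0" "\<And>y. y \<noteq> x \<Longrightarrow> dist y x < e \<Longrightarrow> p y < p x / 2"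
      by (auto simp: eventually_at)
    have *: "p y \<le> p x / 2" if "y \<in> {x..x + e/2}" for y
      using e(2)[of y] that \<open>e > 0\<close> \<open>\<not> 0 \<le> p x\<close> by (cases "y = x") (auto simp: dist_real_def)
    have "0 \<le> prob {x<..x + e/2}" by simp
    also have "\<dots> = (LBINT y. indicator {x..x + e/2} y * p y)"
      using e by (intro inversion no_atom) auto
    also have "\<dots> \<le> (LBINT y. indicator {x..x+e/2} y * (p x / 2))"
      using * by (intro integral_mono p_int ind_int) (auto simp: indicator_def)
    also have "\<dots> = e / 2 * (p x / 2)" using e by simp
    also have "\<dots> < 0" using e \<open>\<not> 0 \<le> p x\<close> by (intro mult_pos_neg) auto
    finally show False by simp
  qed
  have eq: "\<mu> = density lborel (\<lambda>x. ennreal (p x))"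
  proof (rule measure_eqI_lessThan)
    fix x :: real
    have *: "emeasure \<mu> {x<..x + real n} = emeasure (density lborel p) {x<..x + real n}" for n
    proof (cases "n = 0")
      case False
      have "emeasure \<mu> {x<..x + real n} = ennreal (LBINT y. indicator {x..x + n} y * p y)"
        using False by (simp add: emeasure_eq_measure inversion no_atom)
      also have "\<dots> = (\<integral>\<^sup>+y. ennreal (indicator {x..x + n} y * p y) \<partial>lborel)"
        using p_int p_nonneg by (intro nn_integral_eq_integral[symmetric]) auto
      also have "\<dots> = (\<integral>\<^sup>+y. ennreal (p y) * indicator {x<..x + n} y \<partial>lborel)"
        using AE_lborel_singleton[of x] by (intro nn_integral_cong_AE) (auto elim!: eventually_mono simp: indicator_def)
      finally show ?thesis by (simp add: emeasure_density)
    qed auto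
    have U: "{x<..} = (\<Union>n. {x<..x + real n})"
    proof -
      have "\<exists>n::nat. y \<le> x + real n" for y :: real
        using real_arch_simple[of "y - x"] by (auto simp: algebra_simps)
      then show ?thesis by auto
    qed
    have inc: "incseq (\<lambda>n. {x<..x + real n})" by (auto simp: incseq_def)
    have 1: "(SUP n. emeasure \<mu> {x<..x + real n}) = emeasure \<mu> {x<..}"
      unfolding U by (intro SUP_emeasure_incseq inc) auto
    have 2: "(SUP n. emeasure (density lborel p) {x<..x + real n}) = emeasure (density lborel p) {x<..}"
      unfolding U by (intro SUP_emeasure_incseq inc) auto
    show "emeasure \<mu> {x<..} = emeasure (density lborel p) {x<..}"
      using 1 2 * by simp
    show "emeasure \<mu> {x<..} < \<infinity>" by (simp add: emeasure_eq_measure)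
  qed auto
  show ?thesis
    by (rule that[OF p_nonneg p_meas eq]) (simp add: P_p[symmetric] P_def)
qed

subsection \<open>Characteristic functions on Euclidean spaces\<close>

definition mchar :: "'b::euclidean_space measure \<Rightarrow> 'b \<Rightarrow> complex" where
  "mchar \<mu> \<zeta> = (CLINT x | \<mu>. iexp (\<zeta> \<bullet> x))"

text \<open>The functions whose integrals are determined by the characteristic function. They form
  an algebra, hence contain all polynomials in sines of linear forms, which is what
  Stone-Weierstrass asks for.\<close>

inductive trig_poly :: "('b::euclidean_space \<Rightarrow> complex) \<Rightarrow> bool" where
  trig_poly_exp: "trig_poly (\<lambda>x. iexp (\<zeta> \<bullet> x))"
| trig_poly_add: "trig_poly f \<Longrightarrow> trig_poly g \<Longrightarrow> trig_poly (\<lambda>x. f x + g x)"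
| trig_poly_scale: "trig_poly f \<Longrightarrow> trig_poly (\<lambda>x. c * f x)"

lemma trig_poly_const: "trig_poly (\<lambda>x. c)"
  using trig_poly_scale[OF trig_poly_exp[of 0], of c] by simp

lemma trig_poly_mult:
  assumes "trig_poly f" "trig_poly g"
  shows "trig_poly (\<lambda>x. f x * g x)"
  using assms(1)
proof (induction rule: trig_poly.induct)
  case (trig_poly_exp u)
  from assms(2) show ?case
  proof (induction rule: trig_poly.induct)
    case (trig_poly_exp v)
    have "(\<lambda>x. iexp (u \<bullet> x) * iexp (v \<bullet> x)) = (\<lambda>x. iexp ((u + v) \<bullet> x))"
      by (simp add: inner_add_left exp_add[symmetric] algebra_simps)
    then show ?case using trig_poly.trig_poly_exp by metis
  next
    case (trig_poly_add f g)
    then show ?case using trig_poly.trig_poly_add by (force simp: distrib_left)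
  next
    case (trig_poly_scale f c)
    then show ?case using trig_poly.trig_poly_scale[OF trig_poly_scale.IH, of c] by (simp add: mult.left_commute)
  qed
next
  case (trig_poly_add f g)
  then show ?case using trig_poly.trig_poly_add by (force simp: distrib_right)
next
  case (trig_poly_scale f c)
  then show ?case using trig_poly.trig_poly_scale[OF trig_poly_scale.IH, of c] by (simp add: mult.assoc)
qed

lemma trig_poly_sum:
  assumes "finite A" "\<And>i. i \<in> A \<Longrightarrow> trig_poly (f i)"
  shows "trig_poly (\<lambda>x. \<Sum>i\<in>A. f i x)"
  using assms by (induction A) (auto intro: trig_poly_const trig_poly_add)

lemma trig_poly_sin: "trig_poly (\<lambda>x. complex_of_real (sin (\<zeta> \<bullet> x)))"
proof -
  have "complex_of_real (sin (\<zeta> \<bullet> x)) =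
      (- \<i> / 2) * iexp (\<zeta> \<bullet> x) + (\<i> / 2) * iexp ((- \<zeta>) \<bullet> x)" for x
    by (simp add: Re_exp Im_exp complex_eq_iff)
  then show ?thesis
    by (simp only:) (intro trig_poly_add trig_poly_scale trig_poly_exp)
qed

lemma trig_poly_polynomial_sin:
  fixes S :: "'b::euclidean_space \<Rightarrow> 'b"
  assumes "real_polynomial_function P"
    and S_def: "\<And>x. S x = (\<Sum>b\<in>Basis. sin ((c *\<^sub>R b) \<bullet> x) *\<^sub>R b)"
  shows "trig_poly (\<lambda>x. complex_of_real (P (S x)))"
  using assms(1)
proof (induction rule: real_polynomial_function.induct)
  case (linear f)
  then interpret bounded_linear f .
  have "complex_of_real (f (S x)) = (\<Sum>b\<in>Basis. of_real (f b) * of_real (sin ((c *\<^sub>R b) \<bullet> x)))" for x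
    unfolding S_def by (simp add: sum scaleR mult.commute)
  then show ?case
    by (simp only:) (intro trig_poly_sum trig_poly_scale trig_poly_sin finite_Basis)
next
  case (const c)
  then show ?case by (rule trig_poly_const)
next
  case (add f g)
  then show ?case using trig_poly_add by (force simp: of_real_add)
next
  case (mult f g)
  then show ?case using trig_poly_mult by (force simp: of_real_mult)
qed

lemma integral_trig_poly_eq:
  fixes \<mu> \<nu> :: "'b::euclidean_space measure"
  assumes "trig_poly f" and "prob_space \<mu>" "prob_space \<nu>"
    and [measurable_cong]: "sets \<mu> = sets borel" "sets \<nu> = sets borel"
    and "mchar \<mu> = mchar \<nu>"
  shows "integrable \<mu> f \<and> integrable \<nu> f \<and> integral\<^sup>L \<mu> f = integral\<^sup>L \<nu> f"
  using assms(1)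
proof (induction rule: trig_poly.induct)
  case (trig_poly_exp u)
  interpret M: prob_space \<mu> by fact
  interpret N: prob_space \<nu> by fact
  show ?case
    using fun_cong[OF \<open>mchar \<mu> = mchar \<nu>\<close>, of u] unfolding mchar_def
    by (auto intro!: M.integrable_const_bound[where B = 1] N.integrable_const_bound[where B = 1])
qed auto

text \<open>Functions that fall linearly from 1 on a closed set to 0 at distance 1/n decrease to its
  indicator, and the closed sets are an intersection-stable generator of the Borel sets.\<close>

lemma measure_eqI_bounded_continuous:
  fixes \<mu> \<nu> :: "'b::euclidean_space measure"
  assumes "prob_space \<mu>" "prob_space \<nu>"
    and [measurable_cong]: "sets \<mu> = sets borel" "sets \<nu> = sets borel"
    and eq: "\<And>h :: 'b \<Rightarrow> real. continuous_on UNIV h \<Longrightarrow> (\<And>x. \<bar>h x\<bar> \<le> 1) \<Longrightarrow> integral\<^sup>L \<mu> h = integral\<^sup>L \<nu> h"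
  shows "\<mu> = \<nu>"
proof -
  interpret M: prob_space \<mu> by fact
  interpret N: prob_space \<nu> by fact
  have closed_eq: "emeasure \<mu> K = emeasure \<nu> K" if "closed K" for K
  \<comment> \<open>\<open>infdist x {}\<close> is 0, so for the empty set the approximants below
    would be constantly 1.\<close>
  proof (cases "K = {}")
    case False
    have [measurable]: "K \<in> sets borel" using that by auto
    define h where "h n x = max 0 (1 - real n * infdist x K)" for n x
    have h_cont: "continuous_on UNIV (h n)" for n
      unfolding h_def by (intro continuous_intros)
    have [measurable]: "h n \<in> borel_measurable borel" for n
      by (rule borel_measurable_continuous_onI[OF h_cont])
    have h_bound: "\<bar>h n x\<bar> \<le> 1" for n x
      by (auto simp: h_def infdist_nonneg)
    have h_lim: "(\<lambda>n. h n x) \<longlonglongrightarrow> indicator K x" for x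
    proof (cases "x \<in> K")
      case True
      then show ?thesis by (simp add: h_def)
    next
      case out: False
      then have pos: "infdist x K > 0"
        using in_closed_iff_infdist_zero[OF that False] infdist_nonneg[of x K] by force
      obtain n0 where n0: "1 < real n0 * infdist x K"
        using reals_Archimedean3[OF pos] by blast
      have "h n x = 0" if "n \<ge> n0" for n
      proof -
        have "real n0 * infdist x K \<le> real n * infdist x K"
          using that pos by (intro mult_right_mono) auto
        then show ?thesis using n0 by (simp add: h_def)
      qed
      then have "eventually (\<lambda>n. h n x = indicator K x) sequentially"
        using out by (auto simp: eventually_sequentially)
      then show ?thesis by (rule tendsto_eventually)
    qed
    have "(\<lambda>n. integral\<^sup>L \<mu> (h n)) \<longlonglongrightarrow> integral\<^sup>L \<mu> (indicator K)"
      using h_lim h_bound by (intro integral_dominated_convergence[where w = "\<lambda>_. 1"]) auto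
    moreover have "(\<lambda>n. integral\<^sup>L \<nu> (h n)) \<longlonglongrightarrow> integral\<^sup>L \<nu> (indicator K)"
      using h_lim h_bound by (intro integral_dominated_convergence[where w = "\<lambda>_. 1"]) auto
    ultimately have "integral\<^sup>L \<mu> (indicator K) = (integral\<^sup>L \<nu> (indicator K) :: real)"
      using eq[OF h_cont h_bound] LIMSEQ_unique by (simp add: LIMSEQ_unique)
    then show ?thesis by (simp add: M.emeasure_eq_measure N.emeasure_eq_measure)
  qed auto
  show ?thesis
  proof (rule measure_eqI_generator_eq[where E = "Collect closed" and \<Omega> = UNIV and A = "\<lambda>_. UNIV"])
    show "Int_stable (Collect closed :: 'b set set)" by (auto simp: Int_stable_def)
    show "sets \<mu> = sigma_sets UNIV (Collect closed)" "sets \<nu> = sigma_sets UNIV (Collect closed)"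
      using assms(3,4) by (simp_all add: borel_eq_closed)
  qed (auto simp: closed_eq)
qed

text \<open>Equality of the characteristic functions gives equality of all moments of the bounded vector
  \<open>(sin (x\<^sub>i / n))\<^sub>i\<close>, hence by Stone--Weierstrass of its law; and \<open>n sin (x\<^sub>i / n)\<close> tends to \<open>x\<^sub>i\<close>.\<close>

theorem mchar_eq_imp_measure_eq:
  fixes \<mu> \<nu> :: "'b::euclidean_space measure"
  assumes pr: "prob_space \<mu>" "prob_space \<nu>"
    and sets [measurable_cong]: "sets \<mu> = sets borel" "sets \<nu> = sets borel"
    and char: "mchar \<mu> = mchar \<nu>"
  shows "\<mu> = \<nu>"
proof (rule measure_eqI_bounded_continuous[OF pr sets])
  interpret M: prob_space \<mu> by fact
  interpret N: prob_space \<nu> by fact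
  fix h :: "'b \<Rightarrow> real"
  assume h_cont: "continuous_on UNIV h" and h_bound: "\<And>x. \<bar>h x\<bar> \<le> 1"
  have [measurable]: "h \<in> borel_measurable borel"
    by (rule borel_measurable_continuous_onI[OF h_cont])
  define S where "S n x = (\<Sum>b\<in>Basis. sin ((inverse (real n) *\<^sub>R b) \<bullet> x) *\<^sub>R b)" for n and x :: 'b
  have S_cont: "continuous_on UNIV (S n)" for n
    unfolding S_def by (intro continuous_intros)
  have [measurable]: "S n \<in> borel_measurable borel" for n
    by (rule borel_measurable_continuous_onI[OF S_cont])
  have S_box: "S n x \<in> cbox (- One) One" for n x
    by (auto simp: mem_box S_def inner_sum_left inner_Basis if_distrib sum.delta cong: if_cong)
  have S_eq: "(\<integral>x. h (real n *\<^sub>R S n x) \<partial>\<mu>) = (\<integral>x. h (real n *\<^sub>R S n x) \<partial>\<nu>)" for n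
  proof (rule ccontr)
    assume ne: "\<not> ?thesis"
    \<comment> \<open>A third of the gap: replacing \<open>h\<close> by the polynomial costs at most
      \<open>e\<close> under each law, which would bound the gap \<open>3 * e\<close> by
      \<open>2 * e\<close>.\<close>
    define e where "e = \<bar>(\<integral>x. h (real n *\<^sub>R S n x) \<partial>\<mu>) - (\<integral>x. h (real n *\<^sub>R S n x) \<partial>\<nu>)\<bar> / 3"
    have "e > 0" using ne by (simp add: e_def)
    have "continuous_on (cbox (- One) One) (\<lambda>y. h (real n *\<^sub>R y))"
      by (rule continuous_on_compose2[OF h_cont]) (auto intro!: continuous_intros)
    then obtain g where g: "real_polynomial_function g"
      "\<And>y. y \<in> cbox (- One) One \<Longrightarrow> \<bar>h (real n *\<^sub>R y) - g y\<bar> < e"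
      using Stone_Weierstrass_real_polynomial_function[of "cbox (- One) One :: 'b set" "\<lambda>y. h (real n *\<^sub>R y)" e] \<open>e > 0\<close>
      by auto
    have trig: "trig_poly (\<lambda>x. complex_of_real (g (S n x)))"
      by (rule trig_poly_polynomial_sin[OF g(1) S_def])
    note * = integral_trig_poly_eq[OF trig pr sets char]
    have int_g: "integrable \<mu> (\<lambda>x. g (S n x))" "integrable \<nu> (\<lambda>x. g (S n x))"
      and eq_g: "(\<integral>x. g (S n x) \<partial>\<mu>) = (\<integral>x. g (S n x) \<partial>\<nu>)"
      using * unfolding complex_of_real_integrable_eq integral_complex_of_real of_real_eq_iff by auto
    have near: "\<bar>(\<integral>x. h (real n *\<^sub>R S n x) \<partial>\<kappa>) - (\<integral>x. g (S n x) \<partial>\<kappa>)\<bar> \<le> e"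
      if "prob_space \<kappa>" and [measurable_cong]: "sets \<kappa> = sets borel" and int: "integrable \<kappa> (\<lambda>x. g (S n x))" for \<kappa>
    proof -
      interpret K: prob_space \<kappa> by fact
      have int_h: "integrable \<kappa> (\<lambda>x. h (real n *\<^sub>R S n x))"
        by (rule K.integrable_const_bound[where B = 1]) (auto simp: h_bound)
      have "\<bar>(\<integral>x. h (real n *\<^sub>R S n x) \<partial>\<kappa>) - (\<integral>x. g (S n x) \<partial>\<kappa>)\<bar> =
          \<bar>\<integral>x. h (real n *\<^sub>R S n x) - g (S n x) \<partial>\<kappa>\<bar>"
        using int int_h by simp
      also have "\<dots> \<le> (\<integral>x. \<bar>h (real n *\<^sub>R S n x) - g (S n x)\<bar> \<partial>\<kappa>)"
        by (rule integral_abs_bound)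
      also have "\<dots> \<le> (\<integral>x. e \<partial>\<kappa>)"
        using int int_h g(2)[OF S_box] by (intro integral_mono) (auto intro: less_imp_le)
      finally show ?thesis by (simp add: K.prob_space)
    qed
    have "\<bar>(\<integral>x. h (real n *\<^sub>R S n x) \<partial>\<mu>) - (\<integral>x. h (real n *\<^sub>R S n x) \<partial>\<nu>)\<bar> \<le> 2 * e"
      using near[OF pr(1) sets(1) int_g(1)] near[OF pr(2) sets(2) int_g(2)] eq_g by linarith
    then show False using \<open>e > 0\<close> by (simp add: e_def)
  qed
  have S_lim: "(\<lambda>n. real n *\<^sub>R S n x) \<longlonglongrightarrow> x" for x
  proof -
    have sin_lim: "(\<lambda>n. real n * sin (inverse (real n) * y)) \<longlonglongrightarrow> y" for y :: real
      by real_asymp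
    have "(\<lambda>n. \<Sum>b\<in>Basis. (real n * sin (inverse (real n) * (b \<bullet> x))) *\<^sub>R b) \<longlonglongrightarrow> (\<Sum>b\<in>Basis. (b \<bullet> x) *\<^sub>R b)"
      by (intro tendsto_intros sin_lim)
    then show ?thesis
      by (simp add: S_def scaleR_sum_right inner_commute[of _ x] euclidean_representation)
  qed
  have lim: "(\<lambda>n. \<integral>x. h (real n *\<^sub>R S n x) \<partial>\<kappa>) \<longlonglongrightarrow> integral\<^sup>L \<kappa> h"
    if "prob_space \<kappa>" and [measurable_cong]: "sets \<kappa> = sets borel" for \<kappa>
  proof -
    interpret K: prob_space \<kappa> by fact
    have "isCont h x" for x using h_cont by (simp add: continuous_on_eq_continuous_at)
    then show ?thesis
      using h_bound
      by (intro integral_dominated_convergence[where w = "\<lambda>_. 1"])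
        (auto intro!: isCont_tendsto_compose[OF _ S_lim])
  qed
  show "integral\<^sup>L \<mu> h = integral\<^sup>L \<nu> h"
    using lim[OF pr(1) sets(1)] lim[OF pr(2) sets(2)] unfolding S_eq by (rule LIMSEQ_unique)
qed

subsection \<open>Splitting infinite product measures\<close>

lemma indep_vars_PiM_components:
  assumes "\<And>i. prob_space (M i)"
  shows "prob_space.indep_vars (PiM UNIV M) M (\<lambda>i \<omega>. \<omega> i) UNIV"
proof -
  interpret prob_space "PiM UNIV M" by (rule prob_space_PiM) (rule assms)
  show ?thesis
    by (subst indep_vars_iff_distr_eq_PiM') (auto simp: distr_PiM_component assms distr_id2 restrict_UNIV)
qed

lemma distr_PiM_restrict_pair:
  assumes M: "\<And>i. prob_space (M i)" and AB: "A \<inter> B = {}"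
    and X: "X \<in> PiM A M \<rightarrow>\<^sub>M S" and Y: "Y \<in> PiM B M \<rightarrow>\<^sub>M R"
  shows "distr (PiM UNIV M) (S \<Otimes>\<^sub>M R) (\<lambda>\<omega>. (X (restrict \<omega> A), Y (restrict \<omega> B))) =
    distr (PiM UNIV M) S (\<lambda>\<omega>. X (restrict \<omega> A)) \<Otimes>\<^sub>M distr (PiM UNIV M) R (\<lambda>\<omega>. Y (restrict \<omega> B))"
proof -
  interpret prob_space "PiM UNIV M" by (rule prob_space_PiM) (rule assms)
  have "indep_var (PiM A M) (\<lambda>\<omega>. restrict \<omega> A) (PiM B M) (\<lambda>\<omega>. restrict \<omega> B)"
    using indep_var_restrict[OF indep_vars_PiM_components[OF M] AB] by simp
  then have *: "distr (PiM UNIV M) (PiM A M) (\<lambda>\<omega>. restrict \<omega> A) \<Otimes>\<^sub>M distr (PiM UNIV M) (PiM B M) (\<lambda>\<omega>. restrict \<omega> B) =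
      distr (PiM UNIV M) (PiM A M \<Otimes>\<^sub>M PiM B M) (\<lambda>\<omega>. (restrict \<omega> A, restrict \<omega> B))"
    unfolding indep_var_distribution_eq by simp
  have r [measurable]: "(\<lambda>\<omega>. restrict \<omega> A) \<in> PiM UNIV M \<rightarrow>\<^sub>M PiM A M" "(\<lambda>\<omega>. restrict \<omega> B) \<in> PiM UNIV M \<rightarrow>\<^sub>M PiM B M"
    by (auto intro: measurable_restrict_subset)
  have "prob_space (distr (distr (PiM UNIV M) (PiM B M) (\<lambda>\<omega>. restrict \<omega> B)) R Y)"
    using Y by (intro prob_space.prob_space_distr prob_space_distr r) auto
  then have "sigma_finite_measure (distr (distr (PiM UNIV M) (PiM B M) (\<lambda>\<omega>. restrict \<omega> B)) R Y)"
    by (rule prob_space_imp_sigma_finite)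
  then have "distr (distr (PiM UNIV M) (PiM A M) (\<lambda>\<omega>. restrict \<omega> A)) S X \<Otimes>\<^sub>M distr (distr (PiM UNIV M) (PiM B M) (\<lambda>\<omega>. restrict \<omega> B)) R Y =
      distr (distr (PiM UNIV M) (PiM A M \<Otimes>\<^sub>M PiM B M) (\<lambda>\<omega>. (restrict \<omega> A, restrict \<omega> B))) (S \<Otimes>\<^sub>M R) (\<lambda>(x, y). (X x, Y y))"
    unfolding *[symmetric] using X Y by (intro pair_measure_distr) auto
  moreover have "(\<lambda>(x, y). (X x, Y y)) \<in> PiM A M \<Otimes>\<^sub>M PiM B M \<rightarrow>\<^sub>M S \<Otimes>\<^sub>M R"
    using X Y by measurable
  ultimately show ?thesis
    using X Y r by (simp add: distr_distr comp_def)
qed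

lemma measurable_PiM_reindex:
  assumes "range f \<subseteq> A"
  shows "(\<lambda>x j. x (f j)) \<in> PiM A M \<rightarrow>\<^sub>M PiM UNIV (\<lambda>j. M (f j))"
proof (rule measurable_PiM_single')
  fix j show "(\<lambda>x. x (f j)) \<in> PiM A M \<rightarrow>\<^sub>M M (f j)"
    using assms by (intro measurable_component_singleton) auto
next
  show "(\<lambda>x j. x (f j)) \<in> space (PiM A M) \<rightarrow> (\<Pi>\<^sub>E j\<in>UNIV. space (M (f j)))"
    using assms by (auto simp: space_PiM PiE_iff Pi_iff)
qed

lemma distr_PiM_UNIV_reindex:
  assumes "\<And>i. prob_space (M i)" and "inj f"
  shows "distr (PiM UNIV M) (PiM UNIV (\<lambda>j. M (f j))) (\<lambda>\<omega> j. \<omega> (f j)) = PiM UNIV (\<lambda>j. M (f j))"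
  using distr_PiM_reindex[of UNIV M f UNIV] assms by (simp add: restrict_UNIV)

text \<open>Coordinates selected by injections with disjoint ranges are independent families, and
  each is again a full product. This is what makes subtrees independent copies of the whole
  tree.\<close>

lemma distr_PiM_split:
  assumes M: "\<And>i. prob_space (M i)" and f: "inj f" and g: "inj g" and fg: "range f \<inter> range g = {}"
  shows "distr (PiM UNIV M) (PiM UNIV (\<lambda>j. M (f j)) \<Otimes>\<^sub>M PiM UNIV (\<lambda>k. M (g k)))
      (\<lambda>\<omega>. (\<lambda>j. \<omega> (f j), \<lambda>k. \<omega> (g k))) =
    PiM UNIV (\<lambda>j. M (f j)) \<Otimes>\<^sub>M PiM UNIV (\<lambda>k. M (g k))"
proof -
  have "distr (PiM UNIV M) (PiM UNIV (\<lambda>j. M (f j)) \<Otimes>\<^sub>M PiM UNIV (\<lambda>k. M (g k)))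
      (\<lambda>\<omega>. ((\<lambda>x j. x (f j)) (restrict \<omega> (range f)), (\<lambda>x k. x (g k)) (restrict \<omega> (range g)))) =
    distr (PiM UNIV M) (PiM UNIV (\<lambda>j. M (f j))) (\<lambda>\<omega>. (\<lambda>x j. x (f j)) (restrict \<omega> (range f))) \<Otimes>\<^sub>M
    distr (PiM UNIV M) (PiM UNIV (\<lambda>k. M (g k))) (\<lambda>\<omega>. (\<lambda>x k. x (g k)) (restrict \<omega> (range g)))"
    by (rule distr_PiM_restrict_pair[OF M fg])
      (auto intro!: measurable_PiM_reindex)
  then show ?thesis by (simp add: distr_PiM_UNIV_reindex M f g)
qed

lemma distr_PiM_split_point:
  assumes M: "\<And>i. prob_space (M i)" and g: "inj g" and ig: "i \<notin> range g"
  shows "distr (PiM UNIV M) (M i \<Otimes>\<^sub>M PiM UNIV (\<lambda>k. M (g k))) (\<lambda>\<omega>. (\<omega> i, \<lambda>k. \<omega> (g k))) =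
    M i \<Otimes>\<^sub>M PiM UNIV (\<lambda>k. M (g k))"
proof -
  have "distr (PiM UNIV M) (M i \<Otimes>\<^sub>M PiM UNIV (\<lambda>k. M (g k)))
      (\<lambda>\<omega>. ((\<lambda>x. x i) (restrict \<omega> {i}), (\<lambda>x k. x (g k)) (restrict \<omega> (range g)))) =
    distr (PiM UNIV M) (M i) (\<lambda>\<omega>. (\<lambda>x. x i) (restrict \<omega> {i})) \<Otimes>\<^sub>M
    distr (PiM UNIV M) (PiM UNIV (\<lambda>k. M (g k))) (\<lambda>\<omega>. (\<lambda>x k. x (g k)) (restrict \<omega> (range g)))"
    using ig by (intro distr_PiM_restrict_pair M)
      (auto intro!: measurable_PiM_reindex measurable_component_singleton)
  then show ?thesis by (simp add: distr_PiM_UNIV_reindex distr_PiM_component M g)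
qed

lemma distr_pair_snd_map:
  assumes "prob_space A" "prob_space B" and h: "h \<in> B \<rightarrow>\<^sub>M C"
  shows "distr (A \<Otimes>\<^sub>M B) (A \<Otimes>\<^sub>M C) (\<lambda>(x, y). (x, h y)) = A \<Otimes>\<^sub>M distr B C h"
proof -
  interpret B: prob_space B by fact
  interpret C: prob_space "distr B C h" by (rule B.prob_space_distr[OF h])
  show ?thesis
    using pair_measure_distr[of "\<lambda>x. x" A A h B C] h C.sigma_finite_measure_axioms by (simp add: distr_id2)
qed

lemma distr_pair_snd:
  assumes "prob_space A" "prob_space B" shows "distr (A \<Otimes>\<^sub>M B) B snd = B"
proof (rule measure_eqI)
  interpret A: prob_space A by fact
  interpret B: prob_space B by fact
  fix X assume "X \<in> sets (distr (A \<Otimes>\<^sub>M B) B snd)"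
  then have X: "X \<in> sets B" by simp
  have "snd -` X \<inter> space (A \<Otimes>\<^sub>M B) = space A \<times> X"
    using sets.sets_into_space[OF X] by (auto simp: space_pair_measure)
  then show "emeasure (distr (A \<Otimes>\<^sub>M B) B snd) X = emeasure B X"
    using X by (simp add: emeasure_distr B.emeasure_pair_measure_Times A.emeasure_space_1)
qed simp

lemma distr_PiM_split3:
  assumes M: "\<And>i. prob_space (M i)" and f: "inj f" and g: "inj g"
    and fg: "range f \<inter> range g = {}" and i: "i \<notin> range f" "i \<notin> range g"
  shows "distr (PiM UNIV M) (M i \<Otimes>\<^sub>M (PiM UNIV (\<lambda>j. M (f j)) \<Otimes>\<^sub>M PiM UNIV (\<lambda>k. M (g k))))
      (\<lambda>\<omega>. (\<omega> i, (\<lambda>j. \<omega> (f j), \<lambda>k. \<omega> (g k)))) =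
    M i \<Otimes>\<^sub>M (PiM UNIV (\<lambda>j. M (f j)) \<Otimes>\<^sub>M PiM UNIV (\<lambda>k. M (g k)))"
proof -
  \<comment> \<open>Joining both injections on a sum type reduces the triple split to splitting off
    one point and then splitting the remaining family in two.\<close>
  define h where "h = case_sum f g"
  have h: "inj h" "i \<notin> range h"
    using f g fg i by (auto simp: h_def inj_on_def image_iff disjoint_iff split: sum.splits)
  let ?N = "PiM UNIV (\<lambda>k. M (h k))"
  let ?P = "PiM UNIV (\<lambda>j. M (f j)) \<Otimes>\<^sub>M PiM UNIV (\<lambda>k. M (g k))"
  have meas [measurable]: "(\<lambda>\<omega>. (\<lambda>j. \<omega> (Inl j), \<lambda>k. \<omega> (Inr k))) \<in> ?N \<rightarrow>\<^sub>M ?P"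
    using measurable_PiM_reindex[of Inl UNIV "\<lambda>k. M (h k)"] measurable_PiM_reindex[of Inr UNIV "\<lambda>k. M (h k)"]
    by (simp add: h_def)
  have meas2: "(\<lambda>\<omega>. (\<omega> i, \<lambda>k. \<omega> (h k))) \<in> PiM UNIV M \<rightarrow>\<^sub>M M i \<Otimes>\<^sub>M ?N"
    by (intro measurable_Pair measurable_PiM_reindex measurable_component_singleton) auto
  have meas3: "(\<lambda>(x, y). (x, (\<lambda>j. y (Inl j), \<lambda>k. y (Inr k)))) \<in> M i \<Otimes>\<^sub>M ?N \<rightarrow>\<^sub>M M i \<Otimes>\<^sub>M ?P"
    by measurable
  have "distr (PiM UNIV M) (M i \<Otimes>\<^sub>M ?P) (\<lambda>\<omega>. (\<omega> i, (\<lambda>j. \<omega> (f j), \<lambda>k. \<omega> (g k)))) =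
    distr (distr (PiM UNIV M) (M i \<Otimes>\<^sub>M ?N) (\<lambda>\<omega>. (\<omega> i, \<lambda>k. \<omega> (h k)))) (M i \<Otimes>\<^sub>M ?P)
      (\<lambda>(x, y). (x, (\<lambda>j. y (Inl j), \<lambda>k. y (Inr k))))"
    by (subst distr_distr[OF meas3 meas2]) (simp add: comp_def h_def)
  also have "\<dots> = distr (M i \<Otimes>\<^sub>M ?N) (M i \<Otimes>\<^sub>M ?P) (\<lambda>(x, y). (x, (\<lambda>j. y (Inl j), \<lambda>k. y (Inr k))))"
    by (subst distr_PiM_split_point[OF M h]) simp
  also have "\<dots> = M i \<Otimes>\<^sub>M distr ?N ?P (\<lambda>y. (\<lambda>j. y (Inl j), \<lambda>k. y (Inr k)))"
    by (intro distr_pair_snd_map M prob_space_PiM meas)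
  also have "distr ?N ?P (\<lambda>y. (\<lambda>j. y (Inl j), \<lambda>k. y (Inr k))) = ?P"
    using distr_PiM_split[of "\<lambda>k. M (h k)" Inl Inr] M by (auto simp: h_def inj_on_def disjoint_iff)
  finally show ?thesis .
qed

text \<open>Regroups by subtree what was grouped by kind: \<open>E\<close> stands for the first
  ring, \<open>A\<close> and \<open>B\<close> for the clocks of the two subtrees, \<open>C\<close>
  and \<open>D\<close> for their marks.\<close>

lemma distr_pair_rearrange:
  assumes "prob_space E" "prob_space A" "prob_space B" "prob_space C" "prob_space D"
  shows "distr ((E \<Otimes>\<^sub>M (A \<Otimes>\<^sub>M B)) \<Otimes>\<^sub>M (C \<Otimes>\<^sub>M D)) (E \<Otimes>\<^sub>M ((A \<Otimes>\<^sub>M C) \<Otimes>\<^sub>M (B \<Otimes>\<^sub>M D)))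
      (\<lambda>((e, (a, b)), (c, d)). (e, ((a, c), (b, d)))) =
    E \<Otimes>\<^sub>M ((A \<Otimes>\<^sub>M C) \<Otimes>\<^sub>M (B \<Otimes>\<^sub>M D))"
proof (rule measure_eqI)
  interpret E: prob_space E by fact
  interpret A: prob_space A by fact
  interpret B: prob_space B by fact
  interpret C: prob_space C by fact
  interpret D: prob_space D by fact
  interpret AB: pair_prob_space A B ..
  interpret AC: pair_prob_space A C ..
  interpret BD: pair_prob_space B D ..
  interpret CD: pair_prob_space C D ..
  interpret BC: pair_prob_space B C ..
  interpret ACBD: pair_prob_space "A \<Otimes>\<^sub>M C" "B \<Otimes>\<^sub>M D" ..
  let ?R = "E \<Otimes>\<^sub>M ((A \<Otimes>\<^sub>M C) \<Otimes>\<^sub>M (B \<Otimes>\<^sub>M D))"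
  let ?L = "(E \<Otimes>\<^sub>M (A \<Otimes>\<^sub>M B)) \<Otimes>\<^sub>M (C \<Otimes>\<^sub>M D)"
  let ?r = "\<lambda>((e, (a, b)), (c, d)). (e, ((a, c), (b, d)))"
  fix X assume "X \<in> sets (distr ?L ?R ?r)"
  then have [measurable]: "X \<in> sets ?R" by simp
  have r_eq: "?r = (\<lambda>x. (fst (fst x), ((fst (snd (fst x)), fst (snd x)), (snd (snd (fst x)), snd (snd x)))))"
    by (auto simp: fun_eq_iff)
  have [measurable]: "?r \<in> ?L \<rightarrow>\<^sub>M ?R"
    by (subst r_eq) measurable
  have CD_fst: "(\<integral>\<^sup>+z. g (fst z) (snd z) \<partial>(C \<Otimes>\<^sub>M D)) = (\<integral>\<^sup>+c. \<integral>\<^sup>+d. g c d \<partial>D \<partial>C)"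
    if "(\<lambda>z. g (fst z) (snd z)) \<in> borel_measurable (C \<Otimes>\<^sub>M D)" for g
    using D.nn_integral_fst[OF that] by simp
  have "emeasure (distr ?L ?R ?r) X = (\<integral>\<^sup>+x. indicator X x \<partial>distr ?L ?R ?r)"
    by simp
  also have "\<dots> = (\<integral>\<^sup>+x. indicator X (?r x) \<partial>?L)"
    by (rule nn_integral_distr) measurable
  also have "\<dots> = (\<integral>\<^sup>+y. \<integral>\<^sup>+z. indicator X (?r (y, z)) \<partial>(C \<Otimes>\<^sub>M D) \<partial>(E \<Otimes>\<^sub>M (A \<Otimes>\<^sub>M B)))"
    by (rule CD.nn_integral_fst[symmetric]) measurable
  also have "\<dots> = (\<integral>\<^sup>+e. \<integral>\<^sup>+ab. \<integral>\<^sup>+z. indicator X (?r ((e, ab), z)) \<partial>(C \<Otimes>\<^sub>M D) \<partial>(A \<Otimes>\<^sub>M B) \<partial>E)"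
    by (rule AB.nn_integral_fst[symmetric]) measurable
  also have "\<dots> = (\<integral>\<^sup>+e. \<integral>\<^sup>+a. \<integral>\<^sup>+b. \<integral>\<^sup>+z. indicator X (?r ((e, (a, b)), z)) \<partial>(C \<Otimes>\<^sub>M D) \<partial>B \<partial>A \<partial>E)"
    by (intro nn_integral_cong B.nn_integral_fst[symmetric]) measurable
  also have "\<dots> = (\<integral>\<^sup>+e. \<integral>\<^sup>+a. \<integral>\<^sup>+b. \<integral>\<^sup>+z. indicator X (e, ((a, fst z), (b, snd z))) \<partial>(C \<Otimes>\<^sub>M D) \<partial>B \<partial>A \<partial>E)"
    by (simp add: case_prod_beta)
  also have "\<dots> = (\<integral>\<^sup>+e. \<integral>\<^sup>+a. \<integral>\<^sup>+b. \<integral>\<^sup>+c. \<integral>\<^sup>+d. indicator X (e, ((a, c), (b, d))) \<partial>D \<partial>C \<partial>B \<partial>A \<partial>E)"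
    by (intro nn_integral_cong CD_fst) measurable
  also have "\<dots> = (\<integral>\<^sup>+e. \<integral>\<^sup>+a. \<integral>\<^sup>+c. \<integral>\<^sup>+b. \<integral>\<^sup>+d. indicator X (e, ((a, c), (b, d))) \<partial>D \<partial>B \<partial>C \<partial>A \<partial>E)"
    by (intro nn_integral_cong BC.Fubini'[symmetric]) measurable
  also have "\<dots> = (\<integral>\<^sup>+e. \<integral>\<^sup>+a. \<integral>\<^sup>+c. \<integral>\<^sup>+bd. indicator X (e, ((a, c), bd)) \<partial>(B \<Otimes>\<^sub>M D) \<partial>C \<partial>A \<partial>E)"
    by (intro nn_integral_cong D.nn_integral_fst) measurable
  also have "\<dots> = (\<integral>\<^sup>+e. \<integral>\<^sup>+ac. \<integral>\<^sup>+bd. indicator X (e, (ac, bd)) \<partial>(B \<Otimes>\<^sub>M D) \<partial>(A \<Otimes>\<^sub>M C) \<partial>E)"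
    by (intro nn_integral_cong C.nn_integral_fst) measurable
  also have "\<dots> = (\<integral>\<^sup>+e. \<integral>\<^sup>+z. indicator X (e, z) \<partial>((A \<Otimes>\<^sub>M C) \<Otimes>\<^sub>M (B \<Otimes>\<^sub>M D)) \<partial>E)"
    by (intro nn_integral_cong BD.nn_integral_fst) measurable
  also have "\<dots> = (\<integral>\<^sup>+x. indicator X x \<partial>?R)"
    by (intro ACBD.nn_integral_fst) measurable
  finally show "emeasure (distr ?L ?R ?r) X = emeasure ?R X" by simp
qed simp

subsection \<open>The genealogical tree and its decomposition at the first ring\<close>

lemma UNIV_direction: "UNIV = range Pos \<union> range Neg"
proof (intro set_eqI)
  fix v show "v \<in> UNIV \<longleftrightarrow> v \<in> range Pos \<union> range Neg"
    by (cases v) auto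
qed

instance direction :: (finite) finite
proof
  show "finite (UNIV :: 'a direction set)"
    unfolding UNIV_direction by simp
qed

lemma sum_direction:
  fixes h :: "'d::finite direction \<Rightarrow> 'b::comm_monoid_add"
  shows "(\<Sum>v\<in>UNIV. h v) = (\<Sum>i\<in>UNIV. h (Pos i)) + (\<Sum>i\<in>UNIV. h (Neg i))"
proof -
  have "(\<Sum>v\<in>UNIV. h v) = sum h (range Pos) + sum h (range Neg)"
    unfolding UNIV_direction by (intro sum.union_disjoint) auto
  then show ?thesis
    by (simp add: sum.reindex inj_on_def)
qed

type_synonym clocks = "ball \<times> nat \<Rightarrow> real"
type_synonym 'd marks = "ball \<times> 'd direction \<Rightarrow> 'd direction"

text \<open>\<open>born\<close> and \<open>heading\<close> are the birth time and the direction as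
  functions on the space of clock and mark families, where the law is a product measure. The
  starting direction is a parameter of \<open>heading\<close> because the subtree of a child may
  start with any direction.\<close>

primrec born :: "ball \<Rightarrow> clocks \<Rightarrow> real" where
  "born [] t = 0"
| "born (k # b) t = born b t + (\<Sum>j\<le>k. t (b, j))"

primrec heading :: "ball \<Rightarrow> 'd direction \<Rightarrow> 'd marks \<Rightarrow> 'd direction" where
  "heading [] v m = v"
| "heading (k # b) v m = m (k # b, heading b v m)"

primrec vec_of :: "'d::finite direction \<Rightarrow> real ^ 'd" where
  "vec_of (Pos i) = axis i 1"
| "vec_of (Neg i) = - axis i 1"

text \<open>After the first ring the initial ball carries a fresh sequence of clocks, its child number
  \<open>k + 1\<close> now being number \<open>k\<close>. Shifting the last entry of a genealogy, which is the index of
  the child of the initial ball, recovers the original names.\<close>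

primrec root_shift :: "ball \<Rightarrow> ball" where
  "root_shift [] = []"
| "root_shift (k # b) = (if b = [] then [Suc k] else k # root_shift b)"

lemma root_shift_snoc [simp]: "root_shift (b @ [j]) = b @ [Suc j]"
  by (induction b) auto

lemma root_shift_eq_Nil_iff [simp]: "root_shift b = [] \<longleftrightarrow> b = []"
  by (cases b) auto

lemma Nil_eq_root_shift_iff [simp]: "[] = root_shift b \<longleftrightarrow> b = []"
  by (cases b) auto

lemma inj_root_shift: "inj root_shift"
proof (rule injI)
  fix b c assume "root_shift b = root_shift c"
  then show "b = c" by (cases b rule: rev_cases; cases c rule: rev_cases) auto
qed

lemma root_shift_neq_append_0 [simp]: "root_shift b \<noteq> c @ [0]" "c @ [0] \<noteq> root_shift b"
  by (cases b rule: rev_cases; simp)+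

lemma ball_cases:
  obtains b where "c = root_shift b" | b where "c = b @ [0]"
proof (cases c rule: rev_cases)
  case Nil
  then show ?thesis using that(1)[of "[]"] by simp
next
  case (snoc b k)
  then show ?thesis using that(1)[of "b @ [k - 1]"] that(2)[of b] by (cases k) auto
qed

definition later_clock :: "ball \<times> nat \<Rightarrow> ball \<times> nat" where
  "later_clock = (\<lambda>(b, k). if b = [] then ([], Suc k) else (root_shift b, k))"

definition first_clock :: "ball \<times> nat \<Rightarrow> ball \<times> nat" where
  "first_clock = (\<lambda>(b, k). (b @ [0], k))"

definition later_mark :: "ball \<times> 'd direction \<Rightarrow> ball \<times> 'd direction" where
  "later_mark = (\<lambda>(b, v). (root_shift b, v))"

definition first_mark :: "ball \<times> 'd direction \<Rightarrow> ball \<times> 'd direction" where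
  "first_mark = (\<lambda>(b, v). (b @ [0], v))"

lemma inj_later_clock: "inj later_clock"
  by (auto simp: later_clock_def inj_on_def split: if_splits dest: injD[OF inj_root_shift])

lemma inj_first_clock: "inj first_clock"
  by (auto simp: first_clock_def inj_on_def)

lemma inj_later_mark: "inj later_mark"
  by (auto simp: later_mark_def inj_on_def dest: injD[OF inj_root_shift])

lemma inj_first_mark: "inj first_mark"
  by (auto simp: first_mark_def inj_on_def)

lemma later_first_clock_disjoint: "range later_clock \<inter> range first_clock = {}"
  by (auto simp: later_clock_def first_clock_def split: if_splits)

lemma later_first_mark_disjoint: "range later_mark \<inter> range first_mark = {}"
  by (auto simp: later_mark_def first_mark_def)

lemma root_clock_notin: "([], 0) \<notin> range later_clock" "([], 0) \<notin> range first_clock"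
  by (auto simp: later_clock_def first_clock_def split: if_splits)

lemma born_root_shift:
  "b \<noteq> [] \<Longrightarrow> born (root_shift b) t = t ([], 0) + born b (\<lambda>i. t (later_clock i))"
proof (induction b)
  case (Cons k b)
  show ?case
  proof (cases "b = []")
    case True
    have "(\<Sum>j\<le>Suc k. t ([], j)) = t ([], 0) + (\<Sum>j\<le>k. t ([], Suc j))"
      by (rule sum.atMost_Suc_shift)
    then show ?thesis using True by (simp add: later_clock_def)
  next
    case False
    then show ?thesis using Cons by (simp add: later_clock_def)
  qed
qed simp

lemma born_append_0: "born (b @ [0]) t = t ([], 0) + born b (\<lambda>i. t (first_clock i))"
  by (induction b) (auto simp: first_clock_def)

lemma heading_root_shift: "heading (root_shift b) v m = heading b v (\<lambda>i. m (later_mark i))"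
  by (induction b) (auto simp: later_mark_def)

text \<open>The marks of the initial ball are never used by \<^const>\<open>heading\<close>, so the subtree of the first child
  can store that child's own marks there.\<close>

lemma heading_append_0:
  "heading (b @ [0]) v m = heading b (m ([0], v)) (\<lambda>i. m (first_mark i))"
  by (induction b) (auto simp: first_mark_def)

lemma heading_fun_upd: "heading b v (m(([], u) := u')) = heading b v m"
  by (induction b) auto

lemma born_nonneg:
  assumes "\<forall>i. 0 < t i" shows "0 \<le> born b t"
  using assms by (induction b) (simp_all add: sum_nonneg less_imp_le)

lemma born_ge_first:
  assumes "\<forall>i. 0 < t i" and "b \<noteq> []" shows "t ([], 0) \<le> born b t"
proof (cases b rule: ball_cases)
  case (1 c)
  then show ?thesis
    using assms born_nonneg[of "\<lambda>i. t (later_clock i)" c] by (simp add: born_root_shift del: split_paired_All)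
next
  case (2 c)
  then show ?thesis
    using assms born_nonneg[of "\<lambda>i. t (first_clock i)" c] by (simp add: born_append_0 del: split_paired_All)
qed

lemma born_root_shift_le_iff:
  assumes "\<forall>i. 0 < t i" and "t ([], 0) \<le> s"
  shows "born (root_shift b) t \<le> s \<longleftrightarrow> born b (\<lambda>i. t (later_clock i)) \<le> s - t ([], 0)"
proof (cases "b = []")
  case True
  have "0 \<le> s" using assms by (meson less_imp_le order_trans)
  then show ?thesis using True assms(2) by simp
next
  case False
  then show ?thesis by (auto simp: born_root_shift algebra_simps)
qed

lemma born_append_0_le_iff:
  "born (b @ [0]) t \<le> s \<longleftrightarrow> born b (\<lambda>i. t (first_clock i)) \<le> s - t ([], 0)"
  by (auto simp: born_append_0 algebra_simps)

lemma born_before_first: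
  assumes "\<forall>i. 0 < t i" and "0 \<le> s" "s < t ([], 0)"
  shows "{b. born b t \<le> s} = {[]}"
proof -
  have "\<not> born b t \<le> s" if "b \<noteq> []" for b
    using born_ge_first[OF assms(1) that] assms(3) by simp
  then show ?thesis using assms(2) by force
qed

lemma born_after_first:
  assumes "\<forall>i. 0 < t i" and "t ([], 0) \<le> s"
  shows "{b. born b t \<le> s} =
    root_shift ` {b. born b (\<lambda>i. t (later_clock i)) \<le> s - t ([], 0)} \<union>
    (\<lambda>b. b @ [0]) ` {b. born b (\<lambda>i. t (first_clock i)) \<le> s - t ([], 0)}"
proof (intro set_eqI)
  fix c
  have inj: "root_shift b = root_shift c \<longleftrightarrow> b = c" for b c
    using inj_root_shift by (auto dest: injD)
  show "c \<in> {b. born b t \<le> s} \<longleftrightarrow> c \<in> root_shift ` {b. born b (\<lambda>i. t (later_clock i)) \<le> s - t ([], 0)} \<union>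
    (\<lambda>b. b @ [0]) ` {b. born b (\<lambda>i. t (first_clock i)) \<le> s - t ([], 0)}"
    by (cases c rule: ball_cases)
      (auto simp: born_root_shift_le_iff[OF assms] born_append_0_le_iff image_iff inj)
qed

text \<open>The number of clock durations that add up to \<open>born b t\<close>. Both
  \<open>root_shift\<close> (away from the initial ball) and appending \<open>0\<close> raise it by
  one, so truncation by size allows induction along the split at the first ring.\<close>

definition ball_size :: "ball \<Rightarrow> nat" where
  "ball_size b = (\<Sum>k\<leftarrow>b. Suc k)"

lemma finite_ball_size: "finite {b. ball_size b \<le> n}"
proof (induction n)
  case 0
  have "{b. ball_size b \<le> 0} \<subseteq> {[]}"
    by (auto simp: ball_size_def elim: list.set_cases)
  then show ?case by (rule finite_subset) simp
next
  case (Suc n)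
  have "{b. ball_size b \<le> Suc n} \<subseteq> insert [] (\<Union>k\<in>{..n}. (#) k ` {b. ball_size b \<le> n})"
  proof
    fix b assume "b \<in> {b. ball_size b \<le> Suc n}"
    then show "b \<in> insert [] (\<Union>k\<in>{..n}. (#) k ` {b. ball_size b \<le> n})"
      by (cases b) (force simp: ball_size_def)+
  qed
  then show ?case by (rule finite_subset) (auto simp: Suc)
qed

lemma ball_size_snoc: "ball_size (b @ [k]) = ball_size b + Suc k"
  by (simp add: ball_size_def)

lemma ball_size_le_Suc:
  "{b. ball_size b \<le> Suc n} =
    root_shift ` {b. ball_size b \<le> n} \<union> (\<lambda>b. b @ [0]) ` {b. ball_size b \<le> n}"
proof (intro set_eqI)
  fix c
  have inj: "root_shift b = root_shift c \<longleftrightarrow> b = c" for b c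
    using inj_root_shift by (auto dest: injD)
  have "ball_size (root_shift b) \<le> Suc n \<longleftrightarrow> ball_size b \<le> n" for b
    by (cases b rule: rev_cases) (auto simp: ball_size_snoc ball_size_def)
  then show "c \<in> {b. ball_size b \<le> Suc n} \<longleftrightarrow>
      c \<in> root_shift ` {b. ball_size b \<le> n} \<union> (\<lambda>b. b @ [0]) ` {b. ball_size b \<le> n}"
    by (cases c rule: ball_cases) (auto simp: ball_size_snoc image_iff inj)
qed

lemma finite_subset_ball_size:
  assumes "finite A" obtains n where "A \<subseteq> {b. ball_size b \<le> n}"
proof
  show "A \<subseteq> {b. ball_size b \<le> Max (insert 0 (ball_size ` A))}"
    using assms by (auto intro: Max_ge)
qed

text \<open>Truncation by size keeps the sum finite and measurable before the whole population is
  known to be finite.\<close>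

definition population :: "nat \<Rightarrow> real \<Rightarrow> clocks \<Rightarrow> ennreal" where
  "population n s t = (\<Sum>b | ball_size b \<le> n. if born b t \<le> s then 1 else 0)"

lemma population_eq_card:
  "population n s t = of_nat (card {b. ball_size b \<le> n \<and> born b t \<le> s})"
proof -
  have "population n s t = (\<Sum>b\<in>{b \<in> {b. ball_size b \<le> n}. born b t \<le> s}. 1)"
    unfolding population_def by (rule sum.inter_filter[symmetric, OF finite_ball_size])
  then show ?thesis by simp
qed

lemma population_Suc:
  assumes pos: "\<forall>i. 0 < t i" and "0 \<le> s"
  shows "population (Suc n) s t = (if s < t ([], 0) then 1
    else population n (s - t ([], 0)) (\<lambda>i. t (later_clock i)) +
         population n (s - t ([], 0)) (\<lambda>i. t (first_clock i)))"
proof (cases "s < t ([], 0)")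
  case True
  have "{b. ball_size b \<le> Suc n \<and> born b t \<le> s} = {[]}"
    unfolding Collect_conj_eq born_before_first[OF assms True] by (simp add: ball_size_def)
  then show ?thesis using True by (simp add: population_eq_card)
next
  case False
  let ?B = "{b. ball_size b \<le> n}"
  have "population (Suc n) s t =
      (\<Sum>b\<in>root_shift ` ?B. if born b t \<le> s then 1 else 0) +
      (\<Sum>b\<in>(\<lambda>b. b @ [0]) ` ?B. if born b t \<le> s then 1 else 0)"
    unfolding population_def ball_size_le_Suc
    by (intro sum.union_disjoint) (auto simp: finite_ball_size)
  also have "(\<Sum>b\<in>root_shift ` ?B. if born b t \<le> s then 1 else 0) =
      population n (s - t ([], 0)) (\<lambda>i. t (later_clock i))"
    using born_root_shift_le_iff[OF pos] False inj_on_subset[OF inj_root_shift]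
    by (subst sum.reindex) (simp_all add: population_def)
  also have "(\<Sum>b\<in>(\<lambda>b. b @ [0]) ` ?B. if born b t \<le> s then 1 else 0) =
      population n (s - t ([], 0)) (\<lambda>i. t (first_clock i))"
    by (subst sum.reindex) (simp_all add: inj_on_def population_def born_append_0_le_iff)
  finally show ?thesis using False by simp
qed

definition position_upto :: "nat \<Rightarrow> 'd::finite direction \<Rightarrow> real \<Rightarrow> clocks \<times> 'd marks \<Rightarrow> real ^ 'd" where
  "position_upto n v s x =
    (\<Sum>b | ball_size b \<le> n. if born b (fst x) \<le> s then vec_of (heading b v (snd x)) else 0)"

text \<open>The limit is eventually constant whenever finitely many balls are born up to time \<open>s\<close>; taking
  it makes measurability immediate.\<close>

definition position :: "'d::finite direction \<Rightarrow> real \<Rightarrow> clocks \<times> 'd marks \<Rightarrow> real ^ 'd" where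
  "position v s x = lim (\<lambda>n. position_upto n v s x)"

lemma position_eq:
  assumes "finite {b. born b (fst x) \<le> s}"
  shows "position v s x = (\<Sum>b | born b (fst x) \<le> s. vec_of (heading b v (snd x)))"
proof -
  obtain n0 where n0: "{b. born b (fst x) \<le> s} \<subseteq> {b. ball_size b \<le> n0}"
    using finite_subset_ball_size[OF assms] .
  have "position_upto n v s x = (\<Sum>b | born b (fst x) \<le> s. vec_of (heading b v (snd x)))" if "n \<ge> n0" for n
  proof -
    have "position_upto n v s x = (\<Sum>b\<in>{b \<in> {b. ball_size b \<le> n}. born b (fst x) \<le> s}. vec_of (heading b v (snd x)))"
      unfolding position_upto_def by (rule sum.inter_filter[symmetric, OF finite_ball_size])
    also have "{b \<in> {b. ball_size b \<le> n}. born b (fst x) \<le> s} = {b. born b (fst x) \<le> s}"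
      using n0 that by force
    finally show ?thesis .
  qed
  then have "(\<lambda>n. position_upto n v s x) \<longlonglongrightarrow> (\<Sum>b | born b (fst x) \<le> s. vec_of (heading b v (snd x)))"
    by (intro tendsto_eventually) (auto simp: eventually_sequentially)
  then show ?thesis unfolding position_def by (rule limI)
qed

definition later :: "clocks \<times> 'd marks \<Rightarrow> clocks \<times> 'd marks" where
  "later x = (\<lambda>i. fst x (later_clock i), \<lambda>i. snd x (later_mark i))"

definition first :: "clocks \<times> 'd marks \<Rightarrow> clocks \<times> 'd marks" where
  "first x = (\<lambda>i. fst x (first_clock i), \<lambda>i. snd x (first_mark i))"

text \<open>The branching property on each path: from the first ring on, the initial ball goes on
  with its remaining clocks, and ball \<open>[0]\<close> starts a tree of its own. Its direction is
  the mark at \<open>([0], v)\<close>, which \<open>first\<close> stores at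
  \<open>([], v)\<close>.\<close>

lemma position_split:
  assumes pos: "\<forall>i. 0 < fst x i" and fin: "\<And>s. finite {b. born b (fst x) \<le> s}" and "0 \<le> s"
  shows "position v s x = (if s < fst x ([], 0) then vec_of v
    else position v (s - fst x ([], 0)) (later x) +
         position (snd (first x) ([], v)) (s - fst x ([], 0)) (first x))"
proof (cases "s < fst x ([], 0)")
  case True
  show ?thesis
    using True by (simp add: position_eq[OF fin] born_before_first[OF pos \<open>0 \<le> s\<close> True])
next
  case False
  then have ge: "fst x ([], 0) \<le> s" by simp
  let ?A = "{b. born b (fst (later x)) \<le> s - fst x ([], 0)}"
  let ?B = "{b. born b (fst (first x)) \<le> s - fst x ([], 0)}"
  have split: "{b. born b (fst x) \<le> s} = root_shift ` ?A \<union> (\<lambda>b. b @ [0]) ` ?B"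
    using born_after_first[OF pos ge] by (simp add: later_def first_def)
  have fin_AB: "finite (root_shift ` ?A)" "finite ((\<lambda>b. b @ [0]) ` ?B)"
    using fin[of s] unfolding split by auto
  then have fin': "finite ?A" "finite ?B"
    by (auto elim!: finite_imageD intro: inj_on_subset[OF inj_root_shift] simp: inj_on_def)
  have "position v s x = (\<Sum>b\<in>root_shift ` ?A. vec_of (heading b v (snd x))) +
      (\<Sum>b\<in>(\<lambda>b. b @ [0]) ` ?B. vec_of (heading b v (snd x)))"
    unfolding position_eq[OF fin] split using fin_AB by (intro sum.union_disjoint) auto
  also have "(\<Sum>b\<in>root_shift ` ?A. vec_of (heading b v (snd x))) = position v (s - fst x ([], 0)) (later x)"
    unfolding position_eq[OF fin'(1)]
    by (subst sum.reindex) (auto intro: inj_on_subset[OF inj_root_shift] simp: heading_root_shift later_def)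
  also have "(\<Sum>b\<in>(\<lambda>b. b @ [0]) ` ?B. vec_of (heading b v (snd x))) =
      position (snd (first x) ([], v)) (s - fst x ([], 0)) (first x)"
    unfolding position_eq[OF fin'(2)]
    by (subst sum.reindex) (auto simp: inj_on_def heading_append_0 first_def first_mark_def)
  finally show ?thesis using False by simp
qed

subsection \<open>Finiteness of the population\<close>

definition exp1 :: "real measure" where
  "exp1 = density lborel (\<lambda>x. ennreal (exponential_density 1 x))"

lemma prob_space_exp1: "prob_space exp1"
  unfolding exp1_def by (rule prob_space_exponential_density) simp

lemma sets_exp1 [measurable_cong, simp]: "sets exp1 = sets borel"
  by (simp add: exp1_def)

lemma measurable_exp1 [simp]:
  "exp1 \<rightarrow>\<^sub>M N = borel \<rightarrow>\<^sub>M N" "N' \<rightarrow>\<^sub>M exp1 = N' \<rightarrow>\<^sub>M borel"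
  by (rule measurable_cong_sets; simp)+

lemma space_exp1 [simp]: "space exp1 = UNIV"
  by (simp add: exp1_def)

lemma AE_exp1_pos: "AE r in exp1. 0 < r"
  unfolding exp1_def using AE_lborel_singleton[of 0]
  by (subst AE_density) (auto elim!: eventually_mono simp: exponential_density_def)

lemma emeasure_exp1_greaterThan:
  assumes "0 \<le> s" shows "emeasure exp1 {s<..} = ennreal (exp (- s))"
proof -
  have "emeasure exp1 {s<..} = (\<integral>\<^sup>+x. ennreal (exponential_density 1 x) * indicator {s<..} x \<partial>lborel)"
    unfolding exp1_def by (rule emeasure_density) auto
  also have "\<dots> = (\<integral>\<^sup>+x. ennreal (exp (- x)) * indicator {s..} x \<partial>lborel)"
    using AE_lborel_singleton[of s] assms
    by (intro nn_integral_cong_AE) (auto elim!: eventually_mono simp: exponential_density_def indicator_def)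
  also have "\<dots> = ennreal (0 - (- exp (- s)))"
  proof (rule nn_integral_FTC_atLeast)
    show "((\<lambda>x::real. - exp (- x)) \<longlongrightarrow> 0) at_top"
      by real_asymp
  qed (auto intro!: derivative_eq_intros)
  finally show ?thesis by simp
qed

definition clock_space :: "clocks measure" where
  "clock_space = PiM UNIV (\<lambda>_. exp1)"

lemma prob_space_clock_space: "prob_space clock_space"
  unfolding clock_space_def by (intro prob_space_PiM prob_space_exp1)

lemma measurable_clock [measurable]: "(\<lambda>t. t i) \<in> borel_measurable clock_space"
  using measurable_component_singleton[of i UNIV "\<lambda>_. exp1"] by (simp add: clock_space_def)

lemma space_clock_space [simp]: "space clock_space = UNIV"
  by (simp add: clock_space_def space_PiM)

lemma measurable_born [measurable]: "born b \<in> borel_measurable clock_space"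
  by (induction b) auto

text \<open>Renewal at the first ring: the clocks of the initial ball from number 1 on, like all
  others, are fresh and independent of clock number 0.\<close>

lemma distr_clock_space_split:
  "distr clock_space (exp1 \<Otimes>\<^sub>M (clock_space \<Otimes>\<^sub>M clock_space))
     (\<lambda>t. (t ([], 0), (\<lambda>i. t (later_clock i), \<lambda>i. t (first_clock i)))) =
   exp1 \<Otimes>\<^sub>M (clock_space \<Otimes>\<^sub>M clock_space)"
  unfolding clock_space_def
  by (rule distr_PiM_split3[of "\<lambda>_. exp1" later_clock first_clock "([], 0)"])
    (auto intro: prob_space_exp1 inj_later_clock inj_first_clock
      simp del: split_paired_All simp: later_first_clock_disjoint root_clock_notin)

lemma measurable_later_clock:
  "(\<lambda>t i. t (later_clock i)) \<in> clock_space \<rightarrow>\<^sub>M clock_space"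
  unfolding clock_space_def using measurable_PiM_reindex[of later_clock UNIV "\<lambda>_. exp1"] by simp

lemma measurable_first_clock:
  "(\<lambda>t i. t (first_clock i)) \<in> clock_space \<rightarrow>\<^sub>M clock_space"
  unfolding clock_space_def using measurable_PiM_reindex[of first_clock UNIV "\<lambda>_. exp1"] by simp

lemma AE_clock_pos: "AE t in clock_space. \<forall>i. 0 < t i"
  unfolding AE_all_countable clock_space_def
  by (intro allI AE_PiM_component prob_space_exp1 AE_exp1_pos) simp

lemma measurable_population [measurable]:
  "(\<lambda>(s, t). population n s t) \<in> borel_measurable (borel \<Otimes>\<^sub>M clock_space)"
  unfolding population_def case_prod_beta by (intro borel_measurable_sum) measurable

text \<open>exp s solves the renewal equation for the mean population: the part before the first
  ring contributes exp (- s), the part after it exp s - exp (- s). The bound therefore reproduces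
  itself in the induction below.\<close>

lemma nn_integral_exp1_le:
  assumes "0 \<le> s"
  shows "(\<integral>\<^sup>+r. (if s < r then 1 else ennreal (2 * exp (s - r))) \<partial>exp1) \<le> ennreal (exp s)"
proof -
  have "(\<integral>\<^sup>+r. (if s < r then 1 else ennreal (2 * exp (s - r))) \<partial>exp1) =
     (\<integral>\<^sup>+r. indicator {s<..} r + ennreal (2 * exp (s - r)) * indicator {..s} r \<partial>exp1)"
    by (intro nn_integral_cong) (auto simp: indicator_def)
  also have "\<dots> = emeasure exp1 {s<..} + (\<integral>\<^sup>+r. ennreal (2 * exp (s - r)) * indicator {..s} r \<partial>exp1)"
    by (subst nn_integral_add) simp_all
  also have "(\<integral>\<^sup>+r. ennreal (2 * exp (s - r)) * indicator {..s} r \<partial>exp1) =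
     (\<integral>\<^sup>+r. ennreal (exponential_density 1 r) * (ennreal (2 * exp (s - r)) * indicator {..s} r) \<partial>lborel)"
    unfolding exp1_def by (subst nn_integral_density) auto
  also have "\<dots> = (\<integral>\<^sup>+r. ennreal (2 * exp (s - 2 * r)) * indicator {0..s} r \<partial>lborel)"
  proof (rule nn_integral_cong)
    fix r :: real
    have "exp (- r) * (2 * exp (s - r)) = 2 * exp (s - 2 * r)"
      by (simp add: mult.left_commute flip: exp_add)
    then show "ennreal (exponential_density 1 r) * (ennreal (2 * exp (s - r)) * indicator {..s} r) =
        ennreal (2 * exp (s - 2 * r)) * indicator {0..s} r"
      by (simp add: exponential_density_def indicator_def flip: ennreal_mult'')
  qed
  also have "\<dots> = ennreal (- exp (s - 2 * s) - (- exp (s - 2 * 0)))"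
    using assms by (intro nn_integral_FTC_Icc) (auto intro!: derivative_eq_intros)
  finally show ?thesis
    using assms by (simp add: emeasure_exp1_greaterThan ennreal_plus[symmetric] del: ennreal_plus)
qed

text \<open>The mean of a Yule process. The bound does not depend on \<open>n\<close>, so monotone
  convergence removes the truncation, and finite mean gives a finite population almost
  surely.\<close>

lemma nn_integral_population_le:
  "0 \<le> s \<Longrightarrow> (\<integral>\<^sup>+t. population n s t \<partial>clock_space) \<le> ennreal (exp s)"
proof (induction n arbitrary: s)
  interpret C: prob_space clock_space by (rule prob_space_clock_space)
  case 0
  have "population 0 s t = 1" for t
  proof -
    have "{b. ball_size b \<le> 0} = {[]}"
      by (auto simp: ball_size_def elim: list.set_cases)
    then show ?thesis using 0 by (simp add: population_def)
  qed
  then show ?case using 0 by (simp add: C.emeasure_space_1[simplified])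
next
  case (Suc n)
  interpret C: prob_space clock_space by (rule prob_space_clock_space)
  interpret CC: pair_prob_space clock_space clock_space ..
  let ?G = "\<lambda>z. if s < fst z then 1 else population n (s - fst z) (fst (snd z)) + population n (s - fst z) (snd (snd z))"
  have "(\<integral>\<^sup>+t. population (Suc n) s t \<partial>clock_space) =
      (\<integral>\<^sup>+t. ?G (t ([], 0), (\<lambda>i. t (later_clock i), \<lambda>i. t (first_clock i))) \<partial>clock_space)"
    using AE_clock_pos
    by (intro nn_integral_cong_AE) (auto elim!: eventually_mono simp: population_Suc[OF _ Suc.prems] simp del: split_paired_All)
  also have "\<dots> = (\<integral>\<^sup>+z. ?G z \<partial>distr clock_space (exp1 \<Otimes>\<^sub>M (clock_space \<Otimes>\<^sub>M clock_space))
      (\<lambda>t. (t ([], 0), (\<lambda>i. t (later_clock i), \<lambda>i. t (first_clock i)))))"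
    by (intro nn_integral_distr[symmetric] measurable_Pair measurable_later_clock measurable_first_clock) measurable
  also have "\<dots> = (\<integral>\<^sup>+z. ?G z \<partial>(exp1 \<Otimes>\<^sub>M (clock_space \<Otimes>\<^sub>M clock_space)))"
    by (simp only: distr_clock_space_split)
  also have "\<dots> = (\<integral>\<^sup>+r. \<integral>\<^sup>+y. ?G (r, y) \<partial>(clock_space \<Otimes>\<^sub>M clock_space) \<partial>exp1)"
    by (rule CC.nn_integral_fst[symmetric]) measurable
  also have "\<dots> \<le> (\<integral>\<^sup>+r. (if s < r then 1 else ennreal (2 * exp (s - r))) \<partial>exp1)"
  proof (rule nn_integral_mono)
    fix r :: real
    have "(\<integral>\<^sup>+y. population n (s - r) (fst y) + population n (s - r) (snd y) \<partial>(clock_space \<Otimes>\<^sub>M clock_space))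
        \<le> ennreal (2 * exp (s - r))" if "r \<le> s"
    proof -
      have "(\<integral>\<^sup>+y. population n (s - r) (fst y) + population n (s - r) (snd y) \<partial>(clock_space \<Otimes>\<^sub>M clock_space)) =
        (\<integral>\<^sup>+y. population n (s - r) (fst y) \<partial>(clock_space \<Otimes>\<^sub>M clock_space)) +
        (\<integral>\<^sup>+y. population n (s - r) (snd y) \<partial>(clock_space \<Otimes>\<^sub>M clock_space))"
        by (rule nn_integral_add) measurable
      also have "(\<integral>\<^sup>+y. population n (s - r) (fst y) \<partial>(clock_space \<Otimes>\<^sub>M clock_space)) = (\<integral>\<^sup>+t. population n (s - r) t \<partial>clock_space)"
        by (subst C.nn_integral_fst[symmetric]) (auto simp: C.emeasure_space_1[simplified])
      also have "(\<integral>\<^sup>+y. population n (s - r) (snd y) \<partial>(clock_space \<Otimes>\<^sub>M clock_space)) = (\<integral>\<^sup>+t. population n (s - r) t \<partial>clock_space)"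
        by (subst C.nn_integral_fst[symmetric]) (auto simp: C.emeasure_space_1[simplified])
      also have "(\<integral>\<^sup>+t. population n (s - r) t \<partial>clock_space) + (\<integral>\<^sup>+t. population n (s - r) t \<partial>clock_space)
          \<le> ennreal (exp (s - r)) + ennreal (exp (s - r))"
        using that by (intro add_mono Suc.IH) auto
      finally show ?thesis by (simp add: ennreal_plus[symmetric] del: ennreal_plus)
    qed
    then show "(\<integral>\<^sup>+y. ?G (r, y) \<partial>(clock_space \<Otimes>\<^sub>M clock_space)) \<le> (if s < r then 1 else ennreal (2 * exp (s - r)))"
      using CC.emeasure_space_1 by (simp add: space_pair_measure)
  qed
  also have "\<dots> \<le> ennreal (exp s)"
    by (rule nn_integral_exp1_le) fact
  finally show ?case .
qed

lemma incseq_population: "incseq (\<lambda>n. population n s t)"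
proof (rule incseq_SucI)
  fix n
  have "{b. ball_size b \<le> n \<and> born b t \<le> s} \<subseteq> {b. ball_size b \<le> Suc n \<and> born b t \<le> s}"
    by auto
  then show "population n s t \<le> population (Suc n) s t"
    unfolding population_eq_card
    by (intro of_nat_mono card_mono) (auto intro: finite_subset[OF _ finite_ball_size[of "Suc n"]])
qed

lemma nn_integral_SUP_population_le:
  assumes "0 \<le> s"
  shows "(\<integral>\<^sup>+t. (SUP n. population n s t) \<partial>clock_space) \<le> ennreal (exp s)"
proof -
  have "(\<integral>\<^sup>+t. (SUP n. population n s t) \<partial>clock_space) = (SUP n. \<integral>\<^sup>+t. population n s t \<partial>clock_space)"
    using incseq_population
    by (intro nn_integral_monotone_convergence_SUP) (auto simp: incseq_def le_fun_def)
  also have "\<dots> \<le> ennreal (exp s)"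
    using assms by (intro SUP_least nn_integral_population_le)
  finally show ?thesis .
qed

lemma SUP_population_eq:
  assumes "finite {b. born b t \<le> s}"
  shows "(SUP n. population n s t) = of_nat (card {b. born b t \<le> s})"
proof -
  obtain n0 where n0: "{b. born b t \<le> s} \<subseteq> {b. ball_size b \<le> n0}"
    using finite_subset_ball_size[OF assms] .
  then have "{b. ball_size b \<le> n0 \<and> born b t \<le> s} = {b. born b t \<le> s}" by auto
  then have eq: "population n0 s t = of_nat (card {b. born b t \<le> s})"
    by (simp add: population_eq_card)
  show ?thesis
  proof (rule antisym)
    show "(SUP n. population n s t) \<le> of_nat (card {b. born b t \<le> s})"
      unfolding population_eq_card using assms by (intro SUP_least of_nat_mono card_mono) auto
    show "of_nat (card {b. born b t \<le> s}) \<le> (SUP n. population n s t)"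
      unfolding eq[symmetric] by (rule SUP_upper) simp
  qed
qed

lemma finite_born_of_SUP_population:
  assumes "(SUP n. population n s t) \<noteq> \<infinity>"
  shows "finite {b. born b t \<le> s}"
proof -
  obtain K :: nat where K: "(SUP n. population n s t) \<le> of_nat K"
    using assms by (metis ennreal_Ex_less_of_nat infinity_ennreal_def less_imp_le top.not_eq_extremum)
  show ?thesis
  proof (rule finite_if_finite_subsets_card_bdd[THEN conjunct1])
    fix G assume G: "G \<subseteq> {b. born b t \<le> s}" "finite G"
    obtain n where n: "G \<subseteq> {b. ball_size b \<le> n}"
      using finite_subset_ball_size[OF G(2)] .
    have "card G \<le> card {b. ball_size b \<le> n \<and> born b t \<le> s}"
      using G n by (intro card_mono) (auto intro: finite_subset[OF _ finite_ball_size[of n]])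
    moreover have "population n s t \<le> of_nat K"
      using SUP_upper[of n UNIV "\<lambda>n. population n s t"] K by (simp add: order_trans)
    then have "card {b. ball_size b \<le> n \<and> born b t \<le> s} \<le> K"
      by (simp add: population_eq_card ennreal_of_nat_eq_real_of_nat)
    ultimately show "card G \<le> K" by simp
  qed
qed

lemma AE_finite_born: "AE t in clock_space. \<forall>s. finite {b. born b t \<le> s}"
proof -
  have "AE t in clock_space. (SUP n. population n (real m) t) \<noteq> \<infinity>" for m
    using nn_integral_SUP_population_le[of "real m"]
    by (intro nn_integral_PInf_AE) (auto simp: top_unique)
  then have "AE t in clock_space. \<forall>m. (SUP n. population n (real m) t) \<noteq> \<infinity>"
    by (simp add: AE_all_countable)
  then show ?thesis
  proof eventually_elim
    fix t assume *: "\<forall>m. (SUP n. population n (real m) t) \<noteq> \<infinity>"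
    show "\<forall>s. finite {b. born b t \<le> s}"
    proof
      fix s :: real
      obtain m :: nat where m: "s \<le> real m" using real_arch_simple by blast
      have "finite {b. born b t \<le> real m}"
        using * by (intro finite_born_of_SUP_population) auto
      then show "finite {b. born b t \<le> s}"
        by (rule finite_subset[rotated]) (use m in auto)
    qed
  qed
qed

subsection \<open>The space of clocks and marks\<close>

locale elephant_parameters =
  fixes p :: real and i1 :: "'d::finite"
  assumes p_gt: "(2 * real CARD('d) + 1) / (4 * real CARD('d)) < p" and p_less_1: "p < 1"
begin

definition dim :: real where "dim = real CARD('d)"
definition \<beta> :: real where "\<beta> = (1 - p) / (2 * dim - 1)"
definition a :: real where "a = (2 * dim * p - 1) / (2 * dim - 1)"

lemma dim_ge_1: "1 \<le> dim"
  unfolding dim_def by (simp add: Suc_leI)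

lemma p_gt_half: "1 / 2 < p"
proof -
  have "(1::real) / 2 < (2 * dim + 1) / (4 * dim)"
    using dim_ge_1 by (simp add: field_simps)
  then show ?thesis using p_gt unfolding dim_def by linarith
qed

lemma \<beta>_pos: "0 < \<beta>"
  unfolding \<beta>_def using dim_ge_1 p_less_1 by simp

lemma a_eq: "a = p - \<beta>"
  unfolding a_def \<beta>_def using dim_ge_1 by (simp add: field_simps)

lemma a_\<beta>: "2 * dim * \<beta> + a = 1"
proof -
  have "2 * dim * \<beta> + a = (2 * dim * (1 - p) + (2 * dim * p - 1)) / (2 * dim - 1)"
    by (simp add: a_def \<beta>_def add_divide_distrib)
  also have "\<dots> = 1"
    using dim_ge_1 by (simp add: algebra_simps)
  finally show ?thesis .
qed

lemma a_gt_half: "1 / 2 < a"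
proof -
  have "2 * dim + 1 < 4 * dim * p"
    using p_gt dim_ge_1 by (simp add: dim_def field_simps)
  then show ?thesis unfolding a_def using dim_ge_1 by (simp add: field_simps)
qed

lemma a_less_1: "a < 1"
  using a_\<beta> \<beta>_pos dim_ge_1 by (smt (verit) mult_pos_pos)

definition q :: "'d direction \<Rightarrow> 'd direction \<Rightarrow> real" where
  "q v u = (if u = v then p else \<beta>)"

lemma q_nonneg: "0 \<le> q v u"
  using p_gt_half \<beta>_pos by (simp add: q_def)

text \<open>The matrix \<open>q\<close> is \<beta> times the all-ones matrix plus \<open>a\<close>
  times the identity. Thus \<open>a\<close> is its eigenvalue on vectors with sum zero, the source
  of the normalisation exp (a t).\<close>

lemma sum_q:
  fixes h :: "'d direction \<Rightarrow> 'b::real_vector"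
  shows "(\<Sum>u\<in>UNIV. q v u *\<^sub>R h u) = \<beta> *\<^sub>R (\<Sum>u\<in>UNIV. h u) + a *\<^sub>R h v"
proof -
  have "(\<Sum>u\<in>UNIV. q v u *\<^sub>R h u) = (\<Sum>u\<in>UNIV. \<beta> *\<^sub>R h u + (if u = v then a *\<^sub>R h u else 0))"
    by (intro sum.cong) (auto simp: q_def a_eq scaleR_diff_left)
  also have "\<dots> = \<beta> *\<^sub>R (\<Sum>u\<in>UNIV. h u) + a *\<^sub>R h v"
    by (simp add: sum.distrib scaleR_sum_right)
  finally show ?thesis .
qed

lemma sum_q_eq_1: "(\<Sum>u\<in>UNIV. q v u) = 1"
proof -
  have "(\<Sum>u\<in>(UNIV :: 'd direction set). 1 :: real) = 2 * dim"
    by (subst sum_direction) (simp add: dim_def)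
  then show ?thesis
    using sum_q[of v "\<lambda>_. 1 :: real"] a_\<beta> by (simp add: algebra_simps del: sum_constant)
qed

definition mark_law :: "'d direction \<Rightarrow> 'd direction measure" where
  "mark_law v = point_measure UNIV (\<lambda>u. ennreal (q v u))"

lemma sets_mark_law [measurable_cong, simp]: "sets (mark_law v) = UNIV"
  by (simp add: mark_law_def sets_point_measure)

lemma space_mark_law [simp]: "space (mark_law v) = UNIV"
  by (simp add: mark_law_def space_point_measure)

lemma measurable_mark_law [simp]: "N \<rightarrow>\<^sub>M mark_law v = N \<rightarrow>\<^sub>M count_space UNIV"
  by (rule measurable_cong_sets) simp_all

lemma emeasure_mark_law: "emeasure (mark_law v) {u} = ennreal (q v u)"
  unfolding mark_law_def by (subst emeasure_point_measure_finite) auto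

lemma prob_space_mark_law: "prob_space (mark_law v)"
proof
  have "emeasure (mark_law v) UNIV = (\<Sum>u\<in>UNIV. ennreal (q v u))"
    unfolding mark_law_def by (subst emeasure_point_measure_finite) auto
  also have "\<dots> = ennreal (\<Sum>u\<in>UNIV. q v u)"
    by (simp add: sum_ennreal q_nonneg)
  finally show "emeasure (mark_law v) (space (mark_law v)) = 1"
    by (simp add: sum_q_eq_1)
qed

lemma integral_mark_law:
  fixes h :: "'d direction \<Rightarrow> 'b::{banach, second_countable_topology}"
  shows "(\<integral>u. h u \<partial>mark_law v) = (\<Sum>u\<in>UNIV. q v u *\<^sub>R h u)"
  unfolding mark_law_def
  by (subst lebesgue_integral_point_measure_finite) (auto simp: q_nonneg)

definition mark_space :: "'d marks measure" where
  "mark_space = PiM UNIV (\<lambda>i. mark_law (snd i))"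

lemma prob_space_mark_space: "prob_space mark_space"
  unfolding mark_space_def by (intro prob_space_PiM prob_space_mark_law)

lemma measurable_mark [measurable]: "(\<lambda>m. m i) \<in> mark_space \<rightarrow>\<^sub>M count_space UNIV"
proof -
  have "(\<lambda>m. m i) \<in> mark_space \<rightarrow>\<^sub>M mark_law (snd i)"
    unfolding mark_space_def by (rule measurable_component_singleton) simp
  also have "mark_space \<rightarrow>\<^sub>M mark_law (snd i) = mark_space \<rightarrow>\<^sub>M count_space UNIV"
    by (rule measurable_cong_sets) simp_all
  finally show ?thesis .
qed

lemma space_mark_space [simp]: "space mark_space = UNIV"
  by (simp add: mark_space_def space_PiM)

lemma measurable_heading [measurable]: "heading b v \<in> mark_space \<rightarrow>\<^sub>M count_space UNIV"
proof (induction b)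
  case (Cons k b)
  have "(\<lambda>m. (\<lambda>u m. m (k # b, u)) (heading b v m) m) \<in> mark_space \<rightarrow>\<^sub>M count_space UNIV"
    by (rule measurable_compose_countable[OF _ Cons]) measurable
  then show ?case by simp
qed simp

lemma distr_mark_space_split:
  "distr mark_space (mark_space \<Otimes>\<^sub>M mark_space) (\<lambda>m. (\<lambda>i. m (later_mark i), \<lambda>i. m (first_mark i))) =
   mark_space \<Otimes>\<^sub>M mark_space"
proof -
  have "(\<lambda>j. mark_law (snd (later_mark j))) = (\<lambda>j. mark_law (snd j))"
    "(\<lambda>j. mark_law (snd (first_mark j))) = (\<lambda>j. mark_law (snd j))"
    by (auto simp: later_mark_def first_mark_def)
  then show ?thesis
    using distr_PiM_split[of "\<lambda>i. mark_law (snd i)" later_mark first_mark]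
    by (simp add: mark_space_def prob_space_mark_law inj_later_mark inj_first_mark later_first_mark_disjoint)
qed

lemma measurable_later_mark: "(\<lambda>m i. m (later_mark i)) \<in> mark_space \<rightarrow>\<^sub>M mark_space"
  unfolding mark_space_def using measurable_PiM_reindex[of later_mark UNIV "\<lambda>i. mark_law (snd i)"]
  by (simp add: later_mark_def case_prod_beta)

lemma measurable_first_mark: "(\<lambda>m i. m (first_mark i)) \<in> mark_space \<rightarrow>\<^sub>M mark_space"
  unfolding mark_space_def using measurable_PiM_reindex[of first_mark UNIV "\<lambda>i. mark_law (snd i)"]
  by (simp add: first_mark_def case_prod_beta)

definition tree_space :: "(clocks \<times> 'd marks) measure" where
  "tree_space = clock_space \<Otimes>\<^sub>M mark_space"

lemma prob_space_tree_space: "prob_space tree_space"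
proof -
  interpret C: prob_space clock_space by (rule prob_space_clock_space)
  interpret M: prob_space mark_space by (rule prob_space_mark_space)
  interpret pair_prob_space clock_space mark_space ..
  show ?thesis unfolding tree_space_def by (rule prob_space_axioms)
qed

sublocale tree: prob_space tree_space
  by (rule prob_space_tree_space)

lemma space_tree_space [simp]: "space tree_space = UNIV"
  by (simp add: tree_space_def space_pair_measure)

lemma measurable_fst_tree [measurable]: "fst \<in> tree_space \<rightarrow>\<^sub>M clock_space"
  unfolding tree_space_def by measurable

lemma measurable_snd_tree [measurable]: "snd \<in> tree_space \<rightarrow>\<^sub>M mark_space"
  unfolding tree_space_def by measurable

lemma measurable_later: "later \<in> tree_space \<rightarrow>\<^sub>M tree_space"
proof -
  have "later = (\<lambda>x. ((\<lambda>t i. t (later_clock i)) (fst x), (\<lambda>m i. m (later_mark i)) (snd x)))"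
    by (simp add: later_def fun_eq_iff)
  also have "\<dots> \<in> tree_space \<rightarrow>\<^sub>M clock_space \<Otimes>\<^sub>M mark_space"
    by (intro measurable_Pair measurable_compose[OF _ measurable_later_clock] measurable_compose[OF _ measurable_later_mark]) auto
  finally show ?thesis by (simp add: tree_space_def)
qed

lemma measurable_first: "first \<in> tree_space \<rightarrow>\<^sub>M tree_space"
proof -
  have "first = (\<lambda>x. ((\<lambda>t i. t (first_clock i)) (fst x), (\<lambda>m i. m (first_mark i)) (snd x)))"
    by (simp add: first_def fun_eq_iff)
  also have "\<dots> \<in> tree_space \<rightarrow>\<^sub>M clock_space \<Otimes>\<^sub>M mark_space"
    by (intro measurable_Pair measurable_compose[OF _ measurable_first_clock] measurable_compose[OF _ measurable_first_mark]) auto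
  finally show ?thesis by (simp add: tree_space_def)
qed

text \<open>The branching property in law. Clocks and marks are split separately and then regrouped
  into two trees independent of each other and of the first ring.\<close>

lemma distr_tree_space_split:
  "distr tree_space (exp1 \<Otimes>\<^sub>M (tree_space \<Otimes>\<^sub>M tree_space)) (\<lambda>x. (fst x ([], 0), (later x, first x))) =
   exp1 \<Otimes>\<^sub>M (tree_space \<Otimes>\<^sub>M tree_space)"
proof -
  let ?C = "exp1 \<Otimes>\<^sub>M (clock_space \<Otimes>\<^sub>M clock_space)" and ?M = "mark_space \<Otimes>\<^sub>M mark_space"
  let ?c = "\<lambda>t. (t ([], 0), (\<lambda>i. t (later_clock i), \<lambda>i. t (first_clock i)))"
  let ?m = "\<lambda>m. (\<lambda>i. m (later_mark i), \<lambda>i. m (first_mark i))"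
  let ?r = "\<lambda>((e, (a, b)), (c, d)). (e, ((a, c), (b, d)))"
  interpret M: prob_space mark_space by (rule prob_space_mark_space)
  interpret MM: pair_prob_space mark_space mark_space ..
  have c: "?c \<in> clock_space \<rightarrow>\<^sub>M ?C"
    by (intro measurable_Pair measurable_later_clock measurable_first_clock) simp
  have m: "?m \<in> mark_space \<rightarrow>\<^sub>M ?M"
    by (intro measurable_Pair measurable_later_mark measurable_first_mark)
  have r_eq: "?r = (\<lambda>x. (fst (fst x), ((fst (snd (fst x)), fst (snd x)), (snd (snd (fst x)), snd (snd x)))))"
    by (auto simp: fun_eq_iff)
  have r: "?r \<in> ?C \<Otimes>\<^sub>M ?M \<rightarrow>\<^sub>M exp1 \<Otimes>\<^sub>M (tree_space \<Otimes>\<^sub>M tree_space)"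
    unfolding tree_space_def by (subst r_eq) measurable
  have cm: "(\<lambda>(t, n). (?c t, ?m n)) \<in> clock_space \<Otimes>\<^sub>M mark_space \<rightarrow>\<^sub>M ?C \<Otimes>\<^sub>M ?M"
    unfolding case_prod_beta by (intro measurable_Pair[OF measurable_compose[OF measurable_fst c] measurable_compose[OF measurable_snd m], unfolded comp_def])
  have "distr tree_space (?C \<Otimes>\<^sub>M ?M) (\<lambda>(t, n). (?c t, ?m n)) = distr clock_space ?C ?c \<Otimes>\<^sub>M distr mark_space ?M ?m"
    unfolding tree_space_def distr_mark_space_split
    using MM.sigma_finite_measure_axioms
    by (subst pair_measure_distr[OF c m, unfolded distr_mark_space_split, symmetric]) (auto simp: distr_mark_space_split)
  also have "\<dots> = ?C \<Otimes>\<^sub>M ?M"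
    by (simp add: distr_clock_space_split distr_mark_space_split)
  finally have *: "distr tree_space (?C \<Otimes>\<^sub>M ?M) (\<lambda>(t, n). (?c t, ?m n)) = ?C \<Otimes>\<^sub>M ?M" .
  have comp: "?r \<circ> (\<lambda>(t, n). (?c t, ?m n)) = (\<lambda>x. (fst x ([], 0), (later x, first x)))"
    by (auto simp: fun_eq_iff later_def first_def)
  have "distr (distr tree_space (?C \<Otimes>\<^sub>M ?M) (\<lambda>(t, n). (?c t, ?m n))) (exp1 \<Otimes>\<^sub>M (tree_space \<Otimes>\<^sub>M tree_space)) ?r =
      exp1 \<Otimes>\<^sub>M (tree_space \<Otimes>\<^sub>M tree_space)"
    unfolding * unfolding tree_space_def
    by (intro distr_pair_rearrange prob_space_exp1 prob_space_clock_space prob_space_mark_space)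
  then show ?thesis
    unfolding distr_distr[OF r cm[folded tree_space_def]] comp .
qed

lemma distr_fst_tree: "distr tree_space clock_space fst = clock_space"
proof -
  interpret C: prob_space clock_space by (rule prob_space_clock_space)
  interpret M: prob_space mark_space by (rule prob_space_mark_space)
  show ?thesis unfolding tree_space_def by (rule M.distr_pair_fst)
qed

lemma AE_tree_pos: "AE x in tree_space. \<forall>i. 0 < fst x i"
  by (rule AE_distrD[OF measurable_fst_tree]) (unfold distr_fst_tree, rule AE_clock_pos)

lemma AE_tree_finite: "AE x in tree_space. \<forall>s. finite {b. born b (fst x) \<le> s}"
  by (rule AE_distrD[OF measurable_fst_tree]) (unfold distr_fst_tree, rule AE_finite_born)

lemma measurable_position [measurable]:
  "(\<lambda>(s, x). position v s x) \<in> borel_measurable (borel \<Otimes>\<^sub>M tree_space)"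
proof -
  have "(\<lambda>y. if born b (fst (snd y)) \<le> fst y then vec_of (heading b v (snd (snd y))) else 0)
      \<in> borel_measurable (borel \<Otimes>\<^sub>M tree_space)" for b
    by measurable
  then have "(\<lambda>y. position_upto n v (fst y) (snd y)) \<in> borel_measurable (borel \<Otimes>\<^sub>M tree_space)" for n
    unfolding position_upto_def by (intro borel_measurable_sum) auto
  then show ?thesis
    unfolding position_def case_prod_beta by (intro borel_measurable_lim_metric) auto
qed

text \<open>The function F of the overview, realised on the canonical space.\<close>

definition cf :: "'d direction \<Rightarrow> real \<Rightarrow> real ^ 'd \<Rightarrow> complex" where
  "cf v s \<zeta> = (CLINT x | tree_space. iexp (\<zeta> \<bullet> position v s x))"

lemma norm_cf_le_1: "cmod (cf v s \<zeta>) \<le> 1"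
proof -
  have "cmod (cf v s \<zeta>) \<le> (LINT x | tree_space. cmod (iexp (\<zeta> \<bullet> position v s x)))"
    unfolding cf_def by (rule integral_norm_bound)
  then show ?thesis by (simp add: tree.prob_space[simplified])
qed

lemma measurable_cf [measurable]: "(\<lambda>s. cf v s \<zeta>) \<in> borel_measurable borel"
  unfolding cf_def by measurable

text \<open>\<open>heading\<close> never reads the coordinate \<open>([], v)\<close>. It can thus be
  redrawn from \<open>mark_law v\<close> independently of all that determines the position, and
  averaging over it gives the weights \<open>q v u\<close>.\<close>

lemma integral_iexp_first_child:
  "(CLINT x | tree_space. iexp (\<zeta> \<bullet> position (snd x ([], v)) s x)) = (\<Sum>u\<in>UNIV. q v u *\<^sub>R cf u s \<zeta>)"
proof -
  interpret C: prob_space clock_space by (rule prob_space_clock_space)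
  interpret M: prob_space mark_space by (rule prob_space_mark_space)
  interpret L: prob_space "mark_law v" by (rule prob_space_mark_law)
  interpret CM: pair_prob_space clock_space mark_space ..
  interpret LM: pair_prob_space "mark_law v" mark_space ..
  have [measurable]: "(\<lambda>x. iexp (\<zeta> \<bullet> position u s x)) \<in> borel_measurable tree_space" for u
    by measurable
  have [measurable]: "(\<lambda>x. iexp (\<zeta> \<bullet> position (snd x ([], v)) s x)) \<in> borel_measurable tree_space"
    by (rule measurable_compose_countable[where f = "\<lambda>u x. iexp (\<zeta> \<bullet> position u s x)"]) measurable
  have upd: "position u s (t, m(([], v) := u')) = position u s (t, m)" for u u' t m
    by (simp add: position_def position_upto_def heading_fun_upd cong: if_cong)
  have resample: "distr (mark_law v \<Otimes>\<^sub>M mark_space) mark_space (\<lambda>(u, m). m(([], v) := u)) = mark_space"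
    using distr_pair_PiM_eq_PiM[of UNIV "\<lambda>i. mark_law (snd i)" "([], v)"]
    by (simp add: mark_space_def prob_space_mark_law)
  have upd_meas: "(\<lambda>(u, m). m(([], v) := u)) \<in> mark_law v \<Otimes>\<^sub>M mark_space \<rightarrow>\<^sub>M mark_space"
    unfolding mark_space_def case_prod_beta by (rule measurable_fun_upd[where J = UNIV])
      (use measurable_fst[of "mark_law v" "PiM UNIV (\<lambda>i. mark_law (snd i))"] in auto)
  have inner: "(CLINT m | mark_space. iexp (\<zeta> \<bullet> position (m ([], v)) s (t, m))) =
      (\<Sum>u\<in>UNIV. q v u *\<^sub>R (CLINT m | mark_space. iexp (\<zeta> \<bullet> position u s (t, m))))" for t
  proof -
    have [measurable]: "Pair t \<in> mark_space \<rightarrow>\<^sub>M tree_space"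
      unfolding tree_space_def by measurable
    have [measurable]: "(\<lambda>m. iexp (\<zeta> \<bullet> position u s (t, m))) \<in> borel_measurable mark_space" for u
      by measurable
    have m1: "(\<lambda>m. iexp (\<zeta> \<bullet> position (m ([], v)) s (t, m))) \<in> borel_measurable mark_space"
      by (rule measurable_compose_countable[where f = "\<lambda>u m. iexp (\<zeta> \<bullet> position u s (t, m))"]) measurable
    have fst_meas: "fst \<in> mark_law v \<Otimes>\<^sub>M mark_space \<rightarrow>\<^sub>M count_space UNIV"
      using measurable_fst[of "mark_law v" mark_space] by simp
    have m2: "(\<lambda>z. iexp (\<zeta> \<bullet> position (fst z) s (t, snd z))) \<in> borel_measurable (mark_law v \<Otimes>\<^sub>M mark_space)"
      by (rule measurable_compose_countable[where f = "\<lambda>u z. iexp (\<zeta> \<bullet> position u s (t, snd z))", OF _ fst_meas]) measurable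
    have "(CLINT m | mark_space. iexp (\<zeta> \<bullet> position (m ([], v)) s (t, m))) =
        (CLINT z | mark_law v \<Otimes>\<^sub>M mark_space. iexp (\<zeta> \<bullet> position (fst z) s (t, snd z)))"
      by (subst resample[symmetric], subst integral_distr[OF upd_meas m1]) (simp add: case_prod_beta upd)
    also have "\<dots> = (CLINT u | mark_law v. CLINT m | mark_space. iexp (\<zeta> \<bullet> position u s (t, m)))"
      using m2 by (subst LM.integral_fst'[symmetric]) (auto intro!: LM.integrable_const_bound[where B = 1])
    finally show ?thesis by (simp add: integral_mark_law)
  qed
  have "(CLINT x | tree_space. iexp (\<zeta> \<bullet> position (snd x ([], v)) s x)) =
      (CLINT t | clock_space. CLINT m | mark_space. iexp (\<zeta> \<bullet> position (m ([], v)) s (t, m)))"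
    unfolding tree_space_def
    by (subst CM.integral_fst'[symmetric])
      (auto simp: tree_space_def[symmetric] intro!: tree.integrable_const_bound[where B = 1])
  also have "\<dots> = (CLINT t | clock_space. \<Sum>u\<in>UNIV. q v u *\<^sub>R (CLINT m | mark_space. iexp (\<zeta> \<bullet> position u s (t, m))))"
    by (simp only: inner)
  also have "\<dots> = (\<Sum>u\<in>UNIV. q v u *\<^sub>R (CLINT t | clock_space. CLINT m | mark_space. iexp (\<zeta> \<bullet> position u s (t, m))))"
  proof -
    have "integrable clock_space (\<lambda>t. CLINT m | mark_space. iexp (\<zeta> \<bullet> position u s (t, m)))" for u
      by (rule CM.integrable_fst')
        (auto simp: tree_space_def[symmetric] intro!: tree.integrable_const_bound[where B = 1])
    then show ?thesis by (subst Bochner_Integration.integral_sum) auto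
  qed
  also have "\<dots> = (\<Sum>u\<in>UNIV. q v u *\<^sub>R cf u s \<zeta>)"
    unfolding cf_def tree_space_def
    by (subst CM.integral_fst')
      (auto simp: tree_space_def[symmetric] intro!: tree.integrable_const_bound[where B = 1])
  finally show ?thesis .
qed

end

subsection \<open>The characteristic functions at finite times\<close>

context elephant_parameters
begin

text \<open>The characteristic function of the urn started from a child of a ball of direction
  \<open>v\<close>.\<close>

definition mcf :: "'d direction \<Rightarrow> real \<Rightarrow> real ^ 'd \<Rightarrow> complex" where
  "mcf v s \<zeta> = (\<Sum>u\<in>UNIV. q v u *\<^sub>R cf u s \<zeta>)"

lemma norm_mcf_le_1: "cmod (mcf v s \<zeta>) \<le> 1"
proof -
  have "cmod (mcf v s \<zeta>) \<le> (\<Sum>u\<in>UNIV. q v u * cmod (cf u s \<zeta>))"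
    unfolding mcf_def by (rule order_trans[OF norm_sum]) (simp add: q_nonneg)
  also have "\<dots> \<le> (\<Sum>u\<in>UNIV. q v u * 1)"
    by (intro sum_mono mult_left_mono norm_cf_le_1 q_nonneg)
  finally show ?thesis by (simp add: sum_q_eq_1)
qed

lemma measurable_mcf [measurable]: "(\<lambda>s. mcf v s \<zeta>) \<in> borel_measurable borel"
  unfolding mcf_def by measurable

lemma measurable_iexp_position [measurable]:
  "(\<lambda>y. iexp (\<zeta> \<bullet> position v (fst y) (snd y))) \<in> borel_measurable (borel \<Otimes>\<^sub>M tree_space)"
  by measurable

lemma measurable_iexp_first_child:
  "(\<lambda>y. iexp (\<zeta> \<bullet> position (snd (snd y) ([], v)) (fst y) (snd y))) \<in> borel_measurable (borel \<Otimes>\<^sub>M tree_space)"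
  by (rule measurable_compose_countable[where f = "\<lambda>u y. iexp (\<zeta> \<bullet> position u (fst y) (snd y))"]) measurable

text \<open>Conditioning on the first ring \<open>r\<close>: for \<open>r \<le> s\<close> there
  remain two independent urns of age \<open>s - r\<close>, one from the old ball and one from its
  child, so the characteristic functions multiply.\<close>

lemma cf_first_split:
  assumes "0 \<le> s"
  shows "cf v s \<zeta> = (CLINT r | exp1. if s < r then iexp (\<zeta> \<bullet> vec_of v) else cf v (s - r) \<zeta> * mcf v (s - r) \<zeta>)"
proof -
  interpret TT: pair_prob_space tree_space tree_space ..
  interpret E: prob_space exp1 by (rule prob_space_exp1)
  interpret ET: pair_prob_space exp1 "tree_space \<Otimes>\<^sub>M tree_space" ..
  define A where "A r x = iexp (\<zeta> \<bullet> position v (s - r) x)" for r x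
  define B where "B r x = iexp (\<zeta> \<bullet> position (snd x ([], v)) (s - r) x)" for r x
  define H where "H z = (if s < fst z then iexp (\<zeta> \<bullet> vec_of v) else A (fst z) (fst (snd z)) * B (fst z) (snd (snd z)))" for z
  have A_meas [measurable]: "(\<lambda>z. A (fst z) (snd z)) \<in> borel_measurable (borel \<Otimes>\<^sub>M tree_space)"
    unfolding A_def by (rule measurable_compose[OF _ measurable_iexp_position, where f = "\<lambda>z. (s - fst z, snd z)", simplified]) measurable
  have B_meas [measurable]: "(\<lambda>z. B (fst z) (snd z)) \<in> borel_measurable (borel \<Otimes>\<^sub>M tree_space)"
    unfolding B_def by (rule measurable_compose[OF _ measurable_iexp_first_child, where f = "\<lambda>z. (s - fst z, snd z)", simplified]) measurable
  have A_meas' [measurable]: "(\<lambda>z. A (f z) (g z)) \<in> borel_measurable N"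
    if [measurable]: "f \<in> borel_measurable N" "g \<in> N \<rightarrow>\<^sub>M tree_space" for f g N
    using measurable_compose[OF _ A_meas, of "\<lambda>z. (f z, g z)" N] by simp
  have B_meas' [measurable]: "(\<lambda>z. B (f z) (g z)) \<in> borel_measurable N"
    if [measurable]: "f \<in> borel_measurable N" "g \<in> N \<rightarrow>\<^sub>M tree_space" for f g N
    using measurable_compose[OF _ B_meas, of "\<lambda>z. (f z, g z)" N] by simp
  have H_meas [measurable]: "H \<in> borel_measurable (exp1 \<Otimes>\<^sub>M (tree_space \<Otimes>\<^sub>M tree_space))"
    unfolding H_def by measurable
  have split_meas: "(\<lambda>x. (fst x ([], 0), (later x, first x))) \<in> tree_space \<rightarrow>\<^sub>M exp1 \<Otimes>\<^sub>M (tree_space \<Otimes>\<^sub>M tree_space)"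
    by (intro measurable_Pair measurable_later measurable_first) simp
  have norm_A: "cmod (A r x) = 1" and norm_B: "cmod (B r x) = 1" for r x
    by (simp_all add: A_def B_def)
  have norm_H: "cmod (H z) = 1" for z
    by (simp add: H_def norm_A norm_B norm_mult)
  have "cf v s \<zeta> = (CLINT x | tree_space. H (fst x ([], 0), (later x, first x)))"
    unfolding cf_def
  proof (rule integral_cong_AE)
    show "AE x in tree_space. iexp (\<zeta> \<bullet> position v s x) = H (fst x ([], 0), (later x, first x))"
      using AE_tree_pos AE_tree_finite
    proof eventually_elim
      fix x :: "clocks \<times> 'd marks"
      assume "\<forall>i. 0 < fst x i" and "\<forall>s. finite {b. born b (fst x) \<le> s}"
      then show "iexp (\<zeta> \<bullet> position v s x) = H (fst x ([], 0), (later x, first x))"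
        using position_split[of x s v] assms
        by (simp add: H_def A_def B_def inner_add_right algebra_simps exp_add del: split_paired_All)
    qed
    show "(\<lambda>x. H (fst x ([], 0), (later x, first x))) \<in> borel_measurable tree_space"
      using measurable_compose[OF split_meas H_meas] by simp
  qed measurable
  also have "\<dots> = integral\<^sup>L (distr tree_space (exp1 \<Otimes>\<^sub>M (tree_space \<Otimes>\<^sub>M tree_space)) (\<lambda>x. (fst x ([], 0), (later x, first x)))) H"
    by (rule integral_distr[OF split_meas H_meas, symmetric])
  also have "\<dots> = integral\<^sup>L (exp1 \<Otimes>\<^sub>M (tree_space \<Otimes>\<^sub>M tree_space)) H"
    by (simp only: distr_tree_space_split)
  also have "\<dots> = (CLINT r | exp1. CLINT y | tree_space \<Otimes>\<^sub>M tree_space. H (r, y))"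
    by (intro ET.integral_fst'[symmetric] ET.integrable_const_bound[where B = 1]) (auto simp: norm_H)
  also have "\<dots> = (CLINT r | exp1. if s < r then iexp (\<zeta> \<bullet> vec_of v) else cf v (s - r) \<zeta> * mcf v (s - r) \<zeta>)"
  proof (rule Bochner_Integration.integral_cong[OF refl])
    fix r :: real
    have "(CLINT y | tree_space \<Otimes>\<^sub>M tree_space. A r (fst y) * B r (snd y)) = cf v (s - r) \<zeta> * mcf v (s - r) \<zeta>"
    proof -
      have "(CLINT y | tree_space \<Otimes>\<^sub>M tree_space. A r (fst y) * B r (snd y)) =
          (CLINT x | tree_space. CLINT x' | tree_space. A r x * B r x')"
        by (subst TT.integral_fst'[symmetric])
          (auto intro!: TT.integrable_const_bound[where B = 1] simp: norm_mult norm_A norm_B)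
      also have "\<dots> = cf v (s - r) \<zeta> * mcf v (s - r) \<zeta>"
        by (simp add: A_def B_def integral_iexp_first_child cf_def[symmetric] mcf_def del: of_real_mult)
      finally show ?thesis .
    qed
    then show "(CLINT y | tree_space \<Otimes>\<^sub>M tree_space. H (r, y)) =
        (if s < r then iexp (\<zeta> \<bullet> vec_of v) else cf v (s - r) \<zeta> * mcf v (s - r) \<zeta>)"
      using TT.prob_space by (simp add: H_def space_pair_measure)
  qed
  finally show ?thesis .
qed

lemma set_integrable_exp_cf:
  "set_integrable lborel {0..s} (\<lambda>r. exp r *\<^sub>R (cf v r \<zeta> * mcf v r \<zeta>))"
  unfolding set_integrable_def
proof (rule integrableI_bounded_set_indicator[where B = "exp s"])
  show "AE r in lborel. r \<in> {0..s} \<longrightarrow> cmod (exp r *\<^sub>R (cf v r \<zeta> * mcf v r \<zeta>)) \<le> exp s"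
  proof (intro AE_I2 impI)
    fix r assume "r \<in> {0..s}"
    then have "exp r * (cmod (cf v r \<zeta>) * cmod (mcf v r \<zeta>)) \<le> exp s * (1 * 1)"
      by (intro mult_mono norm_cf_le_1 norm_mcf_le_1) auto
    then show "cmod (exp r *\<^sub>R (cf v r \<zeta> * mcf v r \<zeta>)) \<le> exp s"
      by (simp add: norm_mult)
  qed
qed (auto simp: emeasure_lborel_Icc_eq)

text \<open>After the substitution of \<open>s - r\<close> for \<open>r\<close> the factor exp s
  absorbs the exponential density, so \<open>s\<close> survives on the right only as the upper limit
  of integration and can be differentiated.\<close>

lemma cf_volterra:
  assumes "0 \<le> s"
  shows "exp s *\<^sub>R cf v s \<zeta> = iexp (\<zeta> \<bullet> vec_of v) + integral {0..s} (\<lambda>r. exp r *\<^sub>R (cf v r \<zeta> * mcf v r \<zeta>))"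
proof -
  interpret E: prob_space exp1 by (rule prob_space_exp1)
  define c where "c = iexp (\<zeta> \<bullet> vec_of v)"
  define G where "G r = cf v r \<zeta> * mcf v r \<zeta>" for r
  have [measurable]: "G \<in> borel_measurable borel" unfolding G_def by measurable
  have norm_G: "cmod (G r) \<le> 1" for r
    unfolding G_def norm_mult using mult_mono[OF norm_cf_le_1 norm_mcf_le_1] by force
  have norm_G_c: "cmod (G r) \<le> 1 + cmod c" for r
    by (rule order_trans[OF norm_G]) simp
  have "cf v s \<zeta> = (CLINT r | exp1. indicator {s<..} r *\<^sub>R c + indicator {..s} r *\<^sub>R G (s - r))"
    unfolding cf_first_split[OF assms] c_def[symmetric] G_def[symmetric]
    by (intro Bochner_Integration.integral_cong) (auto simp: indicator_def)
  also have "\<dots> = (CLINT r | exp1. indicator {s<..} r *\<^sub>R c) + (CLINT r | exp1. indicator {..s} r *\<^sub>R G (s - r))"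
    using norm_G_c
    by (intro Bochner_Integration.integral_add E.integrable_const_bound[where B = "1 + cmod c"])
      (auto simp: indicator_def)
  also have "(CLINT r | exp1. indicator {s<..} r *\<^sub>R c) = exp (- s) *\<^sub>R c"
    using emeasure_exp1_greaterThan[OF assms] by (simp add: measure_def)
  also have "(CLINT r | exp1. indicator {..s} r *\<^sub>R G (s - r)) =
      (CLBINT r. exponential_density 1 r *\<^sub>R (indicator {..s} r *\<^sub>R G (s - r)))"
    unfolding exp1_def by (intro integral_density) (auto simp: exponential_density_def)
  also have "\<dots> = (CLBINT r. indicator {0..s} (s - r) *\<^sub>R (exp (- r) *\<^sub>R G (s - r)))"
    by (intro Bochner_Integration.integral_cong) (auto simp: exponential_density_def indicator_def)
  also have "\<dots> = (CLBINT r. indicator {0..s} r *\<^sub>R (exp (r - s) *\<^sub>R G r))"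
    by (subst lborel_integral_real_affine[where c = "-1" and t = s]) auto
  also have "\<dots> = (CLBINT r. exp (- s) *\<^sub>R (indicator {0..s} r *\<^sub>R (exp r *\<^sub>R G r)))"
    by (intro Bochner_Integration.integral_cong) (auto simp: indicator_def exp_diff exp_minus field_simps)
  also have "\<dots> = exp (- s) *\<^sub>R (CLBINT r:{0..s}. exp r *\<^sub>R G r)"
    by (simp only: set_lebesgue_integral_def integral_scaleR_right)
  also have "(CLBINT r:{0..s}. exp r *\<^sub>R G r) = integral {0..s} (\<lambda>r. exp r *\<^sub>R G r)"
    unfolding G_def by (rule set_borel_integral_eq_integral(2)[OF set_integrable_exp_cf])
  finally have "exp s *\<^sub>R cf v s \<zeta> = exp s *\<^sub>R (exp (- s) *\<^sub>R (c + integral {0..s} (\<lambda>r. exp r *\<^sub>R G r)))"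
    by (simp add: scaleR_add_right)
  then show ?thesis by (simp add: c_def G_def exp_minus)
qed

lemma cf_0: "cf v 0 \<zeta> = iexp (\<zeta> \<bullet> vec_of v)"
  using cf_volterra[of 0 v \<zeta>] by simp

text \<open>A bootstrap: a bounded measurable integrand makes the Volterra integral continuous, and
  with the integrand continuous the integral becomes differentiable.\<close>

lemma continuous_on_cf: "continuous_on {0..s} (\<lambda>r. cf v r \<zeta>)"
proof -
  have "continuous_on {0..s} (\<lambda>r. exp (- r) *\<^sub>R (iexp (\<zeta> \<bullet> vec_of v) + integral {0..r} (\<lambda>r. exp r *\<^sub>R (cf v r \<zeta> * mcf v r \<zeta>))))"
    by (intro continuous_intros indefinite_integral_continuous_1
      set_borel_integral_eq_integral(1)[OF set_integrable_exp_cf])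
  also have "?this \<longleftrightarrow> ?thesis"
    by (intro continuous_on_cong refl) (auto simp: cf_volterra[symmetric] exp_minus)
  finally show ?thesis .
qed

lemma continuous_on_mcf: "continuous_on {0..s} (\<lambda>r. mcf v r \<zeta>)"
  unfolding mcf_def by (intro continuous_intros continuous_on_cf)

lemma cf_has_vector_derivative:
  assumes "0 < s"
  shows "((\<lambda>r. cf v r \<zeta>) has_vector_derivative cf v s \<zeta> * (mcf v s \<zeta> - 1)) (at s)"
proof -
  let ?G = "\<lambda>r. exp r *\<^sub>R (cf v r \<zeta> * mcf v r \<zeta>)"
  have cont: "continuous_on {0..s + 1} ?G"
    by (intro continuous_intros continuous_on_cf continuous_on_mcf)
  have "((\<lambda>r. integral {0..r} ?G) has_vector_derivative ?G s) (at s within {0..s + 1})"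
    using assms by (intro integral_has_vector_derivative cont) auto
  moreover have "at s within {0..s + 1} = at s"
    using assms by (intro at_within_interior) simp
  ultimately have *: "((\<lambda>r. integral {0..r} ?G) has_vector_derivative ?G s) (at s)" by simp
  let ?F = "\<lambda>r. iexp (\<zeta> \<bullet> vec_of v) + integral {0..r} ?G"
  have "((\<lambda>r. exp (- r) *\<^sub>R ?F r) has_vector_derivative exp (- s) *\<^sub>R ?G s + (- exp (- s)) *\<^sub>R ?F s) (at s)"
    by (rule derivative_eq_intros * refl | simp)+
  also have "exp (- s) *\<^sub>R ?G s + (- exp (- s)) *\<^sub>R ?F s = cf v s \<zeta> * (mcf v s \<zeta> - 1)"
    using assms by (simp add: cf_volterra[symmetric] exp_minus algebra_simps)
  finally have "((\<lambda>r. exp (- r) *\<^sub>R ?F r) has_vector_derivative cf v s \<zeta> * (mcf v s \<zeta> - 1)) (at s)" .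
  then show ?thesis
    by (rule has_vector_derivative_transform_within_open[where S = "{0<..}"])
      (use assms in \<open>auto simp: cf_volterra[symmetric] exp_minus\<close>)
qed

lemma cf_increment:
  assumes "0 \<le> s" "s \<le> t"
  shows "exp t *\<^sub>R cf v t \<zeta> - exp s *\<^sub>R cf v s \<zeta> = integral {s..t} (\<lambda>r. exp r *\<^sub>R (cf v r \<zeta> * mcf v r \<zeta>))"
  using assms Henstock_Kurzweil_Integration.integral_combine[of 0 s t "\<lambda>r. exp r *\<^sub>R (cf v r \<zeta> * mcf v r \<zeta>)"]
    set_borel_integral_eq_integral(1)[OF set_integrable_exp_cf[of t v \<zeta>]]
  by (simp add: cf_volterra algebra_simps)

end

subsection \<open>Estimates from the differential equation\<close>

lemma nonincreasing_on_ge_0: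
  fixes f :: "real \<Rightarrow> real"
  assumes "0 \<le> s" "continuous_on {0..s} f"
    and "\<And>r. 0 < r \<Longrightarrow> (f has_real_derivative f' r) (at r)"
    and "\<And>r. 0 < r \<Longrightarrow> f' r \<le> 0"
  shows "f s \<le> f 0"
proof (cases "s = 0")
  case False
  then show ?thesis
    using assms by (intro DERIV_nonpos_imp_decreasing_open[of 0 s f]) auto
qed simp

lemma has_real_derivative_norm_power2:
  fixes z :: "real \<Rightarrow> complex"
  assumes "(z has_vector_derivative z') (at s)"
  shows "((\<lambda>s. (cmod (z s))\<^sup>2) has_real_derivative 2 * (z s \<bullet> z')) (at s)"
proof -
  have *: "((\<lambda>s. Re (z s)) has_real_derivative Re z') (at s)"
    "((\<lambda>s. Im (z s)) has_real_derivative Im z') (at s)"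
    using assms by (auto simp: has_vector_derivative_complex_iff)
  show ?thesis
    unfolding cmod_power2 inner_complex_def
    by (rule derivative_eq_intros * refl | simp)+
qed

context elephant_parameters
begin

lemma q_le_1: "q v u \<le> 1"
  using member_le_sum[of u UNIV "q v"] by (simp add: sum_q_eq_1 q_nonneg)

text \<open>Gronwall's argument: on the unit disc the right-hand side is Lipschitz, so the total
  squared distance \<open>E\<close> satisfies E' \<le> K E and starts at 0.\<close>

lemma offspring_system_unique:
  fixes F G :: "'d direction \<Rightarrow> real \<Rightarrow> complex"
  assumes F: "\<And>v r. 0 < r \<Longrightarrow> (F v has_vector_derivative F v r * ((\<Sum>u\<in>UNIV. q v u *\<^sub>R F u r) - 1)) (at r)"
    and G: "\<And>v r. 0 < r \<Longrightarrow> (G v has_vector_derivative G v r * ((\<Sum>u\<in>UNIV. q v u *\<^sub>R G u r) - 1)) (at r)"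
    and cont: "\<And>v. continuous_on {0..s} (F v)" "\<And>v. continuous_on {0..s} (G v)"
    and bound: "\<And>v r. cmod (F v r) \<le> 1" "\<And>v r. cmod (G v r) \<le> 1"
    and init: "\<And>v. F v 0 = G v 0" and "0 \<le> s"
  shows "F v s = G v s"
proof -
  define N where "N = real CARD('d direction)"
  define z where "z v r = F v r - G v r" for v r
  define z' where "z' v r = F v r * ((\<Sum>u\<in>UNIV. q v u *\<^sub>R F u r) - 1) - G v r * ((\<Sum>u\<in>UNIV. q v u *\<^sub>R G u r) - 1)" for v r
  define E where "E r = (\<Sum>v\<in>UNIV. (cmod (z v r))\<^sup>2)" for r
  define E' where "E' r = (\<Sum>v\<in>UNIV. 2 * (z v r \<bullet> z' v r))" for r
  \<comment> \<open>Bounding products by squares, direction v contributes 4 |z_v|^2 plus |z_v|^2 +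
    |z_u|^2 for each of the N directions u; the sum over v is (4 + 2 N) E.\<close>
  define K where "K = 4 + 2 * N"
  have dz: "(z v has_vector_derivative z' v r) (at r)" if "0 < r" for v r
    unfolding z_def z'_def using F[OF that] G[OF that] by (rule has_vector_derivative_diff)
  have dE: "(E has_real_derivative E' r) (at r)" if "0 < r" for r
    unfolding E_def E'_def by (intro DERIV_sum has_real_derivative_norm_power2 dz that)
  have z'_bound: "cmod (z' v r) \<le> 2 * cmod (z v r) + (\<Sum>u\<in>UNIV. cmod (z u r))" for v r
  proof -
    let ?A = "\<Sum>u\<in>UNIV. q v u *\<^sub>R F u r"
    have "cmod ?A \<le> (\<Sum>u\<in>UNIV. q v u * 1)"
      by (rule order_trans[OF norm_sum]) (auto intro!: sum_mono mult_left_le simp: q_nonneg bound)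
    then have A: "cmod (?A - 1) \<le> 2"
      using norm_triangle_ineq4[of ?A 1] by (simp add: sum_q_eq_1)
    have diff: "f * (A - 1) - g * (B - 1) = (f - g) * (A - 1) + g * (A - B)" for f g A B :: complex
      by (simp add: algebra_simps)
    have sum_z: "(\<Sum>u\<in>UNIV. q v u *\<^sub>R z u r) = ?A - (\<Sum>u\<in>UNIV. q v u *\<^sub>R G u r)"
      by (simp add: z_def sum_subtractf scaleR_diff_right)
    have z'_eq: "z' v r = z v r * (?A - 1) + G v r * (\<Sum>u\<in>UNIV. q v u *\<^sub>R z u r)"
      unfolding sum_z unfolding z'_def diff z_def by (rule refl)
    have "cmod (z' v r) \<le> cmod (z v r) * cmod (?A - 1) + cmod (G v r) * cmod (\<Sum>u\<in>UNIV. q v u *\<^sub>R z u r)"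
      unfolding z'_eq norm_mult[symmetric] by (rule norm_triangle_ineq)
    also have "\<dots> \<le> cmod (z v r) * 2 + 1 * (\<Sum>u\<in>UNIV. cmod (z u r))"
    proof (intro add_mono mult_mono A bound)
      show "cmod (\<Sum>u\<in>UNIV. q v u *\<^sub>R z u r) \<le> (\<Sum>u\<in>UNIV. cmod (z u r))"
        by (rule order_trans[OF norm_sum]) (auto intro!: sum_mono mult_left_le_one_le simp: q_nonneg q_le_1)
    qed auto
    finally show ?thesis by simp
  qed
  have E'_bound: "E' r \<le> K * E r" for r
  proof -
    have "E' r \<le> (\<Sum>v\<in>UNIV. 4 * (cmod (z v r))\<^sup>2 + (\<Sum>u\<in>UNIV. (cmod (z v r))\<^sup>2 + (cmod (z u r))\<^sup>2))"
      unfolding E'_def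
    proof (rule sum_mono)
      fix v
      have "2 * (z v r \<bullet> z' v r) \<le> 2 * (cmod (z v r) * cmod (z' v r))"
        using norm_cauchy_schwarz[of "z v r" "z' v r"] by simp
      also have "\<dots> \<le> 2 * (cmod (z v r) * (2 * cmod (z v r) + (\<Sum>u\<in>UNIV. cmod (z u r))))"
        by (intro mult_left_mono z'_bound) auto
      also have "\<dots> = 4 * (cmod (z v r))\<^sup>2 + (\<Sum>u\<in>UNIV. 2 * cmod (z v r) * cmod (z u r))"
        by (simp add: power2_eq_square algebra_simps sum_distrib_left)
      also have "\<dots> \<le> 4 * (cmod (z v r))\<^sup>2 + (\<Sum>u\<in>UNIV. (cmod (z v r))\<^sup>2 + (cmod (z u r))\<^sup>2)"
        by (intro add_left_mono sum_mono sum_squares_bound)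
      finally show "2 * (z v r \<bullet> z' v r) \<le> 4 * (cmod (z v r))\<^sup>2 + (\<Sum>u\<in>UNIV. (cmod (z v r))\<^sup>2 + (cmod (z u r))\<^sup>2)" .
    qed
    also have "\<dots> = K * E r"
      by (simp add: sum.distrib E_def K_def N_def algebra_simps sum_distrib_left)
    finally show ?thesis .
  qed
  have "E s * exp (- K * s) \<le> E 0 * exp (- K * 0)"
  proof (rule nonincreasing_on_ge_0[OF \<open>0 \<le> s\<close>])
    show "continuous_on {0..s} (\<lambda>r. E r * exp (- K * r))"
      unfolding E_def z_def by (intro continuous_intros cont)
    show "((\<lambda>r. E r * exp (- K * r)) has_real_derivative (E' r - K * E r) * exp (- K * r)) (at r)" if "0 < r" for r
      by (rule derivative_eq_intros dE[OF that] refl | simp add: algebra_simps)+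
    show "(E' r - K * E r) * exp (- K * r) \<le> 0" for r
      using E'_bound[of r] by (intro mult_nonpos_nonneg) auto
  qed
  also have "\<dots> = 0" by (simp add: E_def z_def init)
  finally have "E s \<le> 0" by (simp add: mult_le_0_iff)
  moreover have "(cmod (z v s))\<^sup>2 \<le> E s"
    unfolding E_def by (rule member_le_sum) auto
  ultimately have "(cmod (z v s))\<^sup>2 \<le> 0" by linarith
  then show ?thesis by (simp add: z_def)
qed

text \<open>\<open>q v u\<close> depends only on whether u = v, so it is invariant under every
  permutation of the directions. Both sides then solve the same system, and the condition on \<eta>
  makes the initial values agree.\<close>

lemma cf_symmetry:
  assumes \<pi>: "bij \<pi>" and \<eta>: "\<And>v. \<eta> \<bullet> vec_of (\<pi> v) = \<zeta> \<bullet> vec_of v" and "0 \<le> s"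
  shows "cf v s \<zeta> = cf (\<pi> v) s \<eta>"
proof (rule offspring_system_unique[where F = "\<lambda>v s. cf v s \<zeta>" and G = "\<lambda>v s. cf (\<pi> v) s \<eta>"])
  fix v r assume "0 < (r :: real)"
  show "((\<lambda>s. cf v s \<zeta>) has_vector_derivative cf v r \<zeta> * ((\<Sum>u\<in>UNIV. q v u *\<^sub>R cf u r \<zeta>) - 1)) (at r)"
    using cf_has_vector_derivative[OF \<open>0 < r\<close>] by (simp add: mcf_def)
  have "(\<Sum>u\<in>UNIV. q v u *\<^sub>R cf (\<pi> u) r \<eta>) = (\<Sum>u\<in>UNIV. q (\<pi> v) (\<pi> u) *\<^sub>R cf (\<pi> u) r \<eta>)"
    using \<pi> by (intro sum.cong) (auto simp: q_def bij_def inj_eq)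
  also have "\<dots> = mcf (\<pi> v) r \<eta>"
    unfolding mcf_def by (rule sum.reindex_bij_betw[OF \<pi>])
  finally show "((\<lambda>s. cf (\<pi> v) s \<eta>) has_vector_derivative cf (\<pi> v) r \<eta> * ((\<Sum>u\<in>UNIV. q v u *\<^sub>R cf (\<pi> u) r \<eta>) - 1)) (at r)"
    using cf_has_vector_derivative[OF \<open>0 < r\<close>] by simp
qed (use assms in \<open>auto intro: continuous_on_cf norm_cf_le_1 simp: cf_0\<close>)

lemma cf_minus: "cf v s (- \<zeta>) = cnj (cf v s \<zeta>)"
proof -
  have "cf v s (- \<zeta>) = (CLINT x | tree_space. cnj (iexp (\<zeta> \<bullet> position v s x)))"
    unfolding cf_def by (intro Bochner_Integration.integral_cong) (simp_all add: exp_cnj)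
  also have "\<dots> = cnj (cf v s \<zeta>)"
    unfolding cf_def by simp
  finally show ?thesis .
qed

primrec opposite :: "'d direction \<Rightarrow> 'd direction" where
  "opposite (Pos i) = Neg i"
| "opposite (Neg i) = Pos i"

lemma opposite_opposite [simp]: "opposite (opposite v) = v"
  by (cases v) auto

lemma vec_of_opposite [simp]: "vec_of (opposite v) = - vec_of v"
  by (cases v) auto

lemma cf_opposite:
  assumes "0 \<le> s" shows "cf (opposite v) s \<zeta> = cnj (cf v s \<zeta>)"
proof -
  have "bij opposite" by (rule o_bij[of opposite]) (auto simp: fun_eq_iff)
  from cf_symmetry[OF this _ assms, of "- \<zeta>" \<zeta> v] have "cf v s \<zeta> = cf (opposite v) s (- \<zeta>)" by simp
  then show ?thesis by (simp add: cf_minus)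
qed

definition swap :: "'d \<Rightarrow> 'd \<Rightarrow> 'd" where
  "swap j i = (if i = i1 then j else if i = j then i1 else i)"

lemma swap_swap [simp]: "swap j (swap j i) = i"
  by (simp add: swap_def)

lemma swap_self [simp]: "swap j j = i1"
  by (simp add: swap_def)

definition swap_direction :: "'d \<Rightarrow> 'd direction \<Rightarrow> 'd direction" where
  "swap_direction j v = (case v of Pos i \<Rightarrow> Pos (swap j i) | Neg i \<Rightarrow> Neg (swap j i))"

text \<open>\<open>to_e1 u\<close> is the signed transposition of coordinates that exchanges \<open>u\<close> and \<open>e\<^sub>1\<close>.\<close>

primrec to_e1 :: "'d direction \<Rightarrow> real ^ 'd \<Rightarrow> real ^ 'd" where
  "to_e1 (Pos j) \<zeta> = (\<chi> i. \<zeta> $ swap j i)"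
| "to_e1 (Neg j) \<zeta> = - (\<chi> i. \<zeta> $ swap j i)"

text \<open>Reduces every starting direction to \<open>Pos i1\<close>, the only one whose urn is
  known to converge.\<close>

lemma cf_to_e1:
  assumes "0 \<le> s" shows "cf u s \<zeta> = cf (Pos i1) s (to_e1 u \<zeta>)"
proof -
  have swap_swap: "swap_direction j (swap_direction j v) = v" for j v
    by (cases v) (auto simp: swap_direction_def)
  have bij: "bij (swap_direction j)" for j
    by (rule o_bij[of "swap_direction j"]) (auto simp: fun_eq_iff swap_swap)
  have "(\<chi> i. \<zeta> $ swap j i) \<bullet> vec_of (swap_direction j v) = \<zeta> \<bullet> vec_of v" for j v
    by (cases v) (auto simp: swap_direction_def inner_axis)
  from cf_symmetry[OF bij this assms]
  have *: "cf v s \<zeta> = cf (swap_direction j v) s (\<chi> i. \<zeta> $ swap j i)" for j v .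
  show ?thesis
  proof (cases u)
    case (Pos j)
    then show ?thesis using *[of "Pos j" j] by (simp add: swap_direction_def)
  next
    case (Neg j)
    have "cf u s \<zeta> = cf (opposite (Pos i1)) s (\<chi> i. \<zeta> $ swap j i)"
      using *[of "Neg j" j] Neg by (simp add: swap_direction_def)
    then show ?thesis
      using Neg by (simp only: cf_opposite[OF assms] to_e1.simps cf_minus)
  qed
qed

section \<open>Bounds at finite times for the real and imaginary parts\<close>

definition deficit :: "real \<Rightarrow> real ^ 'd \<Rightarrow> real" where
  "deficit s \<zeta> = (\<Sum>i\<in>UNIV. 1 - Re (cf (Pos i) s \<zeta>))"

lemma deficit_term_nonneg: "0 \<le> 1 - Re (cf v s \<zeta>)"
  using complex_Re_le_cmod[of "cf v s \<zeta>"] norm_cf_le_1[of v s \<zeta>] by linarith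

lemma deficit_term_le: "1 - Re (cf (Pos i) s \<zeta>) \<le> deficit s \<zeta>"
  unfolding deficit_def by (rule member_le_sum) (use deficit_term_nonneg in simp_all)

lemma deficit_nonneg: "0 \<le> deficit s \<zeta>"
  unfolding deficit_def by (intro sum_nonneg deficit_term_nonneg)

text \<open>Opposite directions have conjugate characteristic functions, so imaginary parts cancel
  in the uniform part of \<open>q\<close>. The equations of the different directions are coupled
  only through the real quantity \<open>deficit\<close>.\<close>

lemma mcf_eq:
  assumes "0 \<le> s"
  shows "mcf v s \<zeta> = of_real (1 - a - 2 * \<beta> * deficit s \<zeta>) + a *\<^sub>R cf v s \<zeta>"
proof -
  have "(\<Sum>u\<in>UNIV. cf u s \<zeta>) = (\<Sum>i\<in>UNIV. cf (Pos i) s \<zeta> + cnj (cf (Pos i) s \<zeta>))"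
    using cf_opposite[OF assms, of "Pos i" for i] by (simp add: sum_direction sum.distrib)
  also have "\<dots> = (\<Sum>i\<in>UNIV. of_real (2 * Re (cf (Pos i) s \<zeta>)))"
    by (intro sum.cong) (auto simp: complex_add_cnj)
  also have "\<dots> = of_real (2 * (dim - deficit s \<zeta>))"
    by (simp add: deficit_def dim_def sum_subtractf sum_distrib_left)
  finally have "mcf v s \<zeta> = \<beta> *\<^sub>R of_real (2 * (dim - deficit s \<zeta>)) + a *\<^sub>R cf v s \<zeta>"
    unfolding mcf_def sum_q by simp
  also have "\<beta> *\<^sub>R (of_real (2 * (dim - deficit s \<zeta>)) :: complex) = of_real (2 * dim * \<beta> - 2 * \<beta> * deficit s \<zeta>)"
    by (simp add: scaleR_conv_of_real algebra_simps)
  also have "2 * dim * \<beta> = 1 - a" using a_\<beta> by simp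
  finally show ?thesis .
qed

lemma Re_cf_derivative:
  assumes "0 < s"
  shows "((\<lambda>r. Re (cf v r \<zeta>)) has_real_derivative
    - Re (cf v s \<zeta>) * (2 * \<beta> * deficit s \<zeta> + a * (1 - Re (cf v s \<zeta>))) - a * (Im (cf v s \<zeta>))\<^sup>2) (at s)"
proof -
  have "((\<lambda>r. Re (cf v r \<zeta>)) has_real_derivative Re (cf v s \<zeta> * (mcf v s \<zeta> - 1))) (at s)"
    using cf_has_vector_derivative[OF assms] by (auto simp: has_vector_derivative_complex_iff)
  then show ?thesis
    using assms by (simp add: mcf_eq power2_eq_square algebra_simps)
qed

lemma Im_cf_derivative:
  assumes "0 < s"
  shows "((\<lambda>r. Im (cf v r \<zeta>)) has_real_derivative
    Im (cf v s \<zeta>) * (a - 2 * \<beta> * deficit s \<zeta> - 2 * a * (1 - Re (cf v s \<zeta>)))) (at s)"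
proof -
  have "((\<lambda>r. Im (cf v r \<zeta>)) has_real_derivative Im (cf v s \<zeta> * (mcf v s \<zeta> - 1))) (at s)"
    using cf_has_vector_derivative[OF assms] by (auto simp: has_vector_derivative_complex_iff)
  then show ?thesis
    using assms by (simp add: mcf_eq algebra_simps)
qed

text \<open>Both deficit terms in the equation for the imaginary part are damping, which leaves
  growth at rate at most \<open>a\<close> from the initial value sin of the coordinate.\<close>

lemma Im_cf_upper:
  assumes "0 \<le> s"
  shows "(Im (cf (Pos i) s \<zeta>))\<^sup>2 \<le> (\<zeta> $ i)\<^sup>2 * exp (2 * a * s)"
proof -
  let ?g = "\<lambda>r. Im (cf (Pos i) r \<zeta>)"
  let ?k = "\<lambda>r. a - 2 * \<beta> * deficit r \<zeta> - 2 * a * (1 - Re (cf (Pos i) r \<zeta>))"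
  have "(?g s)\<^sup>2 * exp (- 2 * a * s) \<le> (?g 0)\<^sup>2 * exp (- 2 * a * 0)"
  proof (rule nonincreasing_on_ge_0[OF assms])
    show "continuous_on {0..s} (\<lambda>r. (?g r)\<^sup>2 * exp (- 2 * a * r))"
      by (intro continuous_intros continuous_on_cf)
    show "((\<lambda>r. (?g r)\<^sup>2 * exp (- 2 * a * r)) has_real_derivative
        2 * (?k r - a) * (?g r)\<^sup>2 * exp (- 2 * a * r)) (at r)" if "0 < r" for r
      by (rule derivative_eq_intros Im_cf_derivative[OF that] refl | simp add: power2_eq_square algebra_simps)+
    show "2 * (?k r - a) * (?g r)\<^sup>2 * exp (- 2 * a * r) \<le> 0" for r
    proof -
      have "0 \<le> 2 * \<beta> * deficit r \<zeta>"
        using deficit_nonneg[of r \<zeta>] \<beta>_pos by simp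
      moreover have "0 \<le> 2 * a * (1 - Re (cf (Pos i) r \<zeta>))"
        using deficit_term_nonneg[of "Pos i" r \<zeta>] a_gt_half by (intro mult_nonneg_nonneg) auto
      moreover have "2 * (a - X - Y - a) \<le> 0" if "0 \<le> X" "0 \<le> Y" for X Y :: real
        using that by simp
      ultimately have "2 * (?k r - a) \<le> 0" by blast
      then show ?thesis by (intro mult_nonpos_nonneg[OF mult_nonpos_nonneg]) simp_all
    qed
  qed
  also have "\<dots> = (sin (\<zeta> $ i))\<^sup>2"
    by (simp add: cf_0 Im_exp inner_axis)
  also have "\<dots> \<le> (\<zeta> $ i)\<^sup>2"
    using abs_sin_x_le_abs_x[of "\<zeta> $ i"] by (simp add: abs_le_square_iff)
  finally show ?thesis by (simp add: exp_minus field_simps)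
qed

text \<open>The summand 1/2 comes from 1 - cos x \<le> x^2 / 2 at time 0, the other from the forcing
  by the squared imaginary parts; the latter requires a > 1/2.\<close>

definition C\<^sub>0 :: real where "C\<^sub>0 = 1 / 2 + a / (2 * a - 1)"

lemma C\<^sub>0_pos: "0 < C\<^sub>0"
  using a_gt_half by (simp add: C\<^sub>0_def add_pos_pos)

lemma norm_vec_power2: "(norm \<zeta>)\<^sup>2 = (\<Sum>i\<in>UNIV. (\<zeta> $ i)\<^sup>2)" for \<zeta> :: "real ^ 'd"
  unfolding power2_norm_eq_inner inner_vec_def by (simp add: power2_eq_square)

text \<open>Re \<le> 1 and the bound on Im give U' \<le> U + a |\<zeta>|^2 exp (2 a r) for the
  deficit U. The homogeneous solution grows like exp r only, hence is dominated by the forced one of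
  order exp (2 a r).\<close>

lemma deficit_upper:
  assumes "0 \<le> s"
  shows "deficit s \<zeta> \<le> C\<^sub>0 * (norm \<zeta>)\<^sup>2 * exp (2 * a * s)"
proof -
  \<comment> \<open>b exp (2 a r) is the particular solution of the forced equation: 2 a b = b + a
    |\<zeta>|^2.\<close>
  define b where "b = a / (2 * a - 1) * (norm \<zeta>)\<^sup>2"
  let ?f = "\<lambda>i r. Re (cf (Pos i) r \<zeta>)" and ?g = "\<lambda>i r. Im (cf (Pos i) r \<zeta>)"
  define U' where "U' r = (\<Sum>i\<in>UNIV. ?f i r * (2 * \<beta> * deficit r \<zeta> + a * (1 - ?f i r)) + a * (?g i r)\<^sup>2)" for r
  have dU: "((\<lambda>r. deficit r \<zeta>) has_real_derivative U' r) (at r)" if "0 < r" for r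
    unfolding deficit_def U'_def
    by (intro DERIV_sum) (rule derivative_eq_intros Re_cf_derivative[OF that, unfolded deficit_def] refl | simp add: algebra_simps)+
  have U'_le: "U' r \<le> deficit r \<zeta> + a * (norm \<zeta>)\<^sup>2 * exp (2 * a * r)" if "0 < r" for r
  proof -
    have "U' r \<le> (\<Sum>i\<in>UNIV. 1 * (2 * \<beta> * deficit r \<zeta> + a * (1 - ?f i r)) + a * ((\<zeta> $ i)\<^sup>2 * exp (2 * a * r)))"
      unfolding U'_def using that deficit_nonneg[of r \<zeta>] deficit_term_nonneg[of _ r \<zeta>] \<beta>_pos a_gt_half
      by (intro sum_mono add_mono mult_right_mono mult_left_mono Im_cf_upper)
        (auto intro!: add_nonneg_nonneg mult_nonneg_nonneg)
    also have "\<dots> = 2 * dim * \<beta> * deficit r \<zeta> + a * deficit r \<zeta> + a * (norm \<zeta>)\<^sup>2 * exp (2 * a * r)"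
      by (simp add: sum.distrib sum_distrib_left[symmetric] sum_distrib_right[symmetric] dim_def norm_vec_power2 deficit_def)
    also have "2 * dim * \<beta> * deficit r \<zeta> + a * deficit r \<zeta> = deficit r \<zeta>"
      using a_\<beta> by (metis distrib_right mult_1)
    finally show ?thesis .
  qed
  have "deficit s \<zeta> * exp (- s) - b * exp ((2 * a - 1) * s) \<le> deficit 0 \<zeta> * exp (- 0) - b * exp ((2 * a - 1) * 0)"
  proof (rule nonincreasing_on_ge_0[OF assms])
    show "continuous_on {0..s} (\<lambda>r. deficit r \<zeta> * exp (- r) - b * exp ((2 * a - 1) * r))"
      unfolding deficit_def by (intro continuous_intros continuous_on_cf)
    show "((\<lambda>r. deficit r \<zeta> * exp (- r) - b * exp ((2 * a - 1) * r)) has_real_derivative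
        (U' r - deficit r \<zeta>) * exp (- r) - b * (2 * a - 1) * exp ((2 * a - 1) * r)) (at r)" if "0 < r" for r
      by (auto intro!: derivative_eq_intros dU[OF that] simp: algebra_simps)
    show "(U' r - deficit r \<zeta>) * exp (- r) - b * (2 * a - 1) * exp ((2 * a - 1) * r) \<le> 0" if "0 < r" for r
    proof -
      have "(U' r - deficit r \<zeta>) * exp (- r) \<le> (a * (norm \<zeta>)\<^sup>2 * exp (2 * a * r)) * exp (- r)"
        using U'_le[OF that] by (intro mult_right_mono) auto
      also have "\<dots> = a * (norm \<zeta>)\<^sup>2 * exp ((2 * a - 1) * r)"
        by (simp add: mult.assoc left_diff_distrib flip: exp_add)
      finally show ?thesis using a_gt_half by (simp add: b_def)
    qed
  qed
  moreover have b_nonneg: "b \<ge> 0" using a_gt_half by (simp add: b_def)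
  ultimately have "deficit s \<zeta> * exp (- s) \<le> deficit 0 \<zeta> + b * exp ((2 * a - 1) * s)" by simp
  then have "deficit s \<zeta> * exp (- s) * exp s \<le> (deficit 0 \<zeta> + b * exp ((2 * a - 1) * s)) * exp s"
    by (rule mult_right_mono) simp
  moreover have "deficit s \<zeta> * exp (- s) * exp s = deficit s \<zeta>"
    by (simp add: mult.assoc flip: exp_add)
  moreover have "(deficit 0 \<zeta> + b * exp ((2 * a - 1) * s)) * exp s = deficit 0 \<zeta> * exp s + b * exp (2 * a * s)"
    by (simp add: distrib_right mult.assoc left_diff_distrib flip: exp_add)
  ultimately have "deficit s \<zeta> \<le> deficit 0 \<zeta> * exp s + b * exp (2 * a * s)"
    by linarith
  also have "\<dots> \<le> (norm \<zeta>)\<^sup>2 / 2 * exp (2 * a * s) + b * exp (2 * a * s)"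
  proof (intro add_mono mult_mono order_refl)
    have "deficit 0 \<zeta> = (\<Sum>i\<in>UNIV. 1 - cos (\<zeta> $ i))"
      by (simp add: deficit_def cf_0 Re_exp inner_axis)
    also have "\<dots> \<le> (\<Sum>i\<in>UNIV. (\<zeta> $ i)\<^sup>2 / 2)"
    proof (rule sum_mono)
      fix i
      have "cos (\<zeta> $ i) = 1 - 2 * (sin (\<zeta> $ i / 2))\<^sup>2"
        using cos_double_sin[of "\<zeta> $ i / 2"] by simp
      moreover have "(sin (\<zeta> $ i / 2))\<^sup>2 \<le> (\<zeta> $ i / 2)\<^sup>2"
        using abs_sin_x_le_abs_x[of "\<zeta> $ i / 2"] unfolding abs_le_square_iff .
      ultimately show "1 - cos (\<zeta> $ i) \<le> (\<zeta> $ i)\<^sup>2 / 2"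
        by (simp add: power_divide)
    qed
    finally show "deficit 0 \<zeta> \<le> (norm \<zeta>)\<^sup>2 / 2"
      by (simp add: norm_vec_power2 sum_divide_distrib)
    show "exp s \<le> exp (2 * a * s)"
      using a_gt_half assms by (simp add: mult_le_cancel_right1)
  qed (use b_nonneg in auto)
  also have "\<dots> = C\<^sub>0 * (norm \<zeta>)\<^sup>2 * exp (2 * a * s)"
    by (simp add: C\<^sub>0_def b_def algebra_simps)
  finally show ?thesis .
qed

text \<open>The damping of the imaginary part is at most three times the deficit, whose bound is
  integrable in time up to order |\<zeta>|^2 exp (2 a s). This order stays fixed when \<zeta> is
  scaled by exp (- a s), so the bound is not lost in the limit.\<close>

lemma Im_cf_lower:
  assumes "0 \<le> s"
  shows "(sin (\<zeta> $ i))\<^sup>2 * exp (2 * a * s - 3 * C\<^sub>0 / a * (norm \<zeta>)\<^sup>2 * exp (2 * a * s))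
    \<le> (Im (cf (Pos i) s \<zeta>))\<^sup>2"
proof -
  let ?g = "\<lambda>r. Im (cf (Pos i) r \<zeta>)"
  let ?k = "\<lambda>r. a - 2 * \<beta> * deficit r \<zeta> - 2 * a * (1 - Re (cf (Pos i) r \<zeta>))"
  \<comment> \<open>Squaring doubles the damping to 6 times the bound on the deficit;
    \<open>K\<close> is chosen so that the derivative of K exp (2 a r) compensates exactly
    that.\<close>
  define K where "K = 3 * C\<^sub>0 / a * (norm \<zeta>)\<^sup>2"
  have K: "K \<ge> 0" "2 * a * K = 6 * (C\<^sub>0 * (norm \<zeta>)\<^sup>2)" using C\<^sub>0_pos a_gt_half by (auto simp: K_def)
  let ?E = "\<lambda>r. exp (- 2 * a * r + K * exp (2 * a * r))"
  have "- ((?g s)\<^sup>2 * ?E s) \<le> - ((?g 0)\<^sup>2 * ?E 0)"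
  proof (rule nonincreasing_on_ge_0[OF assms])
    show "continuous_on {0..s} (\<lambda>r. - ((?g r)\<^sup>2 * ?E r))"
      by (intro continuous_intros continuous_on_cf)
    show "((\<lambda>r. - ((?g r)\<^sup>2 * ?E r)) has_real_derivative
        - ((2 * (?k r - a) + 2 * a * K * exp (2 * a * r)) * (?g r)\<^sup>2 * ?E r)) (at r)" if "0 < r" for r
      by (rule derivative_eq_intros Im_cf_derivative[OF that] refl | simp add: power2_eq_square algebra_simps)+
    show "- ((2 * (?k r - a) + 2 * a * K * exp (2 * a * r)) * (?g r)\<^sup>2 * ?E r) \<le> 0" if "0 < r" for r
    proof -
      \<comment> \<open>Of the three deficits one pays for the coupling, as 2 \<beta> \<le> 1, and
        two pay for the term with factor 2 a, as a < 1.\<close>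
      have "2 * \<beta> \<le> 2 * dim * \<beta>" using dim_ge_1 \<beta>_pos by simp
      then have "2 * \<beta> \<le> 1" using a_\<beta> a_gt_half by linarith
      then have "2 * \<beta> * deficit r \<zeta> \<le> 1 * deficit r \<zeta>"
        by (rule mult_right_mono) (rule deficit_nonneg)
      moreover have "2 * a * (1 - Re (cf (Pos i) r \<zeta>)) \<le> 2 * deficit r \<zeta>"
        using a_less_1 a_gt_half deficit_term_nonneg[of "Pos i" r \<zeta>] deficit_term_le[of i r \<zeta>]
        by (intro mult_mono) auto
      moreover have "deficit r \<zeta> \<le> C\<^sub>0 * (norm \<zeta>)\<^sup>2 * exp (2 * a * r)"
        using that by (intro deficit_upper) auto
      ultimately have "0 \<le> 2 * (?k r - a) + 2 * a * K * exp (2 * a * r)"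
        unfolding K by (simp add: algebra_simps)
      then show ?thesis by simp
    qed
  qed
  then have "(sin (\<zeta> $ i))\<^sup>2 * exp K \<le> (?g s)\<^sup>2 * ?E s"
    by (simp add: cf_0 Im_exp inner_axis)
  moreover have "(sin (\<zeta> $ i))\<^sup>2 \<le> (sin (\<zeta> $ i))\<^sup>2 * exp K"
    using K by (simp add: mult_le_cancel_left1)
  ultimately have "(sin (\<zeta> $ i))\<^sup>2 \<le> (?g s)\<^sup>2 * ?E s" by linarith
  then have "(sin (\<zeta> $ i))\<^sup>2 * exp (2 * a * s + - (K * exp (2 * a * s))) \<le>
      (?g s)\<^sup>2 * ?E s * exp (2 * a * s + - (K * exp (2 * a * s)))"
    by (rule mult_right_mono) simp
  also have "\<dots> = (?g s)\<^sup>2"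
    by (simp add: mult.assoc exp_add[symmetric])
  finally show ?thesis
    by (simp add: K_def)
qed

end

subsection \<open>The law of the urn\<close>

lemma birth_time_eq_born: "birth_time T b \<omega> = born b (\<lambda>i. T (fst i) (snd i) \<omega>)"
  by (induction b) auto

lemma ball_direction_eq_heading:
  "ball_direction i1 D b \<omega> = heading b (Pos i1) (\<lambda>i. D (fst i) (snd i) \<omega>)"
  by (induction b) auto

definition driving :: "(ball \<Rightarrow> nat \<Rightarrow> 'a \<Rightarrow> real) \<Rightarrow> (ball \<Rightarrow> 'd direction \<Rightarrow> 'a \<Rightarrow> 'd direction) \<Rightarrow>
    'a \<Rightarrow> clocks \<times> 'd marks" where
  "driving T D \<omega> = (\<lambda>i. T (fst i) (snd i) \<omega>, \<lambda>i. D (fst i) (snd i) \<omega>)"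

lemma urn_difference_eq_position:
  fixes i1 :: "'d::finite"
  assumes "finite {b. birth_time T b \<omega> \<le> s}"
  shows "urn_difference i1 T D s \<omega> = position (Pos i1) s (driving T D \<omega>)"
proof -
  let ?B = "{b. birth_time T b \<omega> \<le> s}"
  have comp: "vec_of v $ i = (if v = Pos i then 1 else 0) - (if v = Neg i then 1 else 0)" for v and i :: 'd
    by (cases v) (auto simp: axis_def)
  have card: "real (card {b. birth_time T b \<omega> \<le> s \<and> ball_direction i1 D b \<omega> = v}) =
      (\<Sum>b\<in>?B. if ball_direction i1 D b \<omega> = v then 1 else 0)" for v
  proof -
    have "(\<Sum>b\<in>?B. if ball_direction i1 D b \<omega> = v then 1 else (0::real)) =
        (\<Sum>b\<in>{b \<in> ?B. ball_direction i1 D b \<omega> = v}. 1)"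
      by (rule sum.inter_filter[symmetric, OF assms])
    then show ?thesis by simp
  qed
  have "position (Pos i1) s (driving T D \<omega>) = (\<Sum>b\<in>?B. vec_of (ball_direction i1 D b \<omega>))"
    using assms by (subst position_eq) (simp_all add: driving_def birth_time_eq_born ball_direction_eq_heading)
  then show ?thesis
    by (simp add: vec_eq_iff urn_difference_def urn_count_def card comp sum_subtractf)
qed

context elephant_parameters
begin

text \<open>Condenses all stochastic assumptions on the urn into one identity of laws, through which
  expectations and almost sure statements pass between the given space and
  \<open>tree_space\<close>.\<close>

lemma distr_driving:
  fixes M :: "'a measure" and T :: "ball \<Rightarrow> nat \<Rightarrow> 'a \<Rightarrow> real"
    and D :: "ball \<Rightarrow> 'd direction \<Rightarrow> 'a \<Rightarrow> 'd direction"
  assumes "urn M p T D"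
  shows "driving T D \<in> M \<rightarrow>\<^sub>M tree_space" "distr M tree_space (driving T D) = tree_space"
proof -
  interpret urn M p T D by fact
  interpret C: prob_space clock_space by (rule prob_space_clock_space)
  interpret K: prob_space mark_space by (rule prob_space_mark_space)
  let ?c = "\<lambda>\<omega> i. T (fst i) (snd i) \<omega>" and ?m = "\<lambda>\<omega> i. D (fst i) (snd i) \<omega>"
  have T_meas [measurable]: "T b k \<in> borel_measurable M" for b k
    using clock_exponential[of b k] by (auto simp: distributed_def)
  have D_meas [measurable]: "D b v \<in> M \<rightarrow>\<^sub>M count_space UNIV" for b v
    using marks_indep unfolding indep_vars_def by (auto dest: bspec[where x = "(b, v)"])
  have T_law: "distr M borel (T b k) = exp1" for b k
  proof -
    have "distr M borel (T b k) = distr M lborel (T b k)" by (rule distr_cong) auto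
    then show ?thesis
      using distributed_distr_eq_density[OF clock_exponential[of b k]] by (simp add: exp1_def)
  qed
  have D_law: "distr M (count_space UNIV) (D b v) = mark_law v" for b v
  proof (rule measure_eqI_finite[where A = UNIV])
    fix u :: "'d direction"
    have "D b v -` {u} \<inter> space M = {\<omega> \<in> space M. D b v \<omega> = u}" by auto
    then have "emeasure (distr M (count_space UNIV) (D b v)) {u} = ennreal (q v u)"
      by (simp add: emeasure_distr emeasure_eq_measure mark_law q_def \<beta>_def dim_def)
    then show "emeasure (distr M (count_space UNIV) (D b v)) {u} = emeasure (mark_law v) {u}"
      by (simp add: emeasure_mark_law)
  qed auto
  have sets_C: "sets clock_space = sets (\<Pi>\<^sub>M _\<in>UNIV. borel)"
    unfolding clock_space_def by (intro sets_PiM_cong) auto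
  have sets_K: "sets mark_space = sets (\<Pi>\<^sub>M _\<in>UNIV. count_space UNIV)"
    unfolding mark_space_def by (intro sets_PiM_cong) auto
  have c_meas': "?c \<in> M \<rightarrow>\<^sub>M (\<Pi>\<^sub>M _\<in>UNIV. borel)"
    by (intro measurable_PiM_single') auto
  have m_meas': "?m \<in> M \<rightarrow>\<^sub>M (\<Pi>\<^sub>M _\<in>UNIV. count_space UNIV)"
    by (intro measurable_PiM_single') auto
  have c_meas: "?c \<in> M \<rightarrow>\<^sub>M clock_space"
    using c_meas' measurable_cong_sets[OF refl sets_C] by blast
  have m_meas: "?m \<in> M \<rightarrow>\<^sub>M mark_space"
    using m_meas' measurable_cong_sets[OF refl sets_K] by blast
  have c_law: "distr M clock_space ?c = clock_space"
  proof -
    have "distr M (\<Pi>\<^sub>M _\<in>UNIV. borel) (\<lambda>\<omega>. \<lambda>i\<in>UNIV. (case i of (b, k) \<Rightarrow> T b k) \<omega>) =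
        (\<Pi>\<^sub>M i\<in>UNIV. distr M borel (case i of (b, k) \<Rightarrow> T b k))"
      using clocks_indep by (subst (asm) indep_vars_iff_distr_eq_PiM') auto
    also have "\<dots> = clock_space"
      by (simp add: clock_space_def case_prod_beta T_law)
    also have "distr M (\<Pi>\<^sub>M _\<in>UNIV. borel) (\<lambda>\<omega>. \<lambda>i\<in>UNIV. (case i of (b, k) \<Rightarrow> T b k) \<omega>) = distr M clock_space ?c"
      by (rule distr_cong) (auto simp: sets_C case_prod_beta restrict_UNIV)
    finally show ?thesis .
  qed
  have m_law: "distr M mark_space ?m = mark_space"
  proof -
    have "distr M (\<Pi>\<^sub>M _\<in>UNIV. count_space UNIV) (\<lambda>\<omega>. \<lambda>i\<in>UNIV. (case i of (b, k) \<Rightarrow> D b k) \<omega>) =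
        (\<Pi>\<^sub>M i\<in>UNIV. distr M (count_space UNIV) (case i of (b, k) \<Rightarrow> D b k))"
      using marks_indep by (subst (asm) indep_vars_iff_distr_eq_PiM') auto
    also have "\<dots> = mark_space"
      by (simp add: mark_space_def case_prod_beta D_law)
    also have "distr M (\<Pi>\<^sub>M _\<in>UNIV. count_space UNIV) (\<lambda>\<omega>. \<lambda>i\<in>UNIV. (case i of (b, k) \<Rightarrow> D b k) \<omega>) = distr M mark_space ?m"
      by (rule distr_cong) (auto simp: sets_K case_prod_beta restrict_UNIV)
    finally show ?thesis .
  qed
  show meas: "driving T D \<in> M \<rightarrow>\<^sub>M tree_space"
    unfolding tree_space_def driving_def[abs_def] by (intro measurable_Pair c_meas m_meas)
  have "clock_space \<Otimes>\<^sub>M mark_space = distr M (clock_space \<Otimes>\<^sub>M mark_space) (driving T D)"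
  proof (rule pair_measure_eqI)
    fix A B assume A: "A \<in> sets clock_space" and B: "B \<in> sets mark_space"
    have "prob ((?c -` A \<inter> space M) \<inter> (?m -` B \<inter> space M)) = prob (?c -` A \<inter> space M) * prob (?m -` B \<inter> space M)"
    proof (rule indep_setD[OF clocks_marks_indep])
      have "(\<lambda>\<omega> (b, k). T b k \<omega>) = ?c" "(\<lambda>\<omega> (b, v). D b v \<omega>) = ?m"
        by (auto simp: fun_eq_iff)
      then show "?c -` A \<inter> space M \<in> sets (vimage_algebra (space M) (\<lambda>\<omega> (b, k). T b k \<omega>) (\<Pi>\<^sub>M _\<in>UNIV. borel))"
        "?m -` B \<inter> space M \<in> sets (vimage_algebra (space M) (\<lambda>\<omega> (b, v). D b v \<omega>) (\<Pi>\<^sub>M _\<in>UNIV. count_space UNIV))"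
        using A B by (auto intro!: in_vimage_algebra simp: sets_C sets_K)
    qed
    moreover have "emeasure clock_space A = ennreal (prob (?c -` A \<inter> space M))"
      using A by (subst c_law[symmetric]) (simp add: emeasure_distr c_meas emeasure_eq_measure)
    moreover have "emeasure mark_space B = ennreal (prob (?m -` B \<inter> space M))"
      using B by (subst m_law[symmetric]) (simp add: emeasure_distr m_meas emeasure_eq_measure)
    moreover have "driving T D -` (A \<times> B) \<inter> space M = (?c -` A \<inter> space M) \<inter> (?m -` B \<inter> space M)"
      by (auto simp: driving_def)
    ultimately show "emeasure clock_space A * emeasure mark_space B =
        emeasure (distr M (clock_space \<Otimes>\<^sub>M mark_space) (driving T D)) (A \<times> B)"
      using A B meas by (simp add: emeasure_distr tree_space_def emeasure_eq_measure ennreal_mult)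
  qed (auto intro: C.sigma_finite_measure_axioms K.sigma_finite_measure_axioms)
  then show "distr M tree_space (driving T D) = tree_space"
    by (simp add: tree_space_def)
qed

lemma AE_urn_finite:
  fixes M :: "'a measure" and T :: "ball \<Rightarrow> nat \<Rightarrow> 'a \<Rightarrow> real"
    and D :: "ball \<Rightarrow> 'd direction \<Rightarrow> 'a \<Rightarrow> 'd direction"
  assumes "urn M p T D"
  shows "AE \<omega> in M. \<forall>s. finite {b. birth_time T b \<omega> \<le> s}"
proof -
  have "AE x in distr M tree_space (driving T D). \<forall>s. finite {b. born b (fst x) \<le> s}"
    unfolding distr_driving[OF assms] by (rule AE_tree_finite)
  from AE_distrD[OF distr_driving(1)[OF assms] this] show ?thesis
    by (simp add: driving_def birth_time_eq_born)
qed

lemma urn_limit_cf: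
  fixes M :: "'a measure" and T :: "ball \<Rightarrow> nat \<Rightarrow> 'a \<Rightarrow> real"
    and D :: "ball \<Rightarrow> 'd direction \<Rightarrow> 'a \<Rightarrow> 'd direction"
  assumes urn: "urn M p T D" and W [measurable]: "W \<in> borel_measurable M"
    and lim: "AE \<omega> in M. ((\<lambda>t. urn_difference i1 T D t \<omega> /\<^sub>R exp (a * t)) \<longlongrightarrow> W \<omega>) at_top"
  shows "((\<lambda>t. cf (Pos i1) t (exp (- (a * t)) *\<^sub>R \<zeta>)) \<longlongrightarrow> mchar (distr M borel W) \<zeta>) at_top"
proof -
  interpret urn M p T D by fact
  let ?X = "\<lambda>t \<omega>. position (Pos i1) t (driving T D \<omega>)"
  have [measurable]: "driving T D \<in> M \<rightarrow>\<^sub>M tree_space"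
    by (rule distr_driving(1)[OF urn])
  have X_meas [measurable]: "?X t \<in> borel_measurable M" for t
    by measurable
  have "cf (Pos i1) t \<eta> = (CLINT \<omega> | M. iexp (\<eta> \<bullet> ?X t \<omega>))" for t \<eta>
    unfolding cf_def by (subst distr_driving(2)[OF urn, symmetric], subst integral_distr) auto
  then have cf_eq: "cf (Pos i1) t (exp (- (a * t)) *\<^sub>R \<zeta>) = (CLINT \<omega> | M. iexp (\<zeta> \<bullet> (?X t \<omega> /\<^sub>R exp (a * t))))" for t
    by (simp add: exp_minus)
  have char_eq: "mchar (distr M borel W) \<zeta> = (CLINT \<omega> | M. iexp (\<zeta> \<bullet> W \<omega>))"
    unfolding mchar_def by (subst integral_distr) auto
  show ?thesis
    unfolding cf_eq char_eq
  proof (rule integral_dominated_convergence_at_top[where w = "\<lambda>_. 1"])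
    show "AE \<omega> in M. ((\<lambda>t. iexp (\<zeta> \<bullet> (?X t \<omega> /\<^sub>R exp (a * t)))) \<longlongrightarrow> iexp (\<zeta> \<bullet> W \<omega>)) at_top"
      using lim AE_urn_finite[OF urn]
    proof eventually_elim
      fix \<omega> assume 1: "((\<lambda>t. urn_difference i1 T D t \<omega> /\<^sub>R exp (a * t)) \<longlongrightarrow> W \<omega>) at_top"
        and 2: "\<forall>s. finite {b. birth_time T b \<omega> \<le> s}"
      have "((\<lambda>t. ?X t \<omega> /\<^sub>R exp (a * t)) \<longlongrightarrow> W \<omega>) at_top"
        using 1 2 by (simp add: urn_difference_eq_position)
      then show "((\<lambda>t. iexp (\<zeta> \<bullet> (?X t \<omega> /\<^sub>R exp (a * t)))) \<longlongrightarrow> iexp (\<zeta> \<bullet> W \<omega>)) at_top"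
        by (intro tendsto_intros)
    qed
  qed auto
qed

end

subsection \<open>The characteristic function of the limit\<close>

lemma norm_mchar_le_1:
  assumes "prob_space \<mu>" shows "cmod (mchar \<mu> \<zeta>) \<le> 1"
proof -
  interpret prob_space \<mu> by fact
  have "cmod (mchar \<mu> \<zeta>) \<le> (LINT x | \<mu>. cmod (iexp (\<zeta> \<bullet> x)))"
    unfolding mchar_def by (rule integral_norm_bound)
  then show ?thesis by (simp add: prob_space)
qed

lemma mchar_0:
  assumes "prob_space \<mu>" shows "mchar \<mu> 0 = 1"
proof -
  interpret prob_space \<mu> by fact
  show ?thesis by (simp add: mchar_def prob_space)
qed

lemma mchar_minus: "mchar \<mu> (- \<zeta>) = cnj (mchar \<mu> \<zeta>)"
proof -
  have "mchar \<mu> (- \<zeta>) = (CLINT x | \<mu>. cnj (iexp (\<zeta> \<bullet> x)))"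
    unfolding mchar_def by (intro Bochner_Integration.integral_cong) (simp_all add: exp_cnj)
  then show ?thesis by (simp add: mchar_def)
qed

lemma continuous_mchar:
  assumes "prob_space \<mu>" and [measurable_cong]: "sets \<mu> = sets borel"
  shows "continuous_on UNIV (mchar \<mu>)"
proof -
  interpret prob_space \<mu> by fact
  have "isCont (mchar \<mu>) \<zeta>" for \<zeta>
    unfolding continuous_at_sequentially mchar_def comp_def
  proof (intro allI impI)
    fix X :: "nat \<Rightarrow> 'a" assume "X \<longlonglongrightarrow> \<zeta>"
    then show "(\<lambda>n. CLINT x | \<mu>. iexp (X n \<bullet> x)) \<longlonglongrightarrow> (CLINT x | \<mu>. iexp (\<zeta> \<bullet> x))"
      by (intro integral_dominated_convergence[where w = "\<lambda>_. 1"]) (auto intro!: tendsto_intros)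
  qed
  then show ?thesis by (simp add: continuous_on_eq_continuous_at)
qed

text \<open>The increment form of h' = g - h. It survives pointwise limits, and it is also what a
  convolution with Exp(1) produces; both uses occur below.\<close>

lemma has_vector_derivative_of_exp_increment:
  fixes g h :: "real \<Rightarrow> complex"
  assumes g: "continuous_on UNIV g"
    and inc: "\<And>r s. r \<le> s \<Longrightarrow> exp s *\<^sub>R h s - exp r *\<^sub>R h r = (CLBINT x. indicator {r..s} x *\<^sub>R (exp x *\<^sub>R g x))"
  shows "(h has_vector_derivative g s - h s) (at s)"
proof -
  \<comment> \<open>Any base point below \<open>s\<close> would do; it makes \<open>s\<close> an
    interior point of the interval of integration.\<close>
  define r where "r = s - 1"
  let ?G = "\<lambda>x. exp x *\<^sub>R g x"
  have cont: "continuous_on A ?G" for A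
    by (intro continuous_intros continuous_on_subset[OF g]) auto
  have inc': "exp t *\<^sub>R h t = exp r *\<^sub>R h r + integral {r..t} ?G" if "r \<le> t" for t
  proof -
    have "set_integrable lborel {r..t} ?G"
      unfolding set_integrable_def by (rule borel_integrable_compact) (auto intro: cont)
    from set_borel_integral_eq_integral(2)[OF this] show ?thesis
      using inc[OF that] by (simp add: set_lebesgue_integral_def algebra_simps)
  qed
  have "((\<lambda>t. integral {r..t} ?G) has_vector_derivative ?G s) (at s within {r..s + 1})"
    by (intro integral_has_vector_derivative cont) (auto simp: r_def)
  moreover have "at s within {r..s + 1} = at s"
    by (intro at_within_interior) (simp add: r_def)
  ultimately have *: "((\<lambda>t. integral {r..t} ?G) has_vector_derivative ?G s) (at s)" by simp
  let ?F = "\<lambda>t. exp r *\<^sub>R h r + integral {r..t} ?G"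
  have F_eq: "exp (- t) *\<^sub>R ?F t = h t" if "r \<le> t" for t
    by (simp add: inc'[OF that, symmetric] exp_minus)
  have "((\<lambda>t. exp (- t) *\<^sub>R ?F t) has_vector_derivative exp (- s) *\<^sub>R ?G s + (- exp (- s)) *\<^sub>R ?F s) (at s)"
    by (rule derivative_eq_intros * refl | simp)+
  also have "exp (- s) *\<^sub>R ?G s + (- exp (- s)) *\<^sub>R ?F s = g s - h s"
    using F_eq[of s] by (simp add: r_def exp_minus)
  finally have "((\<lambda>t. exp (- t) *\<^sub>R ?F t) has_vector_derivative g s - h s) (at s)" .
  then show ?thesis
    by (rule has_vector_derivative_transform_within_open[where S = "{r<..}"])
      (use F_eq in \<open>auto simp: r_def\<close>)
qed

section \<open>Passage to the limit in the integrated equation\<close>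

context elephant_parameters
begin

lemma cf_increment_lborel:
  assumes "0 \<le> s" "s \<le> t"
  shows "exp t *\<^sub>R cf v t \<zeta> - exp s *\<^sub>R cf v s \<zeta> =
    (CLBINT r. indicator {s..t} r *\<^sub>R (exp r *\<^sub>R (cf v r \<zeta> * mcf v r \<zeta>)))"
proof -
  have "set_integrable lborel {s..t} (\<lambda>r. exp r *\<^sub>R (cf v r \<zeta> * mcf v r \<zeta>))"
    by (rule set_integrable_subset[OF set_integrable_exp_cf[of t]]) (use assms in auto)
  from set_borel_integral_eq_integral(2)[OF this] show ?thesis
    using cf_increment[OF assms] by (simp add: set_lebesgue_integral_def)
qed

lemma to_e1_scaleR: "to_e1 u (c *\<^sub>R \<zeta>) = c *\<^sub>R to_e1 u \<zeta>"
  by (cases u) (auto simp: vec_eq_iff)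

lemma continuous_on_to_e1: "continuous_on UNIV (to_e1 u)"
  by (cases u) (auto intro!: continuous_intros)

end

text \<open>Retains of \<open>W\<close> only its law and the convergence of the characteristic
  functions of the urn started from \<open>Pos i1\<close>, so that what follows is analysis of a
  single measure.\<close>

locale elephant_limit = elephant_parameters p i1
  for p :: real and i1 :: "'d::finite" +
  fixes \<mu> :: "(real ^ 'd) measure"
  assumes prob_\<mu>: "prob_space \<mu>" and sets_\<mu> [measurable_cong]: "sets \<mu> = sets borel"
    and cf_limit: "\<And>\<zeta>. ((\<lambda>t. cf (Pos i1) t (exp (- (a * t)) *\<^sub>R \<zeta>)) \<longlongrightarrow> mchar \<mu> \<zeta>) at_top"
begin

text \<open>The characteristic function of the limit of the subtree of the first child.\<close>

definition child :: "real ^ 'd \<Rightarrow> complex" where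
  "child \<zeta> = (\<Sum>u\<in>UNIV. q (Pos i1) u *\<^sub>R mchar \<mu> (to_e1 u \<zeta>))"

lemma continuous_child: "continuous_on UNIV child"
  unfolding child_def
  by (intro continuous_intros continuous_on_compose2[OF continuous_mchar[OF prob_\<mu> sets_\<mu>] continuous_on_to_e1]) auto

lemma norm_child_le_1: "cmod (child \<zeta>) \<le> 1"
proof -
  have "cmod (child \<zeta>) \<le> (\<Sum>u\<in>UNIV. q (Pos i1) u)"
    unfolding child_def
    by (rule order_trans[OF norm_sum]) (auto intro!: sum_mono mult_left_le norm_mchar_le_1 prob_\<mu> simp: q_nonneg)
  then show ?thesis by (simp add: sum_q_eq_1)
qed

text \<open>With time written as \<tau> + y, the factor exp (- a \<tau>) is the right normalisation
  up to exp (a y): a shift of time becomes a dilation. Since \<tau> tends to infinity, y may be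
  negative.\<close>

lemma cf_limit_shift:
  "((\<lambda>\<tau>. cf (Pos i1) (\<tau> + y) (exp (- (a * \<tau>)) *\<^sub>R \<zeta>)) \<longlongrightarrow> mchar \<mu> (exp (a * y) *\<^sub>R \<zeta>)) at_top"
proof -
  have "filterlim (\<lambda>\<tau>. \<tau> + y) at_top at_top"
    using filterlim_tendsto_add_at_top[OF tendsto_const[of y at_top] filterlim_ident] by (simp add: add.commute)
  from filterlim_compose[OF cf_limit[of "exp (a * y) *\<^sub>R \<zeta>"] this] show ?thesis
    by (simp add: algebra_simps flip: exp_add)
qed

lemma mcf_limit_shift:
  "((\<lambda>\<tau>. mcf (Pos i1) (\<tau> + y) (exp (- (a * \<tau>)) *\<^sub>R \<zeta>)) \<longlongrightarrow> child (exp (a * y) *\<^sub>R \<zeta>)) at_top"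
proof -
  have "((\<lambda>\<tau>. \<Sum>u\<in>UNIV. q (Pos i1) u *\<^sub>R cf (Pos i1) (\<tau> + y) (exp (- (a * \<tau>)) *\<^sub>R to_e1 u \<zeta>)) \<longlongrightarrow>
      child (exp (a * y) *\<^sub>R \<zeta>)) at_top"
    unfolding child_def to_e1_scaleR by (intro tendsto_intros cf_limit_shift)
  moreover have "eventually (\<lambda>\<tau>. (\<Sum>u\<in>UNIV. q (Pos i1) u *\<^sub>R cf (Pos i1) (\<tau> + y) (exp (- (a * \<tau>)) *\<^sub>R to_e1 u \<zeta>)) =
      mcf (Pos i1) (\<tau> + y) (exp (- (a * \<tau>)) *\<^sub>R \<zeta>)) at_top"
    using eventually_ge_at_top[of "- y"]
    by eventually_elim (simp add: mcf_def cf_to_e1[symmetric] flip: to_e1_scaleR)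
  ultimately show ?thesis by (rule Lim_transform_eventually)
qed

text \<open>The finite-time equation on [\<tau> + r, \<tau> + s], divided by exp \<tau>, has
  integrands bounded by exp s, so dominated convergence lets \<tau> tend to infinity for any real r
  \<le> s.\<close>

lemma ray_increment:
  assumes "r \<le> s"
  shows "exp s *\<^sub>R mchar \<mu> (exp (a * s) *\<^sub>R \<zeta>) - exp r *\<^sub>R mchar \<mu> (exp (a * r) *\<^sub>R \<zeta>) =
    (CLBINT x. indicator {r..s} x *\<^sub>R (exp x *\<^sub>R (mchar \<mu> (exp (a * x) *\<^sub>R \<zeta>) * child (exp (a * x) *\<^sub>R \<zeta>))))"
proof -
  define c where "c \<tau> y = cf (Pos i1) (\<tau> + y) (exp (- (a * \<tau>)) *\<^sub>R \<zeta>)" for \<tau> y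
  define m where "m \<tau> y = mcf (Pos i1) (\<tau> + y) (exp (- (a * \<tau>)) *\<^sub>R \<zeta>)" for \<tau> y
  have lim_c: "((\<lambda>\<tau>. c \<tau> y) \<longlongrightarrow> mchar \<mu> (exp (a * y) *\<^sub>R \<zeta>)) at_top" for y
    unfolding c_def by (rule cf_limit_shift)
  have lim_m: "((\<lambda>\<tau>. m \<tau> y) \<longlongrightarrow> child (exp (a * y) *\<^sub>R \<zeta>)) at_top" for y
    unfolding m_def by (rule mcf_limit_shift)
  have [measurable]: "c \<tau> \<in> borel_measurable borel" "m \<tau> \<in> borel_measurable borel" for \<tau>
    unfolding c_def m_def by measurable
  have norm_cm: "cmod (c \<tau> y * m \<tau> y) \<le> 1" for \<tau> y
    unfolding norm_mult c_def m_def using mult_mono[OF norm_cf_le_1 norm_mcf_le_1] by force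
  have [measurable]: "(\<lambda>x. mchar \<mu> (exp (a * x) *\<^sub>R \<zeta>)) \<in> borel_measurable borel"
      "(\<lambda>x. child (exp (a * x) *\<^sub>R \<zeta>)) \<in> borel_measurable borel"
    by (intro borel_measurable_continuous_onI continuous_on_compose2[OF continuous_child]
        continuous_on_compose2[OF continuous_mchar[OF prob_\<mu> sets_\<mu>]] continuous_intros; simp)+
  have eq: "exp s *\<^sub>R c \<tau> s - exp r *\<^sub>R c \<tau> r = (CLBINT y. indicator {r..s} y *\<^sub>R (exp y *\<^sub>R (c \<tau> y * m \<tau> y)))"
    if "- r \<le> \<tau>" for \<tau>
  proof -
    have "exp (\<tau> + s) *\<^sub>R c \<tau> s - exp (\<tau> + r) *\<^sub>R c \<tau> r =
       (CLBINT x. indicator {\<tau> + r..\<tau> + s} x *\<^sub>R (exp x *\<^sub>R (cf (Pos i1) x (exp (- (a * \<tau>)) *\<^sub>R \<zeta>) * mcf (Pos i1) x (exp (- (a * \<tau>)) *\<^sub>R \<zeta>))))"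
      unfolding c_def using that assms by (intro cf_increment_lborel) auto
    also have "\<dots> = (CLBINT y. indicator {\<tau> + r..\<tau> + s} (\<tau> + y) *\<^sub>R (exp (\<tau> + y) *\<^sub>R (c \<tau> y * m \<tau> y)))"
      by (subst lborel_integral_real_affine[where c = 1 and t = \<tau>]) (auto simp: c_def m_def)
    also have "\<dots> = (CLBINT y. exp \<tau> *\<^sub>R (indicator {r..s} y *\<^sub>R (exp y *\<^sub>R (c \<tau> y * m \<tau> y))))"
      by (intro Bochner_Integration.integral_cong) (auto simp: indicator_def exp_add)
    also have "\<dots> = exp \<tau> *\<^sub>R (CLBINT y. indicator {r..s} y *\<^sub>R (exp y *\<^sub>R (c \<tau> y * m \<tau> y)))"
      by (rule integral_scaleR_right)
    finally have "exp \<tau> *\<^sub>R (exp s *\<^sub>R c \<tau> s - exp r *\<^sub>R c \<tau> r) =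
        exp \<tau> *\<^sub>R (CLBINT y. indicator {r..s} y *\<^sub>R (exp y *\<^sub>R (c \<tau> y * m \<tau> y)))"
      by (simp add: exp_add scaleR_diff_right)
    then show ?thesis by simp
  qed
  have lhs: "((\<lambda>\<tau>. exp s *\<^sub>R c \<tau> s - exp r *\<^sub>R c \<tau> r) \<longlongrightarrow>
      exp s *\<^sub>R mchar \<mu> (exp (a * s) *\<^sub>R \<zeta>) - exp r *\<^sub>R mchar \<mu> (exp (a * r) *\<^sub>R \<zeta>)) at_top"
    by (intro tendsto_intros lim_c)
  have rhs: "((\<lambda>\<tau>. CLBINT y. indicator {r..s} y *\<^sub>R (exp y *\<^sub>R (c \<tau> y * m \<tau> y))) \<longlongrightarrow>
      (CLBINT x. indicator {r..s} x *\<^sub>R (exp x *\<^sub>R (mchar \<mu> (exp (a * x) *\<^sub>R \<zeta>) * child (exp (a * x) *\<^sub>R \<zeta>))))) at_top"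
  proof (rule integral_dominated_convergence_at_top[where w = "\<lambda>y. indicator {r..s} y * exp s"])
    show "eventually (\<lambda>\<tau>. AE y in lborel. cmod (indicator {r..s} y *\<^sub>R (exp y *\<^sub>R (c \<tau> y * m \<tau> y))) \<le> indicator {r..s} y * exp s) at_top"
    proof (intro always_eventually allI AE_I2)
      fix \<tau> y
      have "exp y * cmod (c \<tau> y * m \<tau> y) \<le> exp s * 1" if "y \<le> s"
        using that norm_cm by (intro mult_mono) auto
      then show "cmod (indicator {r..s} y *\<^sub>R (exp y *\<^sub>R (c \<tau> y * m \<tau> y))) \<le> indicator {r..s} y * exp s"
        by (auto simp: indicator_def norm_mult)
    qed
    show "integrable lborel (\<lambda>y. indicator {r..s} y * exp s)"
      by (intro integrable_mult_left integrable_real_indicator) (auto simp: emeasure_lborel_Icc_eq)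
    show "AE y in lborel. ((\<lambda>\<tau>. indicator {r..s} y *\<^sub>R (exp y *\<^sub>R (c \<tau> y * m \<tau> y))) \<longlongrightarrow>
        indicator {r..s} y *\<^sub>R (exp y *\<^sub>R (mchar \<mu> (exp (a * y) *\<^sub>R \<zeta>) * child (exp (a * y) *\<^sub>R \<zeta>)))) at_top"
      by (intro AE_I2 tendsto_intros lim_c lim_m)
  qed auto
  have "eventually (\<lambda>\<tau>. exp s *\<^sub>R c \<tau> s - exp r *\<^sub>R c \<tau> r =
      (CLBINT y. indicator {r..s} y *\<^sub>R (exp y *\<^sub>R (c \<tau> y * m \<tau> y)))) at_top"
    using eventually_ge_at_top[of "- r"] by eventually_elim (rule eq)
  from tendsto_unique[OF trivial_limit_at_top_linorder Lim_transform_eventually[OF lhs this] rhs]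
  show ?thesis .
qed

lemma ray_derivative:
  "((\<lambda>s. mchar \<mu> (exp (a * s) *\<^sub>R \<zeta>)) has_vector_derivative
    mchar \<mu> (exp (a * s) *\<^sub>R \<zeta>) * (child (exp (a * s) *\<^sub>R \<zeta>) - 1)) (at s)"
proof -
  have "((\<lambda>s. mchar \<mu> (exp (a * s) *\<^sub>R \<zeta>)) has_vector_derivative
    mchar \<mu> (exp (a * s) *\<^sub>R \<zeta>) * child (exp (a * s) *\<^sub>R \<zeta>) - mchar \<mu> (exp (a * s) *\<^sub>R \<zeta>)) (at s)"
    by (rule has_vector_derivative_of_exp_increment[OF _ ray_increment])
      (intro continuous_intros continuous_on_compose2[OF continuous_child]
        continuous_on_compose2[OF continuous_mchar[OF prob_\<mu> sets_\<mu>]]; simp)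
  then show ?thesis by (simp add: algebra_simps)
qed

text \<open>The growth exp (2 a t) of the deficit cancels against the square of the scaling exp (- a
  t). This quadratic bound at 0 encodes a finite second moment.\<close>

lemma one_minus_Re_mchar_le: "1 - Re (mchar \<mu> \<zeta>) \<le> C\<^sub>0 * (norm \<zeta>)\<^sup>2"
proof (rule tendsto_upperbound)
  show "((\<lambda>t. 1 - Re (cf (Pos i1) t (exp (- (a * t)) *\<^sub>R \<zeta>))) \<longlongrightarrow> 1 - Re (mchar \<mu> \<zeta>)) at_top"
    by (intro tendsto_intros cf_limit)
  show "eventually (\<lambda>t. 1 - Re (cf (Pos i1) t (exp (- (a * t)) *\<^sub>R \<zeta>)) \<le> C\<^sub>0 * (norm \<zeta>)\<^sup>2) at_top"
    using eventually_ge_at_top[of 0]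
  proof eventually_elim
    fix t :: real assume "0 \<le> t"
    have "1 - Re (cf (Pos i1) t (exp (- (a * t)) *\<^sub>R \<zeta>)) \<le> C\<^sub>0 * (norm (exp (- (a * t)) *\<^sub>R \<zeta>))\<^sup>2 * exp (2 * a * t)"
      using deficit_term_le deficit_upper[OF \<open>0 \<le> t\<close>] by (rule order_trans)
    also have "\<dots> = C\<^sub>0 * (norm \<zeta>)\<^sup>2 * (exp (- (a * t)) * exp (- (a * t)) * exp (2 * a * t))"
      by (simp add: power2_eq_square)
    also have "exp (- (a * t)) * exp (- (a * t)) * exp (2 * a * t) = 1"
      by (simp flip: exp_add)
    finally show "1 - Re (cf (Pos i1) t (exp (- (a * t)) *\<^sub>R \<zeta>)) \<le> C\<^sub>0 * (norm \<zeta>)\<^sup>2" by simp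
  qed
qed simp

text \<open>The scaled initial value exp (a t) sin (exp (- a t) y) tends to y while the correction
  factor does not depend on t. The result is the nondegeneracy of the limit.\<close>

lemma Im_mchar_lower: "(\<zeta> $ i1)\<^sup>2 * exp (- (3 * C\<^sub>0 / a * (norm \<zeta>)\<^sup>2)) \<le> (Im (mchar \<mu> \<zeta>))\<^sup>2"
proof (rule tendsto_le)
  show "((\<lambda>t. (Im (cf (Pos i1) t (exp (- (a * t)) *\<^sub>R \<zeta>)))\<^sup>2) \<longlongrightarrow> (Im (mchar \<mu> \<zeta>))\<^sup>2) at_top"
    by (intro tendsto_intros cf_limit)
  have "((\<lambda>t. sin (exp (- (a * t)) * y) * exp (a * t)) \<longlongrightarrow> y) at_top" for y
    using a_gt_half by real_asymp
  then show "((\<lambda>t. (sin (exp (- (a * t)) * (\<zeta> $ i1)) * exp (a * t))\<^sup>2 * exp (- (3 * C\<^sub>0 / a * (norm \<zeta>)\<^sup>2)))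
      \<longlongrightarrow> (\<zeta> $ i1)\<^sup>2 * exp (- (3 * C\<^sub>0 / a * (norm \<zeta>)\<^sup>2))) at_top"
    by (intro tendsto_intros)
  show "eventually (\<lambda>t. (sin (exp (- (a * t)) * (\<zeta> $ i1)) * exp (a * t))\<^sup>2 * exp (- (3 * C\<^sub>0 / a * (norm \<zeta>)\<^sup>2))
      \<le> (Im (cf (Pos i1) t (exp (- (a * t)) *\<^sub>R \<zeta>)))\<^sup>2) at_top"
    using eventually_ge_at_top[of 0]
  proof eventually_elim
    fix t :: real assume "0 \<le> t"
    let ?\<eta> = "exp (- (a * t)) *\<^sub>R \<zeta>"
    have "(norm ?\<eta>)\<^sup>2 * exp (2 * a * t) = (norm \<zeta>)\<^sup>2 * (exp (- (a * t)) * exp (- (a * t)) * exp (2 * a * t))"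
      by (simp add: power2_eq_square)
    also have "exp (- (a * t)) * exp (- (a * t)) * exp (2 * a * t) = 1"
      by (simp flip: exp_add)
    finally have n: "3 * C\<^sub>0 / a * (norm ?\<eta>)\<^sup>2 * exp (2 * a * t) = 3 * C\<^sub>0 / a * (norm \<zeta>)\<^sup>2"
      by simp
    have "(sin (?\<eta> $ i1) * exp (a * t))\<^sup>2 * exp (- (3 * C\<^sub>0 / a * (norm \<zeta>)\<^sup>2)) =
        (sin (?\<eta> $ i1))\<^sup>2 * exp (2 * a * t - 3 * C\<^sub>0 / a * (norm ?\<eta>)\<^sup>2 * exp (2 * a * t))"
      unfolding n by (simp add: power_mult_distrib exp_diff exp_minus field_simps flip: exp_double)
    also have "\<dots> \<le> (Im (cf (Pos i1) t ?\<eta>))\<^sup>2"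
      by (rule Im_cf_lower) fact
    finally show "(sin (exp (- (a * t)) * (\<zeta> $ i1)) * exp (a * t))\<^sup>2 * exp (- (3 * C\<^sub>0 / a * (norm \<zeta>)\<^sup>2))
      \<le> (Im (cf (Pos i1) t ?\<eta>))\<^sup>2" by simp
  qed
qed simp

end

subsection \<open>Decay and moments\<close>

text \<open>For h' = h w it turns the derivative of |h|^2 into 2 |h|^2 Re w.\<close>

lemma inner_mult_self: "z \<bullet> (z * w) = (cmod z)\<^sup>2 * Re w" for z w :: complex
  unfolding cmod_power2 inner_complex_def by (simp add: power2_eq_square algebra_simps)

lemma borel_measurable_vec_nth [measurable]:
  "(\<lambda>x :: real ^ 'n. x $ i) \<in> borel_measurable borel"
  by (intro borel_measurable_continuous_onI continuous_intros)

context elephant_limit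
begin

text \<open>Restriction to the diagonal: the inner product of (x, ..., x) with W is x times the
  coordinate sum, so this is the characteristic function of \<open>w\<close>.\<close>

definition \<phi> :: "real \<Rightarrow> complex" where
  "\<phi> x = mchar \<mu> (\<chi> i. x)"

lemma norm_\<phi>_le_1: "cmod (\<phi> x) \<le> 1"
  unfolding \<phi>_def by (rule norm_mchar_le_1[OF prob_\<mu>])

lemma \<phi>_minus: "\<phi> (- x) = cnj (\<phi> x)"
proof -
  have "(\<chi> i. - x) = - (\<chi> i. x :: real ^ 'd)" by (simp add: vec_eq_iff)
  then show ?thesis unfolding \<phi>_def by (simp add: mchar_minus)
qed

lemma continuous_\<phi>: "continuous_on UNIV \<phi>"
  unfolding \<phi>_def
  by (intro continuous_on_compose2[OF continuous_mchar[OF prob_\<mu> sets_\<mu>]] continuous_intros) auto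

text \<open>Permuting coordinates fixes the diagonal, so each \<open>to_e1 u\<close> acts on it by a
  sign only, and the equation closes up in \<phi> and its conjugate.\<close>

lemma child_diag: "child (\<chi> i. x) = of_real ((1 - a) * Re (\<phi> x)) + a *\<^sub>R \<phi> x"
proof -
  have [simp]: "to_e1 (Pos j) (\<chi> i. x) = (\<chi> i. x)" "to_e1 (Neg j) (\<chi> i. x) = - (\<chi> i. x)" for j
    by (simp_all add: vec_eq_iff)
  have "child (\<chi> i. x) = \<beta> *\<^sub>R (dim *\<^sub>R (\<phi> x + cnj (\<phi> x))) + a *\<^sub>R \<phi> x"
    unfolding child_def sum_q sum_direction
    by (simp add: \<phi>_def mchar_minus dim_def scaleR_conv_of_real algebra_simps)
  also have "\<beta> *\<^sub>R (dim *\<^sub>R (\<phi> x + cnj (\<phi> x))) = of_real ((2 * dim * \<beta>) * Re (\<phi> x))"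
    by (simp add: complex_add_cnj scaleR_conv_of_real algebra_simps)
  also have "2 * dim * \<beta> = 1 - a" using a_\<beta> by simp
  finally show ?thesis .
qed

lemma diag_derivative:
  "((\<lambda>s. (cmod (\<phi> (exp (a * s))))\<^sup>2) has_real_derivative
     - 2 * (1 - Re (\<phi> (exp (a * s)))) * (cmod (\<phi> (exp (a * s))))\<^sup>2) (at s)"
proof -
  have diag: "exp y *\<^sub>R (\<chi> i. 1) = (\<chi> i. exp y :: real ^ 'd)" for y :: real
    by (simp add: vec_eq_iff)
  have "((\<lambda>s. \<phi> (exp (a * s))) has_vector_derivative \<phi> (exp (a * s)) * (child (\<chi> i. exp (a * s)) - 1)) (at s)"
    using ray_derivative[of "\<chi> i. 1" s] by (simp add: diag \<phi>_def)
  from has_real_derivative_norm_power2[OF this]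
  have "((\<lambda>s. (cmod (\<phi> (exp (a * s))))\<^sup>2) has_real_derivative
      2 * ((cmod (\<phi> (exp (a * s))))\<^sup>2 * Re (child (\<chi> i. exp (a * s)) - 1))) (at s)"
    unfolding inner_mult_self .
  also have "Re (child (\<chi> i. exp (a * s)) - 1) = Re (\<phi> (exp (a * s))) - 1"
    by (simp add: child_diag algebra_simps)
  also have "2 * ((cmod (\<phi> (exp (a * s))))\<^sup>2 * (Re (\<phi> (exp (a * s))) - 1)) =
      - 2 * (1 - Re (\<phi> (exp (a * s)))) * (cmod (\<phi> (exp (a * s))))\<^sup>2"
    by (simp add: algebra_simps)
  finally show ?thesis .
qed

lemma Im_\<phi>_nonzero: "x \<noteq> 0 \<Longrightarrow> Im (\<phi> x) \<noteq> 0"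
  using Im_mchar_lower[of "\<chi> i. x"] by (auto simp: \<phi>_def mult_le_0_iff)

lemma Re_\<phi>_less_1: "x \<noteq> 0 \<Longrightarrow> Re (\<phi> x) < 1"
proof (rule ccontr)
  assume "x \<noteq> 0" "\<not> Re (\<phi> x) < 1"
  then have "1 \<le> (Re (\<phi> x))\<^sup>2" by simp
  moreover have "0 < (Im (\<phi> x))\<^sup>2" using Im_\<phi>_nonzero[OF \<open>x \<noteq> 0\<close>] by simp
  moreover have "(Re (\<phi> x))\<^sup>2 + (Im (\<phi> x))\<^sup>2 \<le> 1"
    using norm_\<phi>_le_1[of x] unfolding cmod_power2[symmetric] by (simp add: power_le_one)
  ultimately show False by linarith
qed

lemma \<phi>_exp_decay:
  obtains C where "\<And>s. cmod (\<phi> (exp (a * s))) * exp s \<le> C"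
proof -
  define R where "R s = cmod (\<phi> (exp (a * s)))" for s
  define f where "f s = Re (\<phi> (exp (a * s)))" for s
  have R_pos: "0 < R s" for s
    using Im_\<phi>_nonzero[of "exp (a * s)"] by (auto simp: R_def complex_eq_iff)
  have f_le: "f s \<le> R s" for s
    unfolding f_def R_def by (rule complex_Re_le_cmod)
  have f_less: "f s < 1" for s
    unfolding f_def by (rule Re_\<phi>_less_1) simp
  have dR: "(R has_real_derivative - (1 - f s) * R s) (at s)" for s
  proof -
    have "((\<lambda>s. sqrt ((R s)\<^sup>2)) has_real_derivative
        inverse (sqrt ((R s)\<^sup>2)) / 2 * (- 2 * (1 - f s) * (R s)\<^sup>2)) (at s)"
      using R_pos[of s]
      by (intro DERIV_chain2[OF DERIV_real_sqrt] diag_derivative[of s, folded R_def f_def]) simp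
    moreover have "sqrt ((R s)\<^sup>2) = R s" for s
      using R_pos[of s] by simp
    moreover have "inverse (R s) / 2 * (- 2 * (1 - f s) * (R s)\<^sup>2) = - (1 - f s) * R s"
      using R_pos[of s] by (simp add: power2_eq_square field_simps)
    ultimately show ?thesis by simp
  qed
  have R'_neg: "- (1 - f s) * R s < 0" for s
    using f_less[of s] R_pos[of s] by (intro mult_neg_pos) auto
  \<comment> \<open>Strict decrease brings \<open>R\<close> below 1 at time 1, from where on the
    denominator of \<open>B\<close> is positive.\<close>
  have "R 1 < R 0"
    using dR R'_neg by (intro DERIV_neg_imp_decreasing[of 0 1]) auto
  also have "R 0 \<le> 1" unfolding R_def by (rule norm_\<phi>_le_1)
  finally have R1: "R 1 < 1" .
  have R_mono: "R t \<le> R s" if "s \<le> t" for s t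
    using dR R'_neg by (intro DERIV_nonpos_imp_nonincreasing[OF that]) (blast intro: less_imp_le)
  \<comment> \<open>For the logistic equation R' = - R (1 - R) this quotient is constant. Here R' =
    - R (1 - f) with f \<le> R, so R decays at least as fast.\<close>
  define B where "B s = R s * exp s / (1 - R s)" for s
  have B_mono: "B s \<le> B 1" if "1 \<le> s" for s
  proof (rule DERIV_nonpos_imp_nonincreasing[OF that])
    fix t :: real assume "1 \<le> t" "t \<le> s"
    have Rt: "0 < 1 - R t" using R_mono[OF \<open>1 \<le> t\<close>] R1 by simp
    let ?D = "(- (1 - f t) * R t + R t * (1 - R t)) * exp t / (1 - R t)\<^sup>2"
    have "(B has_real_derivative ?D) (at t)"
      unfolding B_def using Rt
      by (auto intro!: derivative_eq_intros dR simp: field_simps power2_eq_square)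
    moreover have "- (1 - f t) * R t + R t * (1 - R t) \<le> 0"
    proof -
      have "- (1 - f t) * R t + R t * (1 - R t) = - ((R t - f t) * R t)"
        by (simp add: algebra_simps)
      also have "\<dots> \<le> 0" using f_le[of t] R_pos[of t] by simp
      finally show ?thesis .
    qed
    then have "?D \<le> 0" by (intro divide_nonpos_nonneg mult_nonpos_nonneg) auto
    ultimately show "\<exists>y. (B has_real_derivative y) (at t) \<and> y \<le> 0" by blast
  qed
  show ?thesis
  proof
    fix s
    \<comment> \<open>The value exp 1 handles times before 1, where only |\<phi>| \<le> 1 is
      available.\<close>
    show "cmod (\<phi> (exp (a * s))) * exp s \<le> max (exp 1) (B 1)"
    proof (cases "1 \<le> s")
      case True
      have Rs: "0 < 1 - R s" using R_mono[OF True] R1 by simp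
      have B1: "0 \<le> B 1" using R1 R_pos[of 1] by (simp add: B_def)
      have "R s * exp s = B s * (1 - R s)" using Rs by (simp add: B_def)
      also have "\<dots> \<le> B 1 * 1" using Rs B_mono[OF True] B1 R_pos[of s] by (intro mult_mono) auto
      finally show ?thesis by (simp add: R_def)
    next
      case False
      then have "R s * exp s \<le> 1 * exp 1"
        unfolding R_def using norm_\<phi>_le_1 by (intro mult_mono) auto
      then show ?thesis by (simp add: R_def)
    qed
  qed
qed

lemma \<phi>_decay:
  obtains C where "\<And>x. \<bar>x\<bar> powr (1 / a) * cmod (\<phi> x) \<le> C"
proof -
  obtain C where C: "\<And>s. cmod (\<phi> (exp (a * s))) * exp s \<le> C"
    using \<phi>_exp_decay by blast
  have pos: "x powr (1 / a) * cmod (\<phi> x) \<le> C" if "0 < x" for x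
  proof -
    have "exp (a * (ln x / a)) = x" using that a_gt_half by simp
    moreover have "exp (ln x / a) = x powr (1 / a)" using that by (simp add: powr_def)
    ultimately show ?thesis using C[of "ln x / a"] by (simp add: mult.commute)
  qed
  have "0 \<le> C" using order_trans[OF norm_ge_zero, of "\<phi> 1" C] pos[of 1] by simp
  have "\<bar>x\<bar> powr (1 / a) * cmod (\<phi> x) \<le> C" for x
  proof (cases x "0 :: real" rule: linorder_cases)
    case less
    then show ?thesis using pos[of "- x"] by (simp add: \<phi>_minus)
  next
    case equal
    then show ?thesis using \<open>0 \<le> C\<close> by simp
  next
    case greater
    then show ?thesis using pos[of x] by simp
  qed
  then show ?thesis by (rule that)
qed

text \<open>a < 1 makes the exponent 1/a of the decay exceed 1, so the tails are integrable.\<close>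

lemma integrable_\<phi>: "integrable lborel (\<lambda>x. cmod (\<phi> x))"
proof -
  obtain C where C: "\<And>x. \<bar>x\<bar> powr (1 / a) * cmod (\<phi> x) \<le> C"
    using \<phi>_decay by blast
  define e where "e = 1 / a"
  have e: "1 < e" using a_gt_half a_less_1 by (simp add: e_def)
  have [measurable]: "\<phi> \<in> borel_measurable borel"
    by (rule borel_measurable_continuous_onI[OF continuous_\<phi>])
  define g where "g x = indicator {1..} x * x powr (- e)" for x :: real
  have [measurable]: "g \<in> borel_measurable borel"
    unfolding g_def by measurable
  have g_int: "integrable lborel g"
  proof (rule integrableI_nonneg)
    have "(\<integral>\<^sup>+x. ennreal (g x) \<partial>lborel) = (\<integral>\<^sup>+x. ennreal (x powr (- e)) * indicator {1..} x \<partial>lborel)"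
      by (intro nn_integral_cong) (auto simp: g_def indicator_def)
    also have "\<dots> = ennreal (0 - (1 powr (1 - e) / (1 - e)))"
    proof (rule nn_integral_FTC_atLeast[where F = "\<lambda>x. x powr (1 - e) / (1 - e)"])
      show "((\<lambda>x. x powr (1 - e) / (1 - e)) \<longlongrightarrow> 0) at_top"
        using e by real_asymp
      show "((\<lambda>x. x powr (1 - e) / (1 - e)) has_real_derivative x powr (- e)) (at x)" if "1 \<le> x" for x
        using e that by (auto intro!: derivative_eq_intros)
    qed auto
    finally show "(\<integral>\<^sup>+x. ennreal (g x) \<partial>lborel) < \<infinity>" by simp
  qed (auto simp: g_def)
  have g'_int: "integrable lborel (\<lambda>x. g (- x))"
    using lborel_integrable_real_affine[OF g_int, of "-1" 0] by simp
  have i_int: "integrable lborel (\<lambda>x. indicator {-1..1 :: real} x :: real)"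
    by (rule integrable_real_indicator) (auto simp: emeasure_lborel_Icc_eq)
  have "integrable lborel (\<lambda>x. indicator {-1..1} x + (C * g x + C * g (- x)))"
    by (intro Bochner_Integration.integrable_add integrable_mult_right i_int g_int g'_int)
  then show ?thesis
  proof (rule Bochner_Integration.integrable_bound)
    have C0: "0 \<le> C" using C[of 0] by simp
    have bound: "cmod (\<phi> x) \<le> C * \<bar>x\<bar> powr (- e)" if "x \<noteq> 0" for x
    proof -
      have A: "\<bar>x\<bar> powr (- e) * (\<bar>x\<bar> powr e * cmod (\<phi> x)) \<le> \<bar>x\<bar> powr (- e) * C"
        using C[of x] by (intro mult_left_mono) (auto simp: e_def)
      have B: "\<bar>x\<bar> powr (- e) * (\<bar>x\<bar> powr e * cmod (\<phi> x)) = cmod (\<phi> x)"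
        using that by (simp add: powr_minus)
      show ?thesis
        unfolding mult.commute[of C] by (rule ord_eq_le_trans[OF B[symmetric] A])
    qed
    show "AE x in lborel. norm (cmod (\<phi> x)) \<le> norm (indicator {-1..1} x + (C * g x + C * g (- x)))"
    proof (rule AE_I2)
      fix x :: real
      have g0: "0 \<le> g y" for y by (simp add: g_def)
      have "cmod (\<phi> x) \<le> indicator {-1..1} x + (C * g x + C * g (- x))"
      proof (cases "x \<in> {-1..1}")
        case True
        have "cmod (\<phi> x) \<le> 1 + (0 + 0)" using norm_\<phi>_le_1 by simp
        also have "\<dots> \<le> 1 + (C * g x + C * g (- x))"
          using C0 g0 by (intro add_mono order_refl mult_nonneg_nonneg) auto
        finally show ?thesis using True by simp
      next
        case False
        then have "1 < x \<or> x < -1" by auto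
        then show ?thesis using bound[of x] by (auto simp: g_def indicator_def abs_if split: if_splits)
      qed
      then show "norm (cmod (\<phi> x)) \<le> norm (indicator {-1..1} x + (C * g x + C * g (- x)))"
        by simp
    qed
  qed simp
qed

text \<open>2 n^2 (1 - cos (x_i / n)) tends to x_i^2, and its mean is a second difference of the
  characteristic function at 0, bounded by the quadratic estimate there. Fatou's lemma
  concludes.\<close>

lemma nn_integral_component_power2_le: "(\<integral>\<^sup>+x. ennreal ((x $ i)\<^sup>2) \<partial>\<mu>) \<le> ennreal (2 * C\<^sub>0)"
proof -
  interpret prob_space \<mu> by (rule prob_\<mu>)
  define f where "f n x = 2 * (real n)\<^sup>2 * (1 - cos (x $ i / real n))" for n and x :: "real ^ 'd"
  have f_nonneg: "0 \<le> f n x" for n x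
    by (simp add: f_def)
  have [measurable]: "f n \<in> borel_measurable \<mu>" for n
    unfolding f_def by measurable
  have f_lim: "(\<lambda>n. f n x) \<longlonglongrightarrow> (x $ i)\<^sup>2" for x
  proof -
    have "(\<lambda>n. 2 * (real n)\<^sup>2 * (1 - cos (y / real n))) \<longlonglongrightarrow> y * y" for y :: real
      by real_asymp
    then show ?thesis unfolding f_def power2_eq_square[of "x $ i"] .
  qed
  have f_int: "(\<integral>\<^sup>+x. ennreal (f n x) \<partial>\<mu>) \<le> ennreal (2 * C\<^sub>0)" for n
  proof -
    let ?z = "axis i (1 / real n) :: real ^ 'd"
    have int_iexp: "integrable \<mu> (\<lambda>x. iexp (?z \<bullet> x))"
      by (rule integrable_const_bound[where B = 1]) auto
    have int_cos: "integrable \<mu> (\<lambda>x. cos (x $ i / real n))"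
      by (rule integrable_const_bound[where B = 1]) auto
    have "Re (mchar \<mu> ?z) = (\<integral>x. Re (iexp (?z \<bullet> x)) \<partial>\<mu>)"
      unfolding mchar_def by (rule integral_Re[OF int_iexp, symmetric])
    also have "\<dots> = (\<integral>x. cos (x $ i / real n) \<partial>\<mu>)"
      by (simp add: Re_exp inner_axis' del: of_real_mult)
    finally have Re_eq: "Re (mchar \<mu> ?z) = (\<integral>x. cos (x $ i / real n) \<partial>\<mu>)" .
    have "(\<integral>\<^sup>+x. ennreal (f n x) \<partial>\<mu>) = ennreal (\<integral>x. f n x \<partial>\<mu>)"
      using int_cos f_nonneg by (intro nn_integral_eq_integral) (auto simp: f_def)
    also have "(\<integral>x. f n x \<partial>\<mu>) = 2 * (real n)\<^sup>2 * (1 - Re (mchar \<mu> ?z))"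
      using int_cos by (simp add: f_def Re_eq prob_space)
    also have "\<dots> \<le> 2 * (real n)\<^sup>2 * (C\<^sub>0 * (norm ?z)\<^sup>2)"
      by (intro mult_left_mono one_minus_Re_mchar_le) auto
    also have "(norm ?z)\<^sup>2 = (1 / real n)\<^sup>2"
      unfolding power2_norm_eq_inner by (simp add: inner_axis_axis power2_eq_square)
    also have "2 * (real n)\<^sup>2 * (C\<^sub>0 * (1 / real n)\<^sup>2) \<le> 2 * C\<^sub>0"
      using C\<^sub>0_pos by (cases "n = 0") (simp_all add: power_divide)
    finally show ?thesis by (simp add: ennreal_leI)
  qed
  have "(\<integral>\<^sup>+x. ennreal ((x $ i)\<^sup>2) \<partial>\<mu>) = (\<integral>\<^sup>+x. liminf (\<lambda>n. ennreal (f n x)) \<partial>\<mu>)"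
  proof (intro nn_integral_cong)
    fix x
    have "(\<lambda>n. ennreal (f n x)) \<longlonglongrightarrow> ennreal ((x $ i)\<^sup>2)"
      using f_lim by (intro tendsto_ennrealI)
    then show "ennreal ((x $ i)\<^sup>2) = liminf (\<lambda>n. ennreal (f n x))"
      by (simp add: lim_imp_Liminf)
  qed
  also have "\<dots> \<le> liminf (\<lambda>n. \<integral>\<^sup>+x. ennreal (f n x) \<partial>\<mu>)"
    by (rule nn_integral_liminf) measurable
  also have "\<dots> \<le> ennreal (2 * C\<^sub>0)"
    using f_int by (intro Liminf_le) (auto simp: eventually_sequentially)
  finally show ?thesis .
qed

lemma integrable_norm: "integrable \<mu> norm"
proof -
  interpret prob_space \<mu> by (rule prob_\<mu>)
  have "integrable \<mu> (\<lambda>x. (x $ i)\<^sup>2)" for i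
    using nn_integral_component_power2_le[of i]
    by (intro integrableI_nonneg) (auto intro: le_less_trans)
  then have "integrable \<mu> (\<lambda>x. \<Sum>i\<in>UNIV. 1 + (x $ i)\<^sup>2)"
    by (intro Bochner_Integration.integrable_sum Bochner_Integration.integrable_add) auto
  then show ?thesis
  proof (rule Bochner_Integration.integrable_bound)
    show "AE x in \<mu>. norm (norm x) \<le> norm (\<Sum>i\<in>UNIV. 1 + (x $ i)\<^sup>2)"
    proof (rule AE_I2)
      fix x
      have "norm x \<le> (\<Sum>i\<in>UNIV. \<bar>x $ i\<bar>)" by (rule norm_le_l1_cart)
      also have "\<dots> \<le> (\<Sum>i\<in>UNIV. 1 + (x $ i)\<^sup>2)"
      proof (rule sum_mono)
        fix i
        have "0 \<le> (\<bar>x $ i\<bar> - 1)\<^sup>2 + (1 + (x $ i)\<^sup>2)" by simp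
        also have "\<dots> = 2 * (1 + (x $ i)\<^sup>2 - \<bar>x $ i\<bar>)"
          by (simp add: power2_eq_square algebra_simps)
        finally show "\<bar>x $ i\<bar> \<le> 1 + (x $ i)\<^sup>2" by simp
      qed
      finally show "norm (norm x) \<le> norm (\<Sum>i\<in>UNIV. 1 + (x $ i)\<^sup>2)"
        by (simp add: sum_nonneg)
    qed
  qed simp
qed

end

subsection \<open>Infinite divisibility\<close>

text \<open>The \<open>k\<close>-th summand of a shot noise: \<open>fst (\<omega> j)\<close> is the
  waiting time before point \<open>j\<close>, so the sum is the position of point \<open>k\<close>,
  and \<open>snd (\<omega> k)\<close> is its mark.\<close>

definition discounted_term :: "real \<Rightarrow> nat \<Rightarrow> (nat \<Rightarrow> real \<times> 'b::euclidean_space) \<Rightarrow> 'b" where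
  "discounted_term b k \<omega> = exp (- b * (\<Sum>j\<le>k. fst (\<omega> j))) *\<^sub>R snd (\<omega> k)"

lemma discounted_term_case_nat_0: "discounted_term b 0 (case_nat z \<omega>) = exp (- b * fst z) *\<^sub>R snd z"
  by (simp add: discounted_term_def)

lemma discounted_term_case_nat_Suc:
  "discounted_term b (Suc k) (case_nat z \<omega>) = exp (- b * fst z) *\<^sub>R discounted_term b k \<omega>"
proof -
  have "(\<Sum>j\<le>Suc k. fst (case_nat z \<omega> j)) = fst z + (\<Sum>j\<le>k. fst (\<omega> j))"
    by (subst sum.atMost_Suc_shift) simp
  moreover have "exp (- b * (x + y)) = exp (- b * x) * exp (- b * y)" for x y
    by (simp add: algebra_simps flip: exp_add)
  ultimately show ?thesis
    unfolding discounted_term_def by simp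
qed

lemma nn_integral_exp1_exp:
  assumes "0 < b" shows "(\<integral>\<^sup>+r. ennreal (exp (- b * r)) \<partial>exp1) = ennreal (1 / (1 + b))"
proof -
  define c where "c = 1 + b"
  have c: "0 < c" using assms by (simp add: c_def)
  have "(\<integral>\<^sup>+r. ennreal (exp (- b * r)) \<partial>exp1) =
      (\<integral>\<^sup>+r. ennreal (exponential_density 1 r) * ennreal (exp (- b * r)) \<partial>lborel)"
    unfolding exp1_def by (rule nn_integral_density) auto
  also have "\<dots> = (\<integral>\<^sup>+r. ennreal (exp (- (1 + b) * r)) * indicator {0..} r \<partial>lborel)"
    by (intro nn_integral_cong)
      (auto simp: exponential_density_def indicator_def algebra_simps simp flip: ennreal_mult'' exp_add)
  also have "\<dots> = ennreal (0 - (- 1 / (1 + b)) * exp (- (1 + b) * 0))"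
    unfolding c_def[symmetric]
  proof (rule nn_integral_FTC_atLeast[where F = "\<lambda>r. (- 1 / c) * exp (- c * r)"])
    show "((\<lambda>r. (- 1 / c) * exp (- c * r)) \<longlongrightarrow> 0) at_top"
      using c by real_asymp
    show "((\<lambda>r. (- 1 / c) * exp (- c * r)) has_real_derivative exp (- c * r)) (at r)" for r
    proof -
      have "((\<lambda>r. (- 1 / c) * exp (- c * r)) has_real_derivative (- 1 / c) * (exp (- c * r) * - c)) (at r)"
        by (auto intro!: derivative_eq_intros)
      then show ?thesis using c by simp
    qed
  qed auto
  finally show ?thesis by simp
qed

text \<open>\<open>\<nu>\<close> is the law of the shot noise \<open>\<Sum>\<^sub>k exp (- b s\<^sub>k) y\<^sub>k\<close>, where the \<open>s\<^sub>k\<close> are the points of a Poisson process and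
  the \<open>y\<^sub>k\<close> are independent with law \<open>\<rho>\<close>.\<close>

lemma discounted_sum_exists:
  fixes \<rho> :: "'b::euclidean_space measure"
  assumes prob_\<rho>: "prob_space \<rho>" and sets_\<rho> [measurable_cong]: "sets \<rho> = sets borel"
    and int_\<rho>: "integrable \<rho> norm" and b: "0 < b"
  obtains \<nu> where "prob_space \<nu>" "sets \<nu> = sets borel"
    "\<And>\<zeta>. mchar \<nu> \<zeta> = (CLINT r | exp1. mchar \<rho> (exp (- b * r) *\<^sub>R \<zeta>) * mchar \<nu> (exp (- b * r) *\<^sub>R \<zeta>))"
proof -
  define N where "N = exp1 \<Otimes>\<^sub>M \<rho>"
  interpret E: prob_space exp1 by (rule prob_space_exp1)
  interpret R: prob_space \<rho> by fact
  interpret ER: pair_prob_space exp1 \<rho> ..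
  interpret N: prob_space N unfolding N_def by (rule ER.prob_space_axioms)
  define S where "S = (\<Pi>\<^sub>M _\<in>(UNIV :: nat set). N)"
  interpret S: prob_space S unfolding S_def by (rule prob_space_PiM) (rule N.prob_space_axioms)
  interpret NS: pair_prob_space N S ..
  \<comment> \<open>Prepending an independent pair to the sequence does not change its law; this is
    the source of the fixed-point equation for \<nu>.\<close>
  have iter: "distr (N \<Otimes>\<^sub>M S) S (\<lambda>(z, \<omega>). case_nat z \<omega>) = S"
  proof -
    interpret product_prob_space "\<lambda>_::nat. N" UNIV ..
    interpret sequence_space N ..
    show ?thesis unfolding S_def by (rule PiM_iter)
  qed
  have iter_meas: "(\<lambda>(z, \<omega>). case_nat z \<omega>) \<in> N \<Otimes>\<^sub>M S \<rightarrow>\<^sub>M S"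
    unfolding S_def by measurable
  have comp: "(\<lambda>\<omega>. \<omega> k) \<in> S \<rightarrow>\<^sub>M N" for k
    unfolding S_def by (rule measurable_component_singleton) simp
  have [measurable]: "fst \<in> borel_measurable N" "snd \<in> borel_measurable N"
    using measurable_fst[of exp1 \<rho>] measurable_snd[of exp1 \<rho>] measurable_cong_sets[OF refl sets_\<rho>]
    by (auto simp: N_def)
  have fst_comp [measurable]: "(\<lambda>\<omega>. fst (\<omega> k)) \<in> borel_measurable S"
    and snd_comp [measurable]: "(\<lambda>\<omega>. snd (\<omega> k)) \<in> borel_measurable S" for k
    by (rule measurable_compose[OF comp]; measurable)+
  have term_meas [measurable]: "discounted_term b k \<in> borel_measurable S" for k
    unfolding discounted_term_def by measurable
  \<comment> \<open>The mean of exp (- b r) for an Exp(1) time r: each waiting time costs a factor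
    \<open>c < 1\<close>, so the norms have geometrically decreasing means and the series converges
    absolutely.\<close>
  define c where "c = 1 / (1 + b)"
  have c: "0 \<le> c" "c < 1" using b by (simp_all add: c_def)
  define m where "m = (\<integral>x. norm x \<partial>\<rho>)"
  have m: "0 \<le> m" by (simp add: m_def)
  have term_int: "(\<integral>\<^sup>+\<omega>. ennreal (norm (discounted_term b k \<omega>)) \<partial>S) = ennreal (c ^ Suc k * m)" for k
  proof (induction k)
    case 0
    have "(\<integral>\<^sup>+\<omega>. ennreal (norm (discounted_term b 0 \<omega>)) \<partial>S) =
        (\<integral>\<^sup>+\<omega>. ennreal (exp (- b * fst (\<omega> 0)) * norm (snd (\<omega> 0))) \<partial>S)"
      by (simp add: discounted_term_def)
    also have "\<dots> = (\<integral>\<^sup>+z. ennreal (exp (- b * fst z) * norm (snd z)) \<partial>distr S N (\<lambda>\<omega>. \<omega> 0))"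
      by (rule nn_integral_distr[OF comp, symmetric]) measurable
    also have "distr S N (\<lambda>\<omega>. \<omega> 0) = N"
      unfolding S_def by (rule distr_PiM_component) (auto intro: N.prob_space_axioms)
    also have "(\<integral>\<^sup>+z. ennreal (exp (- b * fst z) * norm (snd z)) \<partial>N) =
        (\<integral>\<^sup>+r. \<integral>\<^sup>+x. ennreal (exp (- b * r) * norm x) \<partial>\<rho> \<partial>exp1)"
      unfolding N_def by (subst R.nn_integral_fst[symmetric]) auto
    also have "\<dots> = (\<integral>\<^sup>+r. ennreal (exp (- b * r)) * ennreal m \<partial>exp1)"
      using int_\<rho>
      by (intro nn_integral_cong) (simp add: ennreal_mult nn_integral_cmult nn_integral_eq_integral m_def)
    also have "\<dots> = ennreal c * ennreal m"
      using nn_integral_exp1_exp[OF b] by (simp add: nn_integral_multc c_def)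
    finally show ?case using c m by (simp add: ennreal_mult)
  next
    case (Suc k)
    have "(\<integral>\<^sup>+\<omega>. ennreal (norm (discounted_term b (Suc k) \<omega>)) \<partial>S) =
        (\<integral>\<^sup>+y. ennreal (norm (discounted_term b (Suc k) ((\<lambda>(z, \<omega>). case_nat z \<omega>) y))) \<partial>(N \<Otimes>\<^sub>M S))"
      by (subst iter[symmetric], rule nn_integral_distr[OF iter_meas]) simp
    also have "\<dots> = (\<integral>\<^sup>+y. ennreal (exp (- b * fst (fst y))) * ennreal (norm (discounted_term b k (snd y))) \<partial>(N \<Otimes>\<^sub>M S))"
      by (intro nn_integral_cong) (simp add: case_prod_beta discounted_term_case_nat_Suc ennreal_mult)
    also have "\<dots> = (\<integral>\<^sup>+z. \<integral>\<^sup>+\<omega>. ennreal (exp (- b * fst z)) * ennreal (norm (discounted_term b k \<omega>)) \<partial>S \<partial>N)"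
      by (subst S.nn_integral_fst[symmetric]) auto
    also have "\<dots> = (\<integral>\<^sup>+z. ennreal (exp (- b * fst z)) \<partial>N) * ennreal (c ^ Suc k * m)"
      by (simp add: nn_integral_cmult nn_integral_multc Suc)
    also have "(\<integral>\<^sup>+z. ennreal (exp (- b * fst z)) \<partial>N) = (\<integral>\<^sup>+r. \<integral>\<^sup>+x. ennreal (exp (- b * r)) \<partial>\<rho> \<partial>exp1)"
      unfolding N_def by (subst R.nn_integral_fst[symmetric]) auto
    also have "\<dots> = ennreal c"
      using nn_integral_exp1_exp[OF b] by (simp add: R.emeasure_space_1 c_def)
    finally show ?case using c m by (simp add: ennreal_mult[symmetric] mult.assoc)
  qed
  have summable: "AE \<omega> in S. summable (\<lambda>k. discounted_term b k \<omega>)"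
  proof -
    have "(\<integral>\<^sup>+\<omega>. (\<Sum>k. ennreal (norm (discounted_term b k \<omega>))) \<partial>S) = (\<Sum>k. ennreal (c ^ Suc k * m))"
      by (subst nn_integral_suminf) (auto simp: term_int)
    also have "\<dots> = ennreal (\<Sum>k. c ^ Suc k * m)"
      using c m by (intro suminf_ennreal2 summable_mult2) (auto intro!: summable_mult summable_geometric)
    finally have "AE \<omega> in S. (\<Sum>k. ennreal (norm (discounted_term b k \<omega>))) \<noteq> \<infinity>"
      by (intro nn_integral_PInf_AE) auto
    then show ?thesis
    proof eventually_elim
      fix \<omega> assume "(\<Sum>k. ennreal (norm (discounted_term b k \<omega>))) \<noteq> \<infinity>"
      then have "summable (\<lambda>k. norm (discounted_term b k \<omega>))"
        by (intro summable_suminf_not_top) auto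
      then show "summable (\<lambda>k. discounted_term b k \<omega>)" by (rule summable_norm_cancel)
    qed
  qed
  \<comment> \<open>As for \<open>position\<close>, taking \<open>lim\<close> makes \<open>V\<close>
    measurable everywhere, although the series converges only almost surely.\<close>
  define V :: "(nat \<Rightarrow> real \<times> 'b) \<Rightarrow> 'b" where "V \<omega> = lim (\<lambda>n. \<Sum>k<n. discounted_term b k \<omega>)" for \<omega>
  have V_meas [measurable]: "V \<in> borel_measurable S"
    unfolding V_def by (intro borel_measurable_lim_metric) measurable
  \<comment> \<open>The perpetuity equation: the first waiting time discounts the first mark and the
    whole remaining noise.\<close>
  have V_iter: "V (case_nat z \<omega>) = exp (- b * fst z) *\<^sub>R (snd z + V \<omega>)"
    if "summable (\<lambda>k. discounted_term b k \<omega>)" for z \<omega>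
  proof -
    have "(\<lambda>n. \<Sum>k<n. discounted_term b k \<omega>) \<longlonglongrightarrow> V \<omega>"
      using that unfolding V_def by (simp add: summable_iff_convergent convergent_LIMSEQ_iff)
    then have "(\<lambda>n. exp (- b * fst z) *\<^sub>R (snd z + (\<Sum>k<n. discounted_term b k \<omega>))) \<longlonglongrightarrow>
        exp (- b * fst z) *\<^sub>R (snd z + V \<omega>)"
      by (intro tendsto_intros)
    also have "(\<lambda>n. exp (- b * fst z) *\<^sub>R (snd z + (\<Sum>k<n. discounted_term b k \<omega>))) =
        (\<lambda>n. \<Sum>k<Suc n. discounted_term b k (case_nat z \<omega>))"
      by (simp only: sum.lessThan_Suc_shift discounted_term_case_nat_0 discounted_term_case_nat_Suc
        scaleR_add_right scaleR_sum_right)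
    finally have "(\<lambda>n. \<Sum>k<n. discounted_term b k (case_nat z \<omega>)) \<longlonglongrightarrow> exp (- b * fst z) *\<^sub>R (snd z + V \<omega>)"
      by (rule LIMSEQ_imp_Suc)
    then show ?thesis unfolding V_def[of "case_nat z \<omega>"] by (rule limI)
  qed
  define \<nu> where "\<nu> = distr S borel V"
  have prob_\<nu>: "prob_space \<nu>" unfolding \<nu>_def by (rule S.prob_space_distr) measurable
  have char_V: "mchar \<nu> \<zeta> = (CLINT \<omega> | S. iexp (\<zeta> \<bullet> V \<omega>))" for \<zeta>
    unfolding mchar_def \<nu>_def by (subst integral_distr) auto
  have cont_\<nu>: "continuous_on UNIV (mchar \<nu>)"
    by (rule continuous_mchar[OF prob_\<nu>]) (simp add: \<nu>_def)
  have "mchar \<nu> \<zeta> = (CLINT r | exp1. mchar \<rho> (exp (- b * r) *\<^sub>R \<zeta>) * mchar \<nu> (exp (- b * r) *\<^sub>R \<zeta>))" for \<zeta>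
  proof -
    have [measurable]: "(\<lambda>r. mchar \<nu> (exp (- b * r) *\<^sub>R \<zeta>)) \<in> borel_measurable borel"
      by (intro borel_measurable_continuous_onI continuous_on_compose2[OF cont_\<nu>] continuous_intros) auto
    let ?A = "\<lambda>z. iexp ((exp (- b * fst z) *\<^sub>R \<zeta>) \<bullet> snd z)"
    let ?B = "\<lambda>z \<omega>. iexp ((exp (- b * fst z) *\<^sub>R \<zeta>) \<bullet> V \<omega>)"
    have mB [measurable]: "(\<lambda>y. ?B (fst y) (snd y)) \<in> borel_measurable (N \<Otimes>\<^sub>M S)"
      by measurable
    have AE_snd: "AE y in N \<Otimes>\<^sub>M S. summable (\<lambda>k. discounted_term b k (snd y))"
    proof -
      have "distr (N \<Otimes>\<^sub>M S) S snd = S"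
        by (intro distr_pair_snd N.prob_space_axioms S.prob_space_axioms)
      then have "AE \<omega> in distr (N \<Otimes>\<^sub>M S) S snd. summable (\<lambda>k. discounted_term b k \<omega>)"
        using summable by (simp only:)
      then show ?thesis by (rule AE_distrD[OF measurable_snd])
    qed
    have "mchar \<nu> \<zeta> = (CLINT y | N \<Otimes>\<^sub>M S. iexp (\<zeta> \<bullet> V ((\<lambda>(z, \<omega>). case_nat z \<omega>) y)))"
      unfolding char_V by (subst iter[symmetric], rule integral_distr[OF iter_meas]) simp
    also have "\<dots> = (CLINT y | N \<Otimes>\<^sub>M S. ?A (fst y) * ?B (fst y) (snd y))"
    proof (rule integral_cong_AE)
      have "(\<lambda>\<omega>. iexp (\<zeta> \<bullet> V \<omega>)) \<in> borel_measurable S" by measurable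
      from measurable_compose[OF iter_meas this]
      show "(\<lambda>y. iexp (\<zeta> \<bullet> V ((\<lambda>(z, \<omega>). case_nat z \<omega>) y))) \<in> borel_measurable (N \<Otimes>\<^sub>M S)" .
      show "AE y in N \<Otimes>\<^sub>M S. iexp (\<zeta> \<bullet> V ((\<lambda>(z, \<omega>). case_nat z \<omega>) y)) = ?A (fst y) * ?B (fst y) (snd y)"
        using AE_snd
        by eventually_elim
          (simp add: case_prod_beta V_iter inner_add_right distrib_left exp_add)
    qed measurable
    also have "\<dots> = (CLINT z | N. CLINT \<omega> | S. ?A z * ?B z \<omega>)"
      by (subst NS.integral_fst'[symmetric])
        (auto intro!: NS.integrable_const_bound[where B = 1] simp: norm_mult)
    also have "\<dots> = (CLINT z | N. ?A z * mchar \<nu> (exp (- b * fst z) *\<^sub>R \<zeta>))"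
      by (simp add: char_V)
    also have "\<dots> = (CLINT r | exp1. CLINT x | \<rho>. iexp ((exp (- b * r) *\<^sub>R \<zeta>) \<bullet> x) * mchar \<nu> (exp (- b * r) *\<^sub>R \<zeta>))"
    proof -
      have "(\<lambda>z. ?A z * mchar \<nu> (exp (- b * fst z) *\<^sub>R \<zeta>)) \<in> borel_measurable N"
        by measurable
      then have "integrable N (\<lambda>z. ?A z * mchar \<nu> (exp (- b * fst z) *\<^sub>R \<zeta>))"
        by (intro N.integrable_const_bound[where B = 1]) (simp_all add: norm_mult norm_mchar_le_1[OF prob_\<nu>])
      from ER.integral_fst'[OF this[unfolded N_def]] show ?thesis
        by (simp add: N_def)
    qed
    also have "\<dots> = (CLINT r | exp1. mchar \<rho> (exp (- b * r) *\<^sub>R \<zeta>) * mchar \<nu> (exp (- b * r) *\<^sub>R \<zeta>))"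
      by (simp add: mchar_def[of \<rho>])
    finally show ?thesis .
  qed
  from that[OF prob_\<nu> _ this] show ?thesis
    by (simp add: \<nu>_def)
qed

text \<open>A function y that averages \<open>H\<close> over an Exp(1) delay solves y' = H - y; this
  is the increment form of that equation.\<close>

lemma exp1_convolution_increment:
  fixes H :: "real \<Rightarrow> complex"
  assumes H [measurable]: "H \<in> borel_measurable borel" and bound: "\<And>x. cmod (H x) \<le> B" and "r \<le> s"
  shows "exp s *\<^sub>R (CLINT x | exp1. H (s - x)) - exp r *\<^sub>R (CLINT x | exp1. H (r - x)) =
    (CLBINT x. indicator {r..s} x *\<^sub>R (exp x *\<^sub>R H x))"
proof -
  have eq: "exp t *\<^sub>R (CLINT x | exp1. H (t - x)) = (CLBINT x. indicator {..t} x *\<^sub>R (exp x *\<^sub>R H x))" for t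
  proof -
    have "(CLINT x | exp1. H (t - x)) = (CLBINT x. exponential_density 1 x *\<^sub>R H (t - x))"
      unfolding exp1_def by (intro integral_density) (auto simp: exponential_density_def)
    also have "\<dots> = (CLBINT x. indicator {..t} (t - x) *\<^sub>R (exp (- x) *\<^sub>R H (t - x)))"
      by (intro Bochner_Integration.integral_cong) (auto simp: exponential_density_def indicator_def)
    also have "\<dots> = (CLBINT x. indicator {..t} x *\<^sub>R (exp (x - t) *\<^sub>R H x))"
      by (subst lborel_integral_real_affine[where c = "-1" and t = t]) auto
    finally have "exp t *\<^sub>R (CLINT x | exp1. H (t - x)) = (CLBINT x. exp t *\<^sub>R (indicator {..t} x *\<^sub>R (exp (x - t) *\<^sub>R H x)))"
      by (simp only: integral_scaleR_right)
    also have "\<dots> = (CLBINT x. indicator {..t} x *\<^sub>R (exp x *\<^sub>R H x))"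
      by (intro Bochner_Integration.integral_cong) (auto simp: indicator_def simp flip: exp_add)
    finally show ?thesis .
  qed
  have int: "integrable lborel (\<lambda>x. indicator {..t} x *\<^sub>R (exp x *\<^sub>R H x))" for t
  proof -
    interpret E: prob_space exp1 by (rule prob_space_exp1)
    have "integrable exp1 (\<lambda>x. H (t - x))"
      by (rule E.integrable_const_bound[where B = B]) (auto simp: bound)
    then have "integrable lborel (\<lambda>x. exponential_density 1 x *\<^sub>R H (t - x))"
      unfolding exp1_def by (subst (asm) integrable_density) (auto simp: exponential_density_def)
    then have "integrable lborel (\<lambda>x. indicator {..t} (t - x) *\<^sub>R (exp (- x) *\<^sub>R H (t - x)))"
      by (rule Bochner_Integration.integrable_cong[THEN iffD1, rotated -1])
        (auto simp: exponential_density_def indicator_def)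
    from lborel_integrable_real_affine[OF this, of "-1" t]
    have "integrable lborel (\<lambda>x. indicator {..t} x *\<^sub>R (exp (x - t) *\<^sub>R H x))" by simp
    then have "integrable lborel (\<lambda>x. exp t *\<^sub>R (indicator {..t} x *\<^sub>R (exp (x - t) *\<^sub>R H x)))"
      by (rule integrable_scaleR_right)
    then show ?thesis
      by (rule Bochner_Integration.integrable_cong[THEN iffD1, rotated -1])
        (auto simp: indicator_def simp flip: exp_add)
  qed
  have "exp s *\<^sub>R (CLINT x | exp1. H (s - x)) - exp r *\<^sub>R (CLINT x | exp1. H (r - x)) =
      (CLBINT x. indicator {..s} x *\<^sub>R (exp x *\<^sub>R H x) - indicator {..r} x *\<^sub>R (exp x *\<^sub>R H x))"
    unfolding eq by (rule Bochner_Integration.integral_diff[OF int int, symmetric])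
  also have "\<dots> = (CLBINT x. indicator {r..s} x *\<^sub>R (exp x *\<^sub>R H x))"
    using AE_lborel_singleton[of r] \<open>r \<le> s\<close>
    by (intro integral_cong_AE) (auto elim!: eventually_mono simp: indicator_def)
  finally show ?thesis .
qed

lemma mchar_sum_PiM:
  fixes \<nu> :: "'b::euclidean_space measure"
  assumes \<nu>: "prob_space \<nu>" and [measurable_cong]: "sets \<nu> = sets borel"
  shows "mchar (distr (\<Pi>\<^sub>M i\<in>{..<n}. \<nu>) borel (\<lambda>x. \<Sum>i<n. x i)) \<zeta> = mchar \<nu> \<zeta> ^ n"
proof -
  interpret prob_space \<nu> by fact
  interpret product_sigma_finite "\<lambda>_. \<nu>" ..
  have m: "(\<lambda>x. \<Sum>i<n. x i) \<in> borel_measurable (\<Pi>\<^sub>M i\<in>{..<n}. \<nu>)"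
    by (intro borel_measurable_sum measurable_compose[OF measurable_component_singleton]) auto
  have "mchar (distr (\<Pi>\<^sub>M i\<in>{..<n}. \<nu>) borel (\<lambda>x. \<Sum>i<n. x i)) \<zeta> =
      (CLINT x | (\<Pi>\<^sub>M i\<in>{..<n}. \<nu>). iexp (\<zeta> \<bullet> (\<Sum>i<n. x i)))"
    unfolding mchar_def using m by (subst integral_distr) auto
  also have "\<dots> = (CLINT x | (\<Pi>\<^sub>M i\<in>{..<n}. \<nu>). \<Prod>i<n. iexp (\<zeta> \<bullet> x i))"
    by (simp add: inner_sum_right sum_distrib_left exp_sum)
  also have "\<dots> = (\<Prod>i<n. mchar \<nu> \<zeta>)"
    unfolding mchar_def by (intro product_integral_prod) (auto intro!: integrable_const_bound[where B = 1])
  finally show ?thesis by simp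
qed

section \<open>Roots of the limit law\<close>

context elephant_limit
begin

text \<open>Moves the signed transposition from the argument of the characteristic function to the
  random vector, so that \<open>child\<close> can be recognised as the characteristic function of a
  law.\<close>

lemma to_e1_adjoint: "to_e1 u \<zeta> \<bullet> x = \<zeta> \<bullet> to_e1 u x"
proof -
  have "bij (swap j)" for j
    by (rule o_bij[of "swap j"]) (auto simp: fun_eq_iff)
  then have "(\<Sum>i\<in>UNIV. \<zeta> $ swap j i * x $ i) = (\<Sum>i\<in>UNIV. \<zeta> $ i * x $ swap j i)" for j
    by (subst sum.reindex_bij_betw[symmetric, where h = "swap j"]) auto
  then show ?thesis
    by (cases u) (auto simp: inner_vec_def sum_negf)
qed

lemma norm_to_e1: "norm (to_e1 u x) = norm x"
proof -
  have "to_e1 u (to_e1 u x) = x"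
    by (cases u) (auto simp: vec_eq_iff)
  then show ?thesis
    unfolding norm_eq_sqrt_inner to_e1_adjoint by simp
qed

lemma measurable_to_e1 [measurable]: "to_e1 u \<in> borel_measurable borel"
  by (rule borel_measurable_continuous_onI[OF continuous_on_to_e1])

text \<open>The law is realised by drawing the direction u of the child and applying
  \<open>to_e1 u\<close> to an independent vector of law \<mu>. These maps are isometries, so
  integrability of the norm is inherited.\<close>

lemma child_law_exists:
  obtains \<rho> where "prob_space \<rho>" "sets \<rho> = sets borel" "integrable \<rho> norm" "mchar \<rho> = child"
proof -
  interpret L: prob_space "mark_law (Pos i1)" by (rule prob_space_mark_law)
  interpret P: prob_space \<mu> by (rule prob_\<mu>)
  interpret LP: pair_prob_space "mark_law (Pos i1)" \<mu> ..
  let ?LP = "mark_law (Pos i1) \<Otimes>\<^sub>M \<mu>"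
  have fst_meas: "fst \<in> ?LP \<rightarrow>\<^sub>M count_space UNIV"
    using measurable_fst[of "mark_law (Pos i1)" \<mu>] by simp
  have snd_meas [measurable]: "snd \<in> borel_measurable ?LP"
    using measurable_snd[of "mark_law (Pos i1)" \<mu>] measurable_cong_sets[OF refl sets_\<mu>] by blast
  have m [measurable]: "(\<lambda>y. to_e1 (fst y) (snd y)) \<in> borel_measurable ?LP"
    by (rule measurable_compose_countable[where f = "\<lambda>u y. to_e1 u (snd y)", OF _ fst_meas]) measurable
  define \<rho> where "\<rho> = distr ?LP borel (\<lambda>y. to_e1 (fst y) (snd y))"
  show ?thesis
  proof
    show "prob_space \<rho>" unfolding \<rho>_def by (rule LP.prob_space_distr) measurable
    show "sets \<rho> = sets borel" by (simp add: \<rho>_def)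
    have "integrable ?LP (\<lambda>y. norm (snd y))"
    proof -
      have "distr ?LP \<mu> snd = \<mu>"
        by (intro distr_pair_snd L.prob_space_axioms prob_\<mu>)
      then show ?thesis
        using integrable_norm integrable_distr[of snd ?LP \<mu> norm] by simp
    qed
    then show "integrable \<rho> norm"
      unfolding \<rho>_def by (subst integrable_distr_eq) (auto simp: norm_to_e1)
    show "mchar \<rho> = child"
    proof
      fix \<zeta>
      have "mchar \<rho> \<zeta> = (CLINT y | ?LP. iexp (\<zeta> \<bullet> to_e1 (fst y) (snd y)))"
        unfolding mchar_def \<rho>_def by (subst integral_distr) auto
      also have "\<dots> = (CLINT u | mark_law (Pos i1). CLINT x | \<mu>. iexp (\<zeta> \<bullet> to_e1 u x))"
        by (subst LP.integral_fst'[symmetric]) (auto intro!: LP.integrable_const_bound[where B = 1])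
      also have "\<dots> = child \<zeta>"
        by (simp add: integral_mark_law child_def mchar_def to_e1_adjoint)
      finally show "mchar \<rho> \<zeta> = child \<zeta>" .
    qed
  qed
qed

theorem infinitely_divisible_limit: "infinitely_divisible \<mu>"
  unfolding infinitely_divisible_def
proof (intro allI impI)
  fix n :: nat assume n: "1 \<le> n"
  \<comment> \<open>The points of the shot noise have rate 1. Speeding up the discount from
    \<open>a\<close> to a n amounts to rate 1/n in the time of the rays.\<close>
  define b where "b = a * real n"
  have n0: "n \<noteq> 0" using n by simp
  have b: "0 < b" using n a_gt_half by (simp add: b_def)
  obtain \<rho> where \<rho>: "prob_space \<rho>" "sets \<rho> = sets borel" "integrable \<rho> norm" "mchar \<rho> = child"
    using child_law_exists by blast
  obtain \<nu> where \<nu>: "prob_space \<nu>" "sets \<nu> = sets borel"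
    "\<And>\<zeta>. mchar \<nu> \<zeta> = (CLINT r | exp1. child (exp (- b * r) *\<^sub>R \<zeta>) * mchar \<nu> (exp (- b * r) *\<^sub>R \<zeta>))"
    using discounted_sum_exists[OF \<rho>(1-3) b] unfolding \<rho>(4) by blast
  have cont_\<nu>: "continuous_on UNIV (mchar \<nu>)"
    by (rule continuous_mchar[OF \<nu>(1,2)])
  have char_eq: "mchar \<nu> \<zeta> ^ n = mchar \<mu> \<zeta>" for \<zeta>
  proof -
    define y where "y \<sigma> = mchar \<nu> (exp (b * \<sigma>) *\<^sub>R \<zeta>)" for \<sigma>
    define H where "H \<sigma> = child (exp (b * \<sigma>) *\<^sub>R \<zeta>) * y \<sigma>" for \<sigma>
    define h where "h s = mchar \<mu> (exp (a * s) *\<^sub>R \<zeta>)" for s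
    define k where "k s = child (exp (a * s) *\<^sub>R \<zeta>)" for s
    \<comment> \<open>\<open>y\<close> runs in the time of the shot noise, so ray time s corresponds
      to s / n. Both terms of \<open>D\<close> solve the same linear equation z' = z (k - 1), hence
      so does their difference.\<close>
    define D where "D s = y (s / real n) ^ n - h s" for s
    have H_cont: "continuous_on UNIV H"
      unfolding H_def y_def
      by (intro continuous_intros continuous_on_compose2[OF continuous_child] continuous_on_compose2[OF cont_\<nu>]) auto
    have H_meas: "H \<in> borel_measurable borel"
      by (rule borel_measurable_continuous_onI[OF H_cont])
    have H_bound: "cmod (H \<sigma>) \<le> 1" for \<sigma>
      unfolding H_def y_def norm_mult using mult_mono[OF norm_child_le_1 norm_mchar_le_1[OF \<nu>(1)]] by force
    have y_eq: "y \<sigma> = (CLINT r | exp1. H (\<sigma> - r))" for \<sigma>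
    proof -
      have "exp (- (b * r)) * exp (b * \<sigma>) = exp (b * (\<sigma> - r))" for r
        by (simp add: algebra_simps flip: exp_add)
      then show ?thesis
        unfolding y_def[of \<sigma>] by (subst \<nu>(3)) (simp add: H_def y_def)
    qed
    have dy: "(y has_vector_derivative H \<sigma> - y \<sigma>) (at \<sigma>)" for \<sigma>
      using exp1_convolution_increment[OF H_meas H_bound] unfolding y_eq[symmetric]
      by (rule has_vector_derivative_of_exp_increment[OF H_cont])
    have dz: "((\<lambda>s. y (s / real n) ^ n) has_vector_derivative y (s / real n) ^ n * (k s - 1)) (at s)" for s
    proof -
      let ?y = "y (s / real n)"
      have 1: "((\<lambda>s. y (s / real n)) has_vector_derivative (1 / real n) *\<^sub>R (H (s / real n) - ?y)) (at s)"
      proof -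
        have "((\<lambda>s. s / real n) has_vector_derivative 1 / real n) (at s)"
          unfolding has_real_derivative_iff_has_vector_derivative[symmetric]
          using n0 by (auto intro!: derivative_eq_intros)
        from vector_diff_chain_at[OF this dy] show ?thesis by (simp add: comp_def)
      qed
      have 2: "((\<lambda>w. w ^ n) has_field_derivative of_nat n * ?y ^ (n - 1)) (at ?y)"
        by (auto intro!: derivative_eq_intros)
      have "((\<lambda>s. y (s / real n) ^ n) has_vector_derivative
          ((1 / real n) *\<^sub>R (H (s / real n) - ?y)) * (of_nat n * ?y ^ (n - 1))) (at s)"
        using field_vector_diff_chain_at[OF 1 2] by (simp add: comp_def)
      also have "((1 / real n) *\<^sub>R (H (s / real n) - ?y)) * (of_nat n * ?y ^ (n - 1)) = (?y * ?y ^ (n - 1)) * (k s - 1)"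
        using n0 by (simp add: H_def k_def b_def scaleR_conv_of_real algebra_simps)
      also have "?y * ?y ^ (n - 1) = ?y ^ n"
        using n by (cases n) auto
      finally show ?thesis .
    qed
    have dD: "(D has_vector_derivative D s * (k s - 1)) (at s)" for s
    proof -
      have "(h has_vector_derivative h s * (k s - 1)) (at s)"
        unfolding h_def k_def by (rule ray_derivative)
      from has_vector_derivative_diff[OF dz this] show ?thesis
        by (simp add: D_def[abs_def] left_diff_distrib)
    qed
    have dD2: "((\<lambda>s. (cmod (D s))\<^sup>2) has_real_derivative 2 * ((cmod (D s))\<^sup>2 * Re (k s - 1))) (at s)" for s
      using has_real_derivative_norm_power2[OF dD] unfolding inner_mult_self .
    \<comment> \<open>Re k \<le> 1 makes |D| nonincreasing, so it is enough that \<open>D\<close>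
      vanishes at minus infinity, where both characteristic functions tend to their value 1 at the
      origin.\<close>
    have mono: "(cmod (D s))\<^sup>2 \<le> (cmod (D r))\<^sup>2" if "r \<le> s" for r s
    proof (rule DERIV_nonpos_imp_nonincreasing[OF that])
      fix x
      have "Re (k x - 1) \<le> 0"
        using order_trans[OF complex_Re_le_cmod norm_child_le_1] by (simp add: k_def)
      then have "2 * ((cmod (D x))\<^sup>2 * Re (k x - 1)) \<le> 0"
        by (simp add: mult_nonneg_nonpos)
      then show "\<exists>y. ((\<lambda>s. (cmod (D s))\<^sup>2) has_real_derivative y) (at x) \<and> y \<le> 0"
        using dD2 by blast
    qed
    have lim: "(D \<longlongrightarrow> 0) at_bot"
    proof -
      have "((\<lambda>s. exp (a * s)) \<longlongrightarrow> 0) at_bot"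
        using a_gt_half by real_asymp
      from tendsto_scaleR[OF this tendsto_const[of \<zeta>]]
      have e: "((\<lambda>s. exp (a * s) *\<^sub>R \<zeta>) \<longlongrightarrow> 0) at_bot" by simp
      have "isCont (mchar \<mu>) 0" "isCont (mchar \<nu>) 0"
        using continuous_mchar[OF prob_\<mu> sets_\<mu>] cont_\<nu> by (auto simp: continuous_on_eq_continuous_at)
      from tendsto_diff[OF tendsto_power[OF isCont_tendsto_compose[OF this(2) e], of n] isCont_tendsto_compose[OF this(1) e]]
      have "((\<lambda>s. mchar \<nu> (exp (a * s) *\<^sub>R \<zeta>) ^ n - mchar \<mu> (exp (a * s) *\<^sub>R \<zeta>)) \<longlongrightarrow> 0) at_bot"
        using mchar_0[OF prob_\<mu>] mchar_0[OF \<nu>(1)] by simp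
      moreover have "D = (\<lambda>s. mchar \<nu> (exp (a * s) *\<^sub>R \<zeta>) ^ n - mchar \<mu> (exp (a * s) *\<^sub>R \<zeta>))"
        using n by (auto simp: D_def y_def h_def b_def)
      ultimately show ?thesis by simp
    qed
    have "((\<lambda>r. (cmod (D r))\<^sup>2) \<longlongrightarrow> (cmod 0)\<^sup>2) at_bot"
      by (intro tendsto_intros lim)
    moreover have "eventually (\<lambda>r. (cmod (D 0))\<^sup>2 \<le> (cmod (D r))\<^sup>2) at_bot"
      using eventually_le_at_bot[of 0] by eventually_elim (rule mono)
    ultimately have "(cmod (D 0))\<^sup>2 \<le> (cmod 0)\<^sup>2"
      by (rule tendsto_lowerbound) simp
    then show ?thesis by (simp add: D_def y_def h_def)
  qed
  have m: "(\<lambda>x. \<Sum>i<n. x i) \<in> borel_measurable (\<Pi>\<^sub>M i\<in>{..<n}. \<nu>)"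
    using \<nu>(2) by (intro borel_measurable_sum measurable_compose[OF measurable_component_singleton]) auto
  have "\<mu> = distr (\<Pi>\<^sub>M i\<in>{..<n}. \<nu>) borel (\<lambda>x. \<Sum>i<n. x i)"
  proof (rule mchar_eq_imp_measure_eq)
    show "prob_space (distr (\<Pi>\<^sub>M i\<in>{..<n}. \<nu>) borel (\<lambda>x. \<Sum>i<n. x i))"
      by (intro prob_space.prob_space_distr prob_space_PiM \<nu> m)
    show "mchar \<mu> = mchar (distr (\<Pi>\<^sub>M i\<in>{..<n}. \<nu>) borel (\<lambda>x. \<Sum>i<n. x i))"
      by (rule ext) (simp add: mchar_sum_PiM[OF \<nu>(1,2)] char_eq)
  qed (auto simp: prob_\<mu> sets_\<mu>)
  then show "\<exists>\<nu>. prob_space \<nu> \<and> sets \<nu> = sets borel \<and> \<mu> = distr (\<Pi>\<^sub>M i\<in>{..<n}. \<nu>) borel (\<lambda>x. \<Sum>i<n. x i)"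
    using \<nu>(1,2) by blast
qed

end

subsection \<open>The elephant random walk\<close>

lemma card_born_eq_sum_urn_count:
  fixes D :: "ball \<Rightarrow> 'd::finite direction \<Rightarrow> 'a \<Rightarrow> 'd direction"
  assumes "finite {b. birth_time T b \<omega> \<le> s}"
  shows "card {b. birth_time T b \<omega> \<le> s} = (\<Sum>v\<in>UNIV. urn_count i1 T D s \<omega> v)"
proof -
  have "{b. birth_time T b \<omega> \<le> s} = (\<Union>v\<in>UNIV. {b. birth_time T b \<omega> \<le> s \<and> ball_direction i1 D b \<omega> = v})"
    by auto
  then have "card {b. birth_time T b \<omega> \<le> s} = card (\<Union>v\<in>UNIV. {b. birth_time T b \<omega> \<le> s \<and> ball_direction i1 D b \<omega> = v})"
    by (rule arg_cong)
  also have "\<dots> = (\<Sum>v\<in>UNIV. card {b. birth_time T b \<omega> \<le> s \<and> ball_direction i1 D b \<omega> = v})"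
  proof (rule card_UN_disjoint)
    show "\<forall>v\<in>UNIV. finite {b. birth_time T b \<omega> \<le> s \<and> ball_direction i1 D b \<omega> = v}"
      by (intro ballI finite_subset[OF _ assms]) auto
  qed auto
  finally show ?thesis by (simp add: urn_count_def)
qed

text \<open>Given finiteness, the jump times are the successive distinct birth times. Only a strict
  increase of the number of balls is claimed, since on a given path several balls may be born at
  once.\<close>

lemma jump_time_Suc:
  fixes T :: "ball \<Rightarrow> nat \<Rightarrow> 'a \<Rightarrow> real" and i1 :: "'d::finite" and \<omega> :: 'a
    and D :: "ball \<Rightarrow> 'd direction \<Rightarrow> 'a \<Rightarrow> 'd direction"
  assumes fin: "\<And>s. finite {b. birth_time T b \<omega> \<le> s}"
  defines "J \<equiv> \<lambda>n. jump_time i1 T D n \<omega>" and "B \<equiv> \<lambda>s. {b. birth_time T b \<omega> \<le> s}"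
  shows "J n < J (Suc n)" "card (B (J n)) < card (B (J (Suc n)))"
    "\<And>t. J n \<le> t \<Longrightarrow> t < J (Suc n) \<Longrightarrow> B t = B (J n)"
proof -
  let ?s = "J n"
  have fin_B: "finite (B s)" for s unfolding B_def by (rule fin)
  have B_mono: "B r \<subseteq> B s" if "r \<le> s" for r s
    using that by (auto simp: B_def)
  \<comment> \<open>There are infinitely many names of balls, so some \<open>b0\<close> is still
    unborn. Births after the jump and up to that of \<open>b0\<close> are finitely many and their
    minimum exists.\<close>
  obtain b0 where b0: "b0 \<notin> B ?s"
    using fin_B[of ?s] infinite_UNIV_listI ex_new_if_finite by metis
  define F where "F = (\<lambda>b. birth_time T b \<omega>) ` (B (birth_time T b0 \<omega>) - B ?s)"
  define m where "m = Min F"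
  have F: "finite F" "F \<noteq> {}"
    using fin_B b0 by (auto simp: F_def B_def)
  have F_gt: "?s < x" if "x \<in> F" for x
    using that by (auto simp: F_def B_def)
  have m: "m \<in> F" unfolding m_def using F by (rule Min_in)
  have m_le: "m \<le> birth_time T b \<omega>" if "b \<notin> B ?s" for b
  proof (cases "birth_time T b \<omega> \<le> birth_time T b0 \<omega>")
    case True
    then show ?thesis unfolding m_def using that F by (intro Min_le) (auto simp: F_def B_def)
  next
    case False
    have "m \<le> birth_time T b0 \<omega>" using m by (auto simp: F_def B_def)
    then show ?thesis using False by simp
  qed
  have before: "B t = B ?s" if "?s \<le> t" "t < m" for t
  proof
    show "B t \<subseteq> B ?s"
    proof
      fix b assume "b \<in> B t"
      then show "b \<in> B ?s" using m_le[of b] that by (force simp: B_def)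
    qed
  qed (rule B_mono[OF that(1)])
  have after: "card (B ?s) < card (B t)" if "m \<le> t" for t
  proof (rule psubset_card_mono[OF fin_B])
    obtain b where b: "b \<notin> B ?s" "birth_time T b \<omega> = m" using m by (auto simp: F_def)
    have "?s < m" using F_gt[OF m] .
    moreover have "b \<in> B t" using that b by (simp add: B_def)
    ultimately show "B ?s \<subset> B t" using that b(1) B_mono[of ?s t] by auto
  qed
  \<comment> \<open>Balls are never removed, so a total that has changed never returns: the set is
    the whole half line from the next birth time on, and the infimum is attained.\<close>
  have "{t. ?s < t \<and> urn_count i1 T D t \<omega> \<noteq> urn_count i1 T D ?s \<omega>} = {m..}"
  proof (intro set_eqI iffI)
    fix t assume t: "t \<in> {t. ?s < t \<and> urn_count i1 T D t \<omega> \<noteq> urn_count i1 T D ?s \<omega>}"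
    show "t \<in> {m..}"
    proof (rule ccontr)
      assume "t \<notin> {m..}"
      then have "B t = B ?s" using t by (intro before) auto
      then have "birth_time T b \<omega> \<le> t \<longleftrightarrow> birth_time T b \<omega> \<le> ?s" for b
        by (auto simp: B_def)
      then have "urn_count i1 T D t \<omega> = urn_count i1 T D ?s \<omega>"
        by (simp add: fun_eq_iff urn_count_def)
      then show False using t by simp
    qed
  next
    fix t assume t: "t \<in> {m..}"
    have "urn_count i1 T D t \<omega> \<noteq> urn_count i1 T D ?s \<omega>"
    proof
      assume eq: "urn_count i1 T D t \<omega> = urn_count i1 T D ?s \<omega>"
      have "card (B t) = card (B ?s)"
        unfolding B_def card_born_eq_sum_urn_count[OF fin, of _ i1 D] eq ..
      then show False using after[of t] t by simp
    qed
    then show "t \<in> {t. ?s < t \<and> urn_count i1 T D t \<omega> \<noteq> urn_count i1 T D ?s \<omega>}"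
      using F_gt[OF m] t by auto
  qed
  then have J_Suc: "J (Suc n) = m"
    by (simp add: J_def)
  show "J n < J (Suc n)" unfolding J_Suc by (rule F_gt[OF m])
  show "card (B (J n)) < card (B (J (Suc n)))" unfolding J_Suc by (rule after) simp
  show "B t = B (J n)" if "J n \<le> t" "t < J (Suc n)" for t
    using that unfolding J_Suc by (rule before)
qed

text \<open>\<open>n\<close> is the last jump up to \<open>s\<close>; it exists because every jump
  adds a ball. Step \<open>Suc n\<close> of the walk shows the urn after jump \<open>n\<close>. The
  population bounds the step from above, and the last claim makes it large.\<close>

lemma urn_difference_eq_elephant_walk:
  fixes D :: "ball \<Rightarrow> 'd::finite direction \<Rightarrow> 'a \<Rightarrow> 'd direction"
  assumes fin: "\<And>s. finite {b. birth_time T b \<omega> \<le> s}" and "0 \<le> s"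
  obtains n where "urn_difference i1 T D s \<omega> = elephant_walk i1 T D (Suc n) \<omega>"
    "Suc n \<le> card {b. birth_time T b \<omega> \<le> s}"
    "\<And>k. jump_time i1 T D k \<omega> \<le> s \<Longrightarrow> k \<le> n"
proof -
  define J where "J n = jump_time i1 T D n \<omega>" for n
  define B where "B s = {b. birth_time T b \<omega> \<le> s}" for s
  note jump = jump_time_Suc[OF fin, of i1 D, folded J_def B_def]
  have fin_B: "finite (B s)" for s unfolding B_def by (rule fin)
  have B_mono: "B r \<subseteq> B s" if "r \<le> s" for r s
    using that by (auto simp: B_def)
  have card_B: "Suc n \<le> card (B (J n))" for n
  proof (induction n)
    case 0
    have "[] \<in> B (J 0)" by (simp add: B_def J_def)
    then show ?case using fin_B[of "J 0"] by (auto simp: Suc_le_eq card_gt_0_iff)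
  next
    case (Suc n)
    then show ?case using jump(2)[of n] by simp
  qed
  have bound: "Suc k \<le> card (B s)" if "J k \<le> s" for k
    using card_B[of k] card_mono[OF fin_B B_mono[OF that]] by simp
  define K where "K = {k. J k \<le> s}"
  have "K \<subseteq> {..card (B s)}" using bound by (force simp: K_def)
  then have K: "finite K" by (rule finite_subset) simp
  have "0 \<in> K" using \<open>0 \<le> s\<close> by (simp add: K_def J_def)
  define n where "n = Max K"
  have nK: "n \<in> K" unfolding n_def using K \<open>0 \<in> K\<close> by (intro Max_in) auto
  have n_max: "k \<le> n" if "J k \<le> s" for k
    unfolding n_def using K that by (intro Max_ge) (auto simp: K_def)
  have "s < J (Suc n)" using n_max[of "Suc n"] by force
  then have "B s = B (J n)" using nK by (intro jump(3)) (auto simp: K_def)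
  then have "birth_time T b \<omega> \<le> s \<longleftrightarrow> birth_time T b \<omega> \<le> J n" for b
    by (auto simp: B_def)
  then have "urn_difference i1 T D s \<omega> = elephant_walk i1 T D (Suc n) \<omega>"
    by (simp add: elephant_walk_def urn_difference_def urn_count_def J_def)
  moreover have "Suc n \<le> card (B s)" using nK by (intro bound) (simp add: K_def)
  ultimately show ?thesis using that[of n] n_max by (simp add: B_def J_def)
qed

text \<open>Comparing time scales along a subsequence on which the urn has at most \<open>C e\<^sup>m\<close> balls at
  time \<open>m\<close> replaces the almost sure convergence of \<open>n exp (- \<tau>\<^sub>n)\<close>.\<close>

lemma urn_limit_eq_0_of_walk_limit_eq_0:
  fixes D :: "ball \<Rightarrow> 'd::finite direction \<Rightarrow> 'a \<Rightarrow> 'd direction"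
  assumes fin: "\<And>s. finite {b. birth_time T b \<omega> \<le> s}" and "0 < a"
    and W: "((\<lambda>t. urn_difference i1 T D t \<omega> /\<^sub>R exp (a * t)) \<longlongrightarrow> W) at_top"
    and Y: "(\<lambda>n. elephant_walk i1 T D n \<omega> /\<^sub>R (real n powr a)) \<longlonglongrightarrow> 0"
    and freq: "frequently (\<lambda>m. real (card {b. birth_time T b \<omega> \<le> real m}) \<le> C * exp (real m)) sequentially"
  shows "W = 0"
proof (rule ccontr)
  assume "W \<noteq> 0"
  obtain m0 :: nat where m0: "real (card {b. birth_time T b \<omega> \<le> real m0}) \<le> C * exp (real m0)"
    using frequently_ex[OF freq] by blast
  then have C: "0 \<le> C"
    by (meson of_nat_0_le_iff order_trans zero_le_mult_iff exp_gt_zero not_le)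
  \<comment> \<open>Chosen so that \<open>e * C powr a\<close> is at most half of
    \<open>norm W\<close>; the \<open>+ 1\<close> covers \<open>C = 0\<close>.\<close>
  define e where "e = norm W / (2 * (C powr a + 1))"
  have e: "0 < e" using \<open>W \<noteq> 0\<close> by (simp add: e_def add_nonneg_pos)
  have "(\<lambda>n. norm (elephant_walk i1 T D n \<omega> /\<^sub>R (real n powr a))) \<longlonglongrightarrow> 0"
    using Y by (rule tendsto_norm_zero)
  then have "eventually (\<lambda>n. norm (elephant_walk i1 T D n \<omega> /\<^sub>R (real n powr a)) < e) sequentially"
    using e by (rule order_tendstoD)
  then obtain k where k: "\<And>n. k \<le> n \<Longrightarrow> norm (elephant_walk i1 T D n \<omega> /\<^sub>R (real n powr a)) < e"
    by (auto simp: eventually_sequentially)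
  have "(\<lambda>m. norm (urn_difference i1 T D (real m) \<omega> /\<^sub>R exp (a * real m))) \<longlonglongrightarrow> norm W"
    using filterlim_compose[OF W filterlim_real_sequentially] by (rule tendsto_norm)
  moreover have "norm W / 2 < norm W" using \<open>W \<noteq> 0\<close> by simp
  ultimately have "eventually (\<lambda>m. norm W / 2 < norm (urn_difference i1 T D (real m) \<omega> /\<^sub>R exp (a * real m))) sequentially"
    by (rule order_tendstoD)
  \<comment> \<open>Once jump \<open>k\<close> has happened, the step of the walk visible at time m
    is beyond \<open>k\<close>, where the walk is already smaller than \<open>e\<close> in its own
    scaling.\<close>
  moreover have "eventually (\<lambda>m. jump_time i1 T D k \<omega> \<le> real m) sequentially"
    using filterlim_real_sequentially by (simp add: filterlim_at_top)
  ultimately have "eventually (\<lambda>m. norm W / 2 < norm (urn_difference i1 T D (real m) \<omega> /\<^sub>R exp (a * real m)) \<and>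
      jump_time i1 T D k \<omega> \<le> real m) sequentially"
    by (rule eventually_conj)
  from frequently_eventually_frequently[OF freq this]
  have "frequently (\<lambda>m. real (card {b. birth_time T b \<omega> \<le> real m}) \<le> C * exp (real m) \<and>
      norm W / 2 < norm (urn_difference i1 T D (real m) \<omega> /\<^sub>R exp (a * real m)) \<and> jump_time i1 T D k \<omega> \<le> real m) sequentially"
    by simp
  then obtain m :: nat where m: "real (card {b. birth_time T b \<omega> \<le> real m}) \<le> C * exp (real m)"
      "norm W / 2 < norm (urn_difference i1 T D (real m) \<omega> /\<^sub>R exp (a * real m))" "jump_time i1 T D k \<omega> \<le> real m"
    using frequently_ex by blast
  obtain n where n: "urn_difference i1 T D (real m) \<omega> = elephant_walk i1 T D (Suc n) \<omega>"
      "Suc n \<le> card {b. birth_time T b \<omega> \<le> real m}" "k \<le> n"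
    using urn_difference_eq_elephant_walk[OF fin, of "real m" i1 D] m(3) by (metis of_nat_0_le_iff)
  have "real (Suc n) \<le> C * exp (real m)"
    using n(2) m(1) by (meson of_nat_le_iff order_trans)
  then have "real (Suc n) powr a \<le> (C * exp (real m)) powr a"
    using \<open>0 < a\<close> by (intro powr_mono2) auto
  also have "\<dots> = C powr a * exp (a * real m)"
    using C by (simp add: powr_mult exp_powr_real mult.commute)
  finally have le: "real (Suc n) powr a / exp (a * real m) \<le> C powr a"
    by (simp add: divide_le_eq)
  have "norm (urn_difference i1 T D (real m) \<omega> /\<^sub>R exp (a * real m)) =
      norm (elephant_walk i1 T D (Suc n) \<omega> /\<^sub>R (real (Suc n) powr a)) * (real (Suc n) powr a / exp (a * real m))"
    by (simp add: n(1) field_simps)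
  also have "\<dots> \<le> e * C powr a"
    using k[of "Suc n"] n(3) e le by (intro mult_mono) auto
  also have "\<dots> \<le> e * (C powr a + 1)" using e by simp
  also have "\<dots> = norm W / 2"
  proof -
    have "u / (2 * x) * x = u / 2" if "0 < x" for u x :: real
      using that by simp
    then show ?thesis unfolding e_def by (simp only: add_nonneg_pos powr_ge_zero zero_less_one)
  qed
  finally show False using m(2) by simp
qed

text \<open>The population divided by exp m has mean at most 1, so by Fatou its liminf is almost
  surely finite; a bound along infinitely many m is all that a liminf provides.\<close>

lemma AE_clock_frequently_bounded:
  "AE t in clock_space. \<exists>C. frequently (\<lambda>m. real (card {b. born b t \<le> real m}) \<le> C * exp (real m)) sequentially"
proof -
  define f where "f m t = ennreal (exp (- real m)) * (SUP n. population n (real m) t)" for m t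
  have f_meas [measurable]: "f m \<in> borel_measurable clock_space" for m
    unfolding f_def by measurable
  have "(\<integral>\<^sup>+t. f m t \<partial>clock_space) \<le> 1" for m
  proof -
    have "(\<integral>\<^sup>+t. f m t \<partial>clock_space) = ennreal (exp (- real m)) * (\<integral>\<^sup>+t. (SUP n. population n (real m) t) \<partial>clock_space)"
      unfolding f_def by (rule nn_integral_cmult) measurable
    also have "\<dots> \<le> ennreal (exp (- real m)) * ennreal (exp (real m))"
      by (intro mult_left_mono nn_integral_SUP_population_le) auto
    also have "\<dots> = 1"
      by (simp flip: ennreal_mult exp_add)
    finally show ?thesis .
  qed
  then have "liminf (\<lambda>m. \<integral>\<^sup>+t. f m t \<partial>clock_space) \<le> 1"
    by (intro Liminf_le) auto
  moreover have "(\<integral>\<^sup>+t. liminf (\<lambda>m. f m t) \<partial>clock_space) \<le> liminf (\<lambda>m. \<integral>\<^sup>+t. f m t \<partial>clock_space)"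
    by (rule nn_integral_liminf) measurable
  ultimately have "(\<integral>\<^sup>+t. liminf (\<lambda>m. f m t) \<partial>clock_space) \<le> 1" by (rule order_trans[rotated])
  then have "(\<integral>\<^sup>+t. liminf (\<lambda>m. f m t) \<partial>clock_space) \<noteq> \<infinity>"
    by (auto simp: top_unique)
  then have "AE t in clock_space. liminf (\<lambda>m. f m t) \<noteq> \<infinity>"
    by (intro nn_integral_PInf_AE) measurable
  then show ?thesis
    using AE_finite_born
  proof eventually_elim
    fix t assume lim: "liminf (\<lambda>m. f m t) \<noteq> \<infinity>" and fin: "\<forall>s. finite {b. born b t \<le> s}"
    obtain C :: nat where C: "liminf (\<lambda>m. f m t) < of_nat C"
      using lim ennreal_Ex_less_of_nat by (auto simp: less_top)
    have f_eq: "f m t = ennreal (exp (- real m) * real (card {b. born b t \<le> real m}))" for m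
      using fin by (simp add: f_def SUP_population_eq ennreal_of_nat_eq_real_of_nat ennreal_mult)
    have "frequently (\<lambda>m. real (card {b. born b t \<le> real m}) \<le> real C * exp (real m)) sequentially"
      unfolding frequently_def
    proof
      assume "eventually (\<lambda>m. \<not> real (card {b. born b t \<le> real m}) \<le> real C * exp (real m)) sequentially"
      then have "eventually (\<lambda>m. of_nat C \<le> f m t) sequentially"
      proof eventually_elim
        fix m assume "\<not> real (card {b. born b t \<le> real m}) \<le> real C * exp (real m)"
        then have "exp (- real m) * (real C * exp (real m)) \<le> exp (- real m) * real (card {b. born b t \<le> real m})"
          by (intro mult_left_mono) auto
        moreover have "exp (- real m) * (real C * exp (real m)) = real C"
          by (simp add: exp_minus)
        ultimately show "of_nat C \<le> f m t"
          unfolding f_eq ennreal_of_nat_eq_real_of_nat by (intro ennreal_leI) simp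
      qed
      then have "of_nat C \<le> liminf (\<lambda>m. f m t)" by (rule Liminf_bounded)
      then show False using C by simp
    qed
    then show "\<exists>C. frequently (\<lambda>m. real (card {b. born b t \<le> real m}) \<le> C * exp (real m)) sequentially" by blast
  qed
qed

lemma (in elephant_parameters) AE_urn_frequently_bounded:
  fixes M :: "'a measure" and T :: "ball \<Rightarrow> nat \<Rightarrow> 'a \<Rightarrow> real"
    and D :: "ball \<Rightarrow> 'd direction \<Rightarrow> 'a \<Rightarrow> 'd direction"
  assumes "urn M p T D"
  shows "AE \<omega> in M. \<exists>C. frequently (\<lambda>m. real (card {b. birth_time T b \<omega> \<le> real m}) \<le> C * exp (real m)) sequentially"
proof -
  let ?P = "\<lambda>t. \<exists>C. frequently (\<lambda>m. real (card {b. born b t \<le> real m}) \<le> C * exp (real m)) sequentially"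
  have "AE t in distr tree_space clock_space fst. ?P t"
    unfolding distr_fst_tree by (rule AE_clock_frequently_bounded)
  then have "AE x in distr M tree_space (driving T D). ?P (fst x)"
    unfolding distr_driving(2)[OF assms] by (rule AE_distrD[OF measurable_fst_tree])
  from AE_distrD[OF distr_driving(1)[OF assms] this] show ?thesis
    by (simp add: driving_def birth_time_eq_born)
qed

section \<open>Assembly of the assertions\<close>

theorem proposition2p3:
  fixes M :: "'a measure" and p :: real and i1 :: "'d::finite"
    and T :: "ball \<Rightarrow> nat \<Rightarrow> 'a \<Rightarrow> real"
    and D :: "ball \<Rightarrow> 'd direction \<Rightarrow> 'a \<Rightarrow> 'd direction"
    and W Y :: "'a \<Rightarrow> real ^ 'd"
  defines "d \<equiv> real CARD('d)"
  defines "a \<equiv> (2 * d * p - 1) / (2 * d - 1)"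
  defines "w \<equiv> (\<lambda>\<omega>. \<Sum>i\<in>UNIV. W \<omega> $ i)"
  defines "\<phi> \<equiv> char (distr M borel w)"
  defines "f \<equiv> (\<lambda>x. Re (\<phi> x))" and "g \<equiv> (\<lambda>x. Im (\<phi> x))"
  assumes p: "(2 * d + 1) / (4 * d) < p" "p < 1"
    and urn: "urn M p T D"
    and W_measurable: "W \<in> borel_measurable M"
    and W_limit: "AE \<omega> in M.
      ((\<lambda>t. urn_difference i1 T D t \<omega> /\<^sub>R exp (a * t)) \<longlongrightarrow> W \<omega>) at_top"
    and Y_measurable: "Y \<in> borel_measurable M"
    and Y_limit: "AE \<omega> in M.
      (\<lambda>n. elephant_walk i1 T D n \<omega> /\<^sub>R (real n powr a)) \<longlonglongrightarrow> Y \<omega>"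
  shows "Limsup at_infinity (\<lambda>x. ereal (\<bar>x\<bar> powr (1 / a) * \<bar>f x\<bar>)) < \<infinity>
    \<and> Limsup at_infinity (\<lambda>x. ereal (\<bar>x\<bar> powr (1 / a) * \<bar>g x\<bar>)) < \<infinity>
    \<and> (SUP x. ereal (\<bar>x\<bar> powr (1 / a) * cmod (\<phi> x))) < \<infinity>
    \<and> integrable lborel (\<lambda>x. cmod (\<phi> x))
    \<and> (\<exists>p_w :: real \<Rightarrow> real. (\<forall>x. 0 \<le> p_w x)
        \<and> distributed M lborel w (\<lambda>x. ennreal (p_w x))
        \<and> (\<forall>x. complex_of_real (p_w x) =
              1 / (2 * complex_of_real pi) * (CLBINT z. iexp (- (x * z)) * \<phi> z)))
    \<and> \<P>(\<omega> in M. W \<omega> = 0) = 0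
    \<and> \<P>(\<omega> in M. Y \<omega> = 0) = 0
    \<and> infinitely_divisible (distr M borel W)"
proof -
  interpret urn M p T D by (rule urn)
  interpret E: elephant_parameters p i1
    using p by unfold_locales (simp_all add: d_def)
  have a_eq: "a = E.a"
    by (simp add: a_def E.a_def E.dim_def d_def)
  have a_pos: "0 < a" using E.a_gt_half by (simp add: a_eq)
  have W_limit': "AE \<omega> in M. ((\<lambda>t. urn_difference i1 T D t \<omega> /\<^sub>R exp (E.a * t)) \<longlongrightarrow> W \<omega>) at_top"
    using W_limit by (simp add: a_eq)
  note [measurable] = W_measurable
  have prob_W: "prob_space (distr M borel W)" by (rule prob_space_distr) measurable
  interpret L: elephant_limit p i1 "distr M borel W"
    by (intro elephant_limit.intro elephant_limit_axioms.intro E.elephant_parameters_axioms prob_W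
      E.urn_limit_cf[OF urn W_measurable W_limit']) simp
  have w_meas [measurable]: "w \<in> borel_measurable M"
    unfolding w_def by measurable
  interpret w: real_distribution "distr M borel w"
    by (rule real_distribution_distr) measurable
  have \<phi>_eq: "\<phi> x = L.\<phi> x" for x
  proof -
    have "\<phi> x = (CLINT \<omega> | M. iexp (x * w \<omega>))"
      unfolding \<phi>_def char_def by (subst integral_distr) auto
    also have "\<dots> = (CLINT \<omega> | M. iexp ((\<chi> i. x) \<bullet> W \<omega>))"
      by (simp add: w_def inner_vec_def sum_distrib_left)
    also have "\<dots> = L.\<phi> x"
      unfolding L.\<phi>_def mchar_def by (subst integral_distr) auto
    finally show ?thesis .
  qed
  obtain C where "\<And>x. \<bar>x\<bar> powr (1 / E.a) * cmod (L.\<phi> x) \<le> C"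
    using L.\<phi>_decay by blast
  then have C: "\<bar>x\<bar> powr (1 / a) * cmod (\<phi> x) \<le> C" for x
    by (simp add: a_eq \<phi>_eq)
  have C_Re: "\<bar>x\<bar> powr (1 / a) * \<bar>f x\<bar> \<le> C" and C_Im: "\<bar>x\<bar> powr (1 / a) * \<bar>g x\<bar> \<le> C" for x
    using order_trans[OF mult_left_mono[OF abs_Re_le_cmod] C] order_trans[OF mult_left_mono[OF abs_Im_le_cmod] C]
    by (auto simp: f_def g_def)
  have Limsup_finite: "Limsup at_infinity (\<lambda>x. ereal (h x)) < \<infinity>" if "\<And>x. h x \<le> C" for h :: "real \<Rightarrow> real"
  proof -
    have "Limsup at_infinity (\<lambda>x. ereal (h x)) \<le> ereal C"
      by (rule Limsup_bounded) (simp add: that)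
    then show ?thesis by (rule le_less_trans) simp
  qed
  have "(SUP x. ereal (\<bar>x\<bar> powr (1 / a) * cmod (\<phi> x))) \<le> ereal C"
    by (rule SUP_least) (simp add: C)
  then have SUP_finite: "(SUP x. ereal (\<bar>x\<bar> powr (1 / a) * cmod (\<phi> x))) < \<infinity>"
    by (rule le_less_trans) simp
  have int_\<phi>: "integrable lborel (\<lambda>x. cmod (\<phi> x))"
    using L.integrable_\<phi> by (simp add: \<phi>_eq)
  obtain p_w where p_w: "\<And>x. 0 \<le> p_w x" "p_w \<in> borel_measurable borel"
      "distr M borel w = density lborel (\<lambda>x. ennreal (p_w x))"
      "\<And>x. complex_of_real (p_w x) = 1 / (2 * complex_of_real pi) * (CLBINT z. iexp (- (x * z)) * \<phi> z)"
    by (rule integrable_char_density[OF w.real_distribution_axioms int_\<phi>[unfolded \<phi>_def], folded \<phi>_def]) blast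
  have w_distributed: "distributed M lborel w (\<lambda>x. ennreal (p_w x))"
    unfolding distributed_def
  proof (intro conjI)
    show "distr M lborel w = density lborel (\<lambda>x. ennreal (p_w x))"
      unfolding p_w(3)[symmetric] by (rule distr_cong) simp_all
    show "w \<in> M \<rightarrow>\<^sub>M lborel" using w_meas by simp
    show "(\<lambda>x. ennreal (p_w x)) \<in> borel_measurable lborel" using p_w(2) by simp
  qed
  \<comment> \<open>W = 0 forces the coordinate sum \<open>w\<close> to vanish, which has
    probability 0 because \<open>w\<close> has a density.\<close>
  have W_nonzero: "AE \<omega> in M. W \<omega> \<noteq> 0"
  proof -
    have "AE x in density lborel (\<lambda>x. ennreal (p_w x)). x \<noteq> 0"
      using p_w(2) AE_lborel_singleton[of "0 :: real"] by (subst AE_density) (auto elim: eventually_mono)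
    then have "AE x in distr M borel w. x \<noteq> 0" by (simp only: p_w(3))
    from AE_distrD[OF w_meas this] show ?thesis
      by eventually_elim (auto simp: w_def)
  qed
  have Y_nonzero: "AE \<omega> in M. Y \<omega> \<noteq> 0"
    using W_nonzero W_limit Y_limit E.AE_urn_finite[OF urn] E.AE_urn_frequently_bounded[OF urn]
  proof eventually_elim
    fix \<omega>
    assume *: "W \<omega> \<noteq> 0" "((\<lambda>t. urn_difference i1 T D t \<omega> /\<^sub>R exp (a * t)) \<longlongrightarrow> W \<omega>) at_top"
      "(\<lambda>n. elephant_walk i1 T D n \<omega> /\<^sub>R (real n powr a)) \<longlonglongrightarrow> Y \<omega>"
      "\<forall>s. finite {b. birth_time T b \<omega> \<le> s}"
      "\<exists>C. frequently (\<lambda>m. real (card {b. birth_time T b \<omega> \<le> real m}) \<le> C * exp (real m)) sequentially"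
    then obtain C where "frequently (\<lambda>m. real (card {b. birth_time T b \<omega> \<le> real m}) \<le> C * exp (real m)) sequentially"
      by blast
    with * show "Y \<omega> \<noteq> 0"
      using urn_limit_eq_0_of_walk_limit_eq_0[of T \<omega> a i1 D "W \<omega>" C] a_pos by auto
  qed
  have prob_0: "\<P>(\<omega> in M. Z \<omega> = 0) = 0" if [measurable]: "Z \<in> borel_measurable M" and nz: "AE \<omega> in M. Z \<omega> \<noteq> 0"
    for Z :: "'a \<Rightarrow> real ^ 'd"
  proof -
    have Z_meas: "{\<omega> \<in> space M. \<not> Z \<omega> \<noteq> 0} \<in> sets M" by measurable
    have "emeasure M {\<omega> \<in> space M. \<not> Z \<omega> \<noteq> 0} = 0"
      by (rule AE_iff_measurable[THEN iffD1, OF Z_meas refl nz])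
    then show ?thesis by (simp add: measure_def)
  qed
  show ?thesis
    using Limsup_finite[of "\<lambda>x. \<bar>x\<bar> powr (1 / a) * \<bar>f x\<bar>"] Limsup_finite[of "\<lambda>x. \<bar>x\<bar> powr (1 / a) * \<bar>g x\<bar>"]
      C_Re C_Im SUP_finite int_\<phi> p_w(1,4) w_distributed prob_0[OF W_measurable W_nonzero] prob_0[OF Y_measurable Y_nonzero]
      L.infinitely_divisible_limit
    by blast
qed

end
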